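(* Let $\Omega\subset\mathbb{R}^3$ be a simply-connected polyhedral domain, let $\mathcal{T}^h$ be any triangulation of $\overline{\Omega}$ by tetrahedra, and let $\underline{\mathbb{E}}^h$ be the associated finite element space. Then there exists one and only one $\underline{\boldsymbol{\varepsilon}}^h\in\underline{\mathbb{E}}^h$ such that $$j(\underline{\boldsymbol{\varepsilon}}^h)=\inf_{\underline{\boldsymbol{e}}^h\in\underline{\mathbb{E}}^h}j(\underline{\boldsymbol{e}}^h).$$ Besides, $\underline{\boldsymbol{\varepsilon}}^h=\nabla_s\dot{\boldsymbol{u}}^h$, where $\dot{\boldsymbol{u}}^h$ is the unique solution in $\dot{\boldsymbol{V}}^h$ to the minimization problem $$J(\dot{\boldsymbol{u}}^h)=\inf_{\dot{\boldsymbol{v}}^h\in\dot{\boldsymbol{V}}^h}J(\dot{\boldsymbol{v}}^h).$$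
   Context: A domain is an open, bounded, connected subset of $\mathbb{R}^3$ with Lipschitz boundary; $\Gamma=\partial\Omega$. $\mathbb{S}^3$ is the space of symmetric $3\times3$ real matrices and $\underline{\boldsymbol{a}}:\underline{\boldsymbol{b}}$ is the matrix inner product. $\nabla_s\boldsymbol{v}=\frac12(\nabla\boldsymbol{v}^\top+\nabla\boldsymbol{v})$. Elasticity data: constants $\lambda>0$, $\mu>0$; $A\underline{\boldsymbol{e}}=\lambda(\mathrm{tr}\,\underline{\boldsymbol{e}})\mathbf{I}_3+2\mu\underline{\boldsymbol{e}}$ for $\underline{\boldsymbol{e}}\in\mathbb{S}^3$; $\boldsymbol{f}\in L^{6/5}(\Omega;\mathbb{R}^3)$, $\boldsymbol{g}\in L^{4/3}(\Gamma;\mathbb{R}^3)$; $L(\boldsymbol{v})=\int_\Omega\boldsymbol{f}\cdot\boldsymbol{v}\,dx+\int_\Gamma\boldsymbol{g}\cdot\boldsymbol{v}\,d\Gamma$. Let $\boldsymbol{R}(\Omega)=\{\boldsymbol{r}\in H^1(\Omega;\mathbb{R}^3):\nabla_s\boldsymbol{r}=0\}=\{\boldsymbol{a}+\boldsymbol{b}\wedge\boldsymbol{x}:\boldsymbol{a},\boldsymbol{b}\in\mathbb{R}^3\}$. It is assumed that $L(\boldsymbol{r})=0$ for all $\boldsymbol{r}\in\boldsymbol{R}(\Omega)$. Displacement functional: $J(\boldsymbol{v})=\frac12\int_\Omega A\nabla_s\boldsymbol{v}:\nabla_s\boldsymbol{v}\,dx-L(\boldsymbol{v})$ for $\boldsymbol{v}\in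 H^1(\Omega;\mathbb{R}^3)$; by the assumption on $L$, $J$ is also well defined on $\dot H^1(\Omega;\mathbb{R}^3):=H^1(\Omega;\mathbb{R}^3)/\boldsymbol{R}(\Omega)$. Strain functional: $\underline{\boldsymbol{E}}(\Omega)=\{\underline{\boldsymbol{e}}\in L^2(\Omega;\mathbb{S}^3):\mathbf{curl}\,\mathbf{curl}\,\underline{\boldsymbol{e}}=0\text{ in }H^{-2}(\Omega;\mathbb{R}^{3\times3})\}$, where $(\mathbf{curl}\,\mathbf{curl}\,\underline{\boldsymbol{e}})_{ij}=\sum_{k,l,m,n}\epsilon_{ilk}\epsilon_{jmn}\partial_{lm}e_{kn}$ with $\epsilon$ the Levi-Civita symbol. For $\Omega$ simply connected it is known that for each $\underline{\boldsymbol{e}}\in\underline{\boldsymbol{E}}(\Omega)$ there is a unique $\kappa(\underline{\boldsymbol{e}})\in\dot H^1(\Omega;\mathbb{R}^3)$ with $\nabla_s\kappa(\underline{\boldsymbol{e}})=\underline{\boldsymbol{e}}$, and that $\kappa$ is an isomorphism of Hilbert spaces. Set $j(\underline{\boldsymbol{e}})=\frac12\int_\Omega A\underline{\boldsymbol{e}}:\underline{\boldsymbol{e}}\,dx-l(\underline{\boldsymbol{e}})$ with $l=L\circ\kappa$, for $\underline{\boldsymbol{e}}\in\underline{\boldsymbol{E}}(\Omega)$. Finite element spaces: $\mathcal{T}^h$ is a conforming triangulation of $\overline\Omega$ by non-degenerate (closed) tetrahedra; each edge $\sigma$ of $\mathcal{T}^h$ is given a unit vector $\boldsymbol{\tau}$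 parallel to it. $\tilde{\underline{\mathbb{E}}}^h$ is the space of $\underline{\boldsymbol{e}}^h\in L^2(\Omega;\mathbb{S}^3)$ that are constant on each $T\in\mathcal{T}^h$ and such that, for every edge $\sigma$ not contained in $\partial\Omega$, $\int_\sigma\boldsymbol{\tau}\cdot(\underline{\boldsymbol{e}}^h|_T)\boldsymbol{\tau}\,dl$ has the same value for all $T\in\mathcal{T}^h$ with $\sigma\subset T$. $\boldsymbol{V}^h$ is the space of continuous $\boldsymbol{v}^h:\overline\Omega\to\mathbb{R}^3$ that are affine on each $T\in\mathcal{T}^h$, and $\dot{\boldsymbol{V}}^h=\boldsymbol{V}^h/\boldsymbol{R}(\Omega)$. For a vertex $\boldsymbol{a}$ of $\mathcal{T}^h$, $\overline\Omega_{\boldsymbol{a}}$ is the union of the tetrahedra of $\mathcal{T}^h$ having $\boldsymbol{a}$ as a vertex. For each vertex $\boldsymbol{a}$ one fixes finitely many linearly independent linear forms $\varphi_{\boldsymbol{a},j}$ on $\tilde{\underline{\mathbb{E}}}^h$, depending only on the restriction to $\overline\Omega_{\boldsymbol{a}}$, such that $\varphi_{\boldsymbol{a},j}(\underline{\boldsymbol{e}}^h)=0$ for all $j$ if and only if $\underline{\boldsymbol{e}}^h|_{\overline\Omega_{\boldsymbol{a}}}=\nabla_s\boldsymbol{v}$ for some continuous $\boldsymbol{v}:\overline\Omega_{\boldsymbol{a}}\to\mathbb{R}^3$ affine on each tetrahedron of $\overline\Omega_{\boldsymbol{a}}$. Then $\underline{\mathbb{E}}^h=\{\underline{\boldsymbol{e}}^h\in\tilde{\underline{\mathbb{E}}}^h:\varphi_{\boldsymbol{a},j}(\underline{\boldsymbol{e}}^h)=0\text{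 for all vertices }\boldsymbol{a}\text{ and all }j\}$. One has $\underline{\mathbb{E}}^h\subset\underline{\boldsymbol{E}}(\Omega)$. *)

theory Defs
  imports "HOL-Analysis.Analysis"
begin

section \<open>Hausdorff measure\<close>

text \<open>The \<open>d\<close>-dimensional Hausdorff measure for \<open>d \<ge> 1\<close>, normalised so that it agrees with
  \<open>d\<close>-dimensional volume on \<open>d\<close>-dimensional planes. The case \<open>d = 0\<close> is not meaningful here, because
  \<open>0 ^ 0 = 1\<close> gives the empty set a positive weight.\<close>

definition hausdorff_weight :: "nat \<Rightarrow> 'a::euclidean_space set \<Rightarrow> ennreal" where
  "hausdorff_weight d S = ennreal (unit_ball_vol (real d) * (diameter S / 2) ^ d)"

definition hausdorff_covers :: "real \<Rightarrow> 'a::euclidean_space set \<Rightarrow> (nat \<Rightarrow> 'a set) set" where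
  "hausdorff_covers \<delta> A =
     {C. A \<subseteq> (\<Union>i. C i) \<and> (\<forall>i. bounded (C i) \<and> diameter (C i) \<le> \<delta>)}"

definition hausdorff_pre :: "nat \<Rightarrow> real \<Rightarrow> 'a::euclidean_space set \<Rightarrow> ennreal" where
  "hausdorff_pre d \<delta> A = (INF C\<in>hausdorff_covers \<delta> A. \<Sum>i. hausdorff_weight d (C i))"

definition hausdorff_outer :: "nat \<Rightarrow> 'a::euclidean_space set \<Rightarrow> ennreal" where
  "hausdorff_outer d A = (SUP \<delta>\<in>{0<..}. hausdorff_pre d \<delta> A)"

definition hausdorff_measure :: "nat \<Rightarrow> 'a::euclidean_space measure" where
  "hausdorff_measure d = measure_of UNIV (sets borel) (hausdorff_outer d)"

text \<open>\<open>measure_of\<close> returns the null measure unless its argument is countably additive on the given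
  sigma-algebra. The lemmas up to \<open>emeasure_hausdorff_measure\<close> show that this does not happen.\<close>

lemma hausdorff_weight_empty: "d > 0 \<Longrightarrow> hausdorff_weight d {} = 0"
  by (simp add: hausdorff_weight_def)

lemma hausdorff_pre_le:
  "C \<in> hausdorff_covers \<delta> A \<Longrightarrow> hausdorff_pre d \<delta> A \<le> (\<Sum>i. hausdorff_weight d (C i))"
  unfolding hausdorff_pre_def by (rule INF_lower)

lemma hausdorff_pre_mono: "A \<subseteq> B \<Longrightarrow> hausdorff_pre d \<delta> A \<le> hausdorff_pre d \<delta> B"
  unfolding hausdorff_pre_def hausdorff_covers_def by (rule INF_superset_mono) auto

lemma hausdorff_pre_antimono: "\<delta> \<le> \<delta>' \<Longrightarrow> hausdorff_pre d \<delta>' A \<le> hausdorff_pre d \<delta> A"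
  unfolding hausdorff_pre_def hausdorff_covers_def
  by (rule INF_superset_mono) (auto intro: order_trans)

lemma hausdorff_outer_mono: "A \<subseteq> B \<Longrightarrow> hausdorff_outer d A \<le> hausdorff_outer d B"
  unfolding hausdorff_outer_def by (intro SUP_mono) (auto intro: hausdorff_pre_mono)

lemma hausdorff_outer_empty:
  assumes "d > 0" shows "hausdorff_outer d {} = 0"
proof -
  have "hausdorff_pre d \<delta> ({}::'a set) = 0" if "\<delta> > 0" for \<delta>
    using hausdorff_pre_le[of "\<lambda>_. {}" \<delta> "{}" d] that
    by (auto simp: hausdorff_covers_def hausdorff_weight_empty assms)
  then show ?thesis unfolding hausdorff_outer_def
    by (intro antisym SUP_least) auto
qed

lemma hausdorff_pre_subadd:
  fixes A :: "nat \<Rightarrow> 'a::euclidean_space set"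
  shows "hausdorff_pre d \<delta> (\<Union>n. A n) \<le> (\<Sum>n. hausdorff_pre d \<delta> (A n))"
proof (rule ennreal_le_epsilon)
  fix e :: real assume e: "0 < e" and fin: "(\<Sum>n. hausdorff_pre d \<delta> (A n)) < top"
  have fn: "hausdorff_pre d \<delta> (A n) \<noteq> top" for n
    using ennreal_suminf_lessD[OF fin, of n] by (simp add: less_top)
  have "\<exists>C\<in>hausdorff_covers \<delta> (A n).
      (\<Sum>i. hausdorff_weight d (C i)) \<le> hausdorff_pre d \<delta> (A n) + ennreal (e * (1/2)^Suc n)" for n
  proof -
    have "hausdorff_pre d \<delta> (A n) < hausdorff_pre d \<delta> (A n) + ennreal (e * (1/2)^Suc n)"
      using fn[of n] e by (simp add: ennreal_add_left_cancel_less less_top)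
    then show ?thesis
      unfolding hausdorff_pre_def INF_less_iff by (auto intro: less_imp_le)
  qed
  then obtain C where C: "\<And>n. C n \<in> hausdorff_covers \<delta> (A n)"
    and Cle: "\<And>n. (\<Sum>i. hausdorff_weight d (C n i))
                    \<le> hausdorff_pre d \<delta> (A n) + ennreal (e * (1/2)^Suc n)"
    by metis
  define D where "D = (\<lambda>k. case prod_decode k of (n, i) \<Rightarrow> C n i)"
  have "x \<in> (\<Union>k. D k)" if "x \<in> A n" for x n
  proof -
    have "x \<in> (\<Union>i. C n i)" using C[of n] that unfolding hausdorff_covers_def by blast
    then obtain i where "x \<in> C n i" by blast
    then have "x \<in> D (prod_encode (n, i))" by (simp add: D_def)
    then show ?thesis by blast
  qed
  then have "D \<in> hausdorff_covers \<delta> (\<Union>n. A n)"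
    using C by (auto simp: hausdorff_covers_def D_def split: prod.split)
  then have "hausdorff_pre d \<delta> (\<Union>n. A n) \<le> (\<Sum>k. hausdorff_weight d (D k))"
    by (rule hausdorff_pre_le)
  also have "\<dots> = (\<Sum>n. \<Sum>i. hausdorff_weight d (C n i))"
  proof -
    have "(\<Sum>k. (\<lambda>(n,i). hausdorff_weight d (C n i)) (prod_decode k))
            = (\<Sum>n. \<Sum>i. hausdorff_weight d (C n i))"
      using suminf_ennreal_2dimen[of "\<lambda>n. \<Sum>i. hausdorff_weight d (C n i)"
          "\<lambda>(n,i). hausdorff_weight d (C n i)"]
      by (simp add: o_def)
    moreover have "(\<lambda>k. hausdorff_weight d (D k))
                     = (\<lambda>k. (\<lambda>(n,i). hausdorff_weight d (C n i)) (prod_decode k))"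
      by (auto simp: D_def split: prod.split)
    ultimately show ?thesis by simp
  qed
  also have "\<dots> \<le> (\<Sum>n. hausdorff_pre d \<delta> (A n) + ennreal (e * (1/2)^Suc n))"
    by (intro suminf_le Cle) auto
  also have "\<dots> = (\<Sum>n. hausdorff_pre d \<delta> (A n)) + (\<Sum>n. ennreal (e * (1/2)^Suc n))"
    by (intro suminf_add[symmetric]) auto
  also have "(\<Sum>n. ennreal (e * (1/2)^Suc n)) = ennreal e"
    using e sums_mult[OF power_half_series, of e]
    by (intro suminf_ennreal_eq) (auto)
  finally show "hausdorff_pre d \<delta> (\<Union>n. A n) \<le> (\<Sum>n. hausdorff_pre d \<delta> (A n)) + ennreal e" .
qed

lemma hausdorff_outer_subadd:
  "hausdorff_outer d (\<Union>n. A n) \<le> (\<Sum>n. hausdorff_outer d (A n))"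
proof -
  have "hausdorff_pre d \<delta> (\<Union>n. A n) \<le> (\<Sum>n. hausdorff_outer d (A n))" if "\<delta> > 0" for \<delta>
  proof -
    have "hausdorff_pre d \<delta> (\<Union>n. A n) \<le> (\<Sum>n. hausdorff_pre d \<delta> (A n))"
      by (rule hausdorff_pre_subadd)
    also have "\<dots> \<le> (\<Sum>n. hausdorff_outer d (A n))"
      unfolding hausdorff_outer_def using that by (intro suminf_le SUP_upper) auto
    finally show ?thesis .
  qed
  then show ?thesis unfolding hausdorff_outer_def[of d "\<Union>n. A n"] by (intro SUP_least) auto
qed

lemma hausdorff_outer_Un:
  assumes "d > 0" shows "hausdorff_outer d (A \<union> B) \<le> hausdorff_outer d A + hausdorff_outer d B"
proof -
  define C where "C = (\<lambda>n::nat. if n = 0 then A else if n = 1 then B else {})"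
  have "(\<Union>n. C n) = A \<union> B" by (auto simp: C_def split: if_splits intro: exI[of _ 0] exI[of _ 1])
  moreover have "(\<Sum>n. hausdorff_outer d (C n)) = (\<Sum>n\<in>{0,1}. hausdorff_outer d (C n))"
    by (rule suminf_finite) (auto simp: C_def hausdorff_outer_empty assms)
  ultimately show ?thesis using hausdorff_outer_subadd[of d C] by (simp add: C_def)
qed

lemma hausdorff_outer_metric:
  assumes d: "d > 0" and \<rho>: "\<rho> > 0"
    and sep: "\<And>x y. x \<in> A \<Longrightarrow> y \<in> B \<Longrightarrow> \<rho> \<le> dist x y"
  shows "hausdorff_outer d A + hausdorff_outer d B \<le> hausdorff_outer d (A \<union> B)"
proof -
  have *: "hausdorff_pre d \<delta> A + hausdorff_pre d \<delta> B \<le> hausdorff_pre d \<delta> (A \<union> B)"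
    if \<delta>: "\<delta> > 0" "\<delta> < \<rho>" for \<delta>
    unfolding hausdorff_pre_def[of d \<delta> "A \<union> B"]
  proof (rule INF_greatest)
    fix C assume C: "C \<in> hausdorff_covers \<delta> (A \<union> B)"
    define P where "P = (\<lambda>X i. if C i \<inter> X = {} then {} else C i)"
    have P: "P X \<in> hausdorff_covers \<delta> X" if "X \<subseteq> A \<union> B" for X
    proof -
      have "X \<subseteq> (\<Union>i. P X i)"
      proof
        fix x assume x: "x \<in> X"
        then have "x \<in> (\<Union>i. C i)" using C that unfolding hausdorff_covers_def by blast
        then obtain i where "x \<in> C i" by blast
        then have "x \<in> P X i" using x by (auto simp: P_def)
        then show "x \<in> (\<Union>i. P X i)" by blast
      qed
      then show ?thesis using C \<delta> by (auto simp: hausdorff_covers_def P_def)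
    qed
    have "C i \<inter> A = {} \<or> C i \<inter> B = {}" for i
    proof (rule ccontr)
      assume "\<not> ?thesis"
      then obtain x y where "x \<in> C i" "x \<in> A" "y \<in> C i" "y \<in> B" by blast
      moreover have "bounded (C i)" "diameter (C i) \<le> \<delta>" using C by (auto simp: hausdorff_covers_def)
      ultimately show False using diameter_bounded_bound[of "C i" x y] sep[of x y] \<delta> by linarith
    qed
    then have w: "hausdorff_weight d (P A i) + hausdorff_weight d (P B i) \<le> hausdorff_weight d (C i)" for i
      by (auto simp: P_def hausdorff_weight_empty d)
    have "hausdorff_pre d \<delta> A + hausdorff_pre d \<delta> B
            \<le> (\<Sum>i. hausdorff_weight d (P A i)) + (\<Sum>i. hausdorff_weight d (P B i))"
      by (intro add_mono hausdorff_pre_le P) auto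
    also have "\<dots> = (\<Sum>i. hausdorff_weight d (P A i) + hausdorff_weight d (P B i))"
      by (intro suminf_add) auto
    also have "\<dots> \<le> (\<Sum>i. hausdorff_weight d (C i))"
      by (intro suminf_le w) auto
    finally show "hausdorff_pre d \<delta> A + hausdorff_pre d \<delta> B \<le> (\<Sum>i. hausdorff_weight d (C i))" .
  qed
  have "hausdorff_outer d A + hausdorff_outer d B
          = (SUP \<delta>\<in>{0<..}. hausdorff_pre d \<delta> A + hausdorff_outer d B)"
    unfolding hausdorff_outer_def[of d A] by (subst ennreal_SUP_add_left) auto
  also have "\<dots> \<le> hausdorff_outer d (A \<union> B)"
  proof (rule SUP_least)
    fix \<delta> :: real assume \<delta>: "\<delta> \<in> {0<..}"
    have "hausdorff_pre d \<delta> A + hausdorff_pre d \<delta>' B \<le> hausdorff_outer d (A \<union> B)" if "\<delta>' > 0" for \<delta>'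
    proof -
      define \<eta> where "\<eta> = Min {\<delta>, \<delta>', \<rho>/2}"
      have \<eta>: "\<eta> > 0" "\<eta> < \<rho>" "\<eta> \<le> \<delta>" "\<eta> \<le> \<delta>'" using that \<delta> \<rho> by (auto simp: \<eta>_def min_def)
      have "hausdorff_pre d \<delta> A + hausdorff_pre d \<delta>' B \<le> hausdorff_pre d \<eta> A + hausdorff_pre d \<eta> B"
        using \<eta> by (intro add_mono hausdorff_pre_antimono) auto
      also have "\<dots> \<le> hausdorff_pre d \<eta> (A \<union> B)" using * \<eta> by blast
      also have "\<dots> \<le> hausdorff_outer d (A \<union> B)"
        unfolding hausdorff_outer_def using \<eta> by (intro SUP_upper) auto
      finally show ?thesis .
    qed
    then show "hausdorff_pre d \<delta> A + hausdorff_outer d B \<le> hausdorff_outer d (A \<union> B)"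
      unfolding hausdorff_outer_def[of d B]
      by (subst ennreal_SUP_add_right) (auto intro!: SUP_least)
  qed
  finally show ?thesis .
qed


lemma hausdorff_outer_separated_sum:
  fixes R :: "nat \<Rightarrow> 'a::euclidean_space set"
  assumes d: "d > 0"
    and sep: "\<And>n. \<exists>\<rho>>0. \<forall>m>n. \<forall>x\<in>R n. \<forall>y\<in>R m. \<rho> \<le> dist x y"
  shows "(\<Sum>n<N. hausdorff_outer d (R n)) \<le> hausdorff_outer d (\<Union>n<N. R n)"
proof -
  have *: "(\<Sum>n\<in>{N-k..<N}. hausdorff_outer d (R n)) \<le> hausdorff_outer d (\<Union>n\<in>{N-k..<N}. R n)"
    if "k \<le> N" for k
    using that
  proof (induction k)
    case 0 then show ?case by simp
  next
    case (Suc k)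
    define m where "m = N - Suc k"
    have m: "N - k = Suc m" "m < N" using Suc.prems by (auto simp: m_def)
    have split: "{m..<N} = insert m {Suc m..<N}" using m by auto
    obtain \<rho> where \<rho>: "\<rho> > 0" "\<forall>j>m. \<forall>x\<in>R m. \<forall>y\<in>R j. \<rho> \<le> dist x y" using sep by blast
    have "(\<Sum>n\<in>{m..<N}. hausdorff_outer d (R n))
            = hausdorff_outer d (R m) + (\<Sum>n\<in>{Suc m..<N}. hausdorff_outer d (R n))"
      by (simp add: split)
    also have "\<dots> \<le> hausdorff_outer d (R m) + hausdorff_outer d (\<Union>n\<in>{Suc m..<N}. R n)"
      using Suc m by (intro add_left_mono) simp
    also have "\<dots> \<le> hausdorff_outer d (R m \<union> (\<Union>n\<in>{Suc m..<N}. R n))"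
      using \<rho> by (intro hausdorff_outer_metric[OF d \<rho>(1)]) (auto simp: Suc_le_eq)
    also have "R m \<union> (\<Union>n\<in>{Suc m..<N}. R n) = (\<Union>n\<in>{m..<N}. R n)" by (simp add: split)
    finally show ?case by (simp add: m_def)
  qed
  show ?thesis using *[of N] by (simp add: atLeast0LessThan)
qed

lemma ennreal_suminf_tail:
  fixes f :: "nat \<Rightarrow> ennreal"
  assumes "(\<Sum>k. f k) \<noteq> top"
  shows "(\<lambda>n. \<Sum>k. f (k + n)) \<longlonglongrightarrow> 0"
proof -
  define g where "g = (\<lambda>k. enn2real (f k))"
  have "f k \<noteq> top" for k
    using ennreal_suminf_lessD[of f top k] assms by (simp add: less_top)
  then have f: "f = (\<lambda>k. ennreal (g k))" by (simp add: g_def less_top)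
  have g: "g k \<ge> 0" for k by (simp add: g_def)
  have sg: "summable g" using assms summable_suminf_not_top[of g] g unfolding f by blast
  have "(\<lambda>n. \<Sum>k. g (k + n)) \<longlonglongrightarrow> 0"
    unfolding LIMSEQ_iff using suminf_exist_split[OF _ sg] by simp
  then have "(\<lambda>n. ennreal (\<Sum>k. g (k + n))) \<longlonglongrightarrow> ennreal 0" by (rule tendsto_ennrealI)
  moreover have "(\<Sum>k. f (k + n)) = ennreal (\<Sum>k. g (k + n))" for n
    unfolding f using g sg by (intro suminf_ennreal2) (auto simp: summable_iff_shift)
  ultimately show ?thesis by simp
qed

lemma hausdorff_outer_closed:
  fixes F X :: "'a::euclidean_space set"
  assumes d: "d > 0" and F: "closed F"
  shows "hausdorff_outer d (X \<inter> F) + hausdorff_outer d (X - F) \<le> hausdorff_outer d X"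
proof (cases "F = {} \<or> hausdorff_outer d X = top")
  case True then show ?thesis by (auto simp: hausdorff_outer_empty d)
next
  case False
  let ?H = "hausdorff_outer d"
  define t where "t = (\<lambda>n::nat. 1 / real (Suc n))"
  have t_mono: "t m \<le> t n" if "n \<le> m" for m n
    using that by (auto simp: t_def field_simps)
  have t_strict: "t m < t n" if "n < m" for m n
    using that by (auto simp: t_def field_simps)
  have t_pos: "t n > 0" for n by (simp add: t_def)
  define A where "A = (\<lambda>n. {x\<in>X. t n \<le> infdist x F})"
  define R where "R = (\<lambda>n. {x\<in>X. t (Suc n) \<le> infdist x F \<and> infdist x F < t n})"
  have sepR: "t (Suc n) - t m \<le> dist x y" if "x \<in> R n" "y \<in> R m" for x y n m
    using that infdist_triangle[of x F y] by (auto simp: R_def)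
  have sums: "(\<Sum>k<N. ?H (R (2*k+j))) \<le> ?H X" for N j
  proof -
    have "(\<Sum>k<N. ?H (R (2*k+j))) \<le> ?H (\<Union>k<N. R (2*k+j))"
    proof (rule hausdorff_outer_separated_sum[OF d])
      fix n
      let ?\<rho> = "t (Suc (2*n+j)) - t (2*n+2+j)"
      have "?\<rho> \<le> dist x y" if "m > n" "x \<in> R (2*n+j)" "y \<in> R (2*m+j)" for m x y
        using sepR[OF that(2,3)] t_mono[of "2*n+2+j" "2*m+j"] that(1) by simp
      moreover have "?\<rho> > 0" using t_strict[of "Suc (2*n+j)" "2*n+2+j"] by simp
      ultimately show "\<exists>\<rho>>0. \<forall>m>n. \<forall>x\<in>R (2*n+j). \<forall>y\<in>R (2*m+j). \<rho> \<le> dist x y" by blast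
    qed
    also have "\<dots> \<le> ?H X" by (rule hausdorff_outer_mono) (auto simp: R_def)
    finally show ?thesis .
  qed
  have all: "(\<Sum>k<2*N. ?H (R k)) = (\<Sum>k<N. ?H (R (2*k+0))) + (\<Sum>k<N. ?H (R (2*k+1)))" for N
    by (induction N) (auto simp: algebra_simps)
  have bound: "(\<Sum>k<N. ?H (R k)) \<le> ?H X + ?H X" for N
  proof -
    have "(\<Sum>k<N. ?H (R k)) \<le> (\<Sum>k<2*N. ?H (R k))" by (intro sum_mono2) auto
    also have "\<dots> \<le> ?H X + ?H X" unfolding all by (intro add_mono sums)
    finally show ?thesis .
  qed
  have fin: "(\<Sum>k. ?H (R k)) \<noteq> top"
  proof -
    have "(\<Sum>k. ?H (R k)) \<le> ?H X + ?H X"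
      unfolding suminf_eq_SUP by (intro SUP_least bound)
    moreover have "?H X + ?H X < top" using False by (simp add: less_top)
    ultimately show ?thesis by (simp add: less_top le_less_trans)
  qed
  have step: "?H (X \<inter> F) + ?H (X - F) \<le> ?H X + (\<Sum>k. ?H (R (k + n)))" for n
  proof -
    have cov: "X - F \<subseteq> A n \<union> (\<Union>k. R (k + n))"
    proof
      fix x assume x: "x \<in> X - F"
      then have pos: "infdist x F > 0"
        using F False infdist_pos_not_in_closed by (metis DiffD2)
      show "x \<in> A n \<union> (\<Union>k. R (k + n))"
      proof (cases "t n \<le> infdist x F")
        case True then show ?thesis using x by (simp add: A_def)
      next
        case nt: False
        have "\<exists>m. t m \<le> infdist x F"
          using pos nat_approx_posE[OF pos] unfolding t_def by (metis less_imp_le)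
        then obtain m where m: "t m \<le> infdist x F" "\<And>i. i < m \<Longrightarrow> \<not> t i \<le> infdist x F"
          using exists_least_iff[of "\<lambda>m. t m \<le> infdist x F"] by blast
        have "n < m" using m(1) nt t_mono[of m n] by force
        then obtain k where k: "m = Suc (k + n)"
          by (metis add.commute less_imp_Suc_add)
        then have "x \<in> R (k + n)" using x m(1) m(2)[of "k + n"] by (auto simp: R_def)
        then show ?thesis by blast
      qed
    qed
    have "?H (X - F) \<le> ?H (A n \<union> (\<Union>k. R (k + n)))" by (rule hausdorff_outer_mono[OF cov])
    also have "\<dots> \<le> ?H (A n) + ?H (\<Union>k. R (k + n))" by (rule hausdorff_outer_Un[OF d])
    also have "\<dots> \<le> ?H (A n) + (\<Sum>k. ?H (R (k + n)))"
      by (intro add_left_mono hausdorff_outer_subadd)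
    finally have 1: "?H (X - F) \<le> ?H (A n) + (\<Sum>k. ?H (R (k + n)))" .
    have "?H (X \<inter> F) + ?H (A n) \<le> ?H (X \<inter> F \<union> A n)"
    proof (rule hausdorff_outer_metric[OF d t_pos[of n]])
      fix x y assume "x \<in> X \<inter> F" "y \<in> A n"
      then show "t n \<le> dist x y"
        using infdist_le[of x F y] by (auto simp: A_def dist_commute)
    qed
    also have "\<dots> \<le> ?H X" by (rule hausdorff_outer_mono) (auto simp: A_def)
    finally have 2: "?H (X \<inter> F) + ?H (A n) \<le> ?H X" .
    have "?H (X \<inter> F) + ?H (X - F) \<le> ?H (X \<inter> F) + (?H (A n) + (\<Sum>k. ?H (R (k + n))))"
      using 1 by (rule add_left_mono)
    also have "\<dots> \<le> ?H X + (\<Sum>k. ?H (R (k + n)))"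
      using 2 by (simp add: add.assoc[symmetric] add_right_mono)
    finally show ?thesis .
  qed
  have "(\<lambda>n. \<Sum>k. ?H (R (k + n))) \<longlonglongrightarrow> 0"
    by (rule ennreal_suminf_tail[OF fin])
  then have "(\<lambda>n. ?H X + (\<Sum>k. ?H (R (k + n)))) \<longlonglongrightarrow> ?H X + 0"
    by (intro tendsto_add tendsto_const)
  then show ?thesis
    using LIMSEQ_le_const[of _ "?H X + 0" "?H (X \<inter> F) + ?H (X - F)"] step by auto
qed

lemma measure_space_hausdorff:
  assumes d: "d > 0"
  shows "measure_space UNIV (sets borel) (hausdorff_outer d :: 'a::euclidean_space set \<Rightarrow> ennreal)"
proof -
  let ?H = "hausdorff_outer d :: 'a set \<Rightarrow> ennreal"
  interpret P: sigma_algebra "UNIV::'a set" "Pow UNIV" by (rule sigma_algebra_Pow)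
  let ?L = "lambda_system UNIV (Pow UNIV) ?H"
  have "outer_measure_space (Pow UNIV) ?H"
    unfolding outer_measure_space_def positive_def increasing_def countably_subadditive_def
    by (auto simp: hausdorff_outer_empty d intro: hausdorff_outer_mono hausdorff_outer_subadd)
  then have ms: "measure_space UNIV ?L ?H" by (rule P.caratheodory_lemma)
  then have "sigma_algebra UNIV ?L" by (simp add: measure_space_def)
  moreover have "F \<in> ?L" if "closed F" for F
  proof -
    have "?H (F \<inter> X) + ?H ((UNIV - F) \<inter> X) = ?H X" for X
    proof (rule antisym)
      show "?H (F \<inter> X) + ?H ((UNIV - F) \<inter> X) \<le> ?H X"
        using hausdorff_outer_closed[OF d that, of X]
        by (simp add: Int_commute Diff_eq)
      have "X = (F \<inter> X) \<union> ((UNIV - F) \<inter> X)" by blast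
      then show "?H X \<le> ?H (F \<inter> X) + ?H ((UNIV - F) \<inter> X)"
        using hausdorff_outer_Un[OF d, of "F \<inter> X" "(UNIV - F) \<inter> X"] by simp
    qed
    then show ?thesis by (simp add: lambda_system_def)
  qed
  ultimately have "sigma_sets UNIV (Collect closed) \<subseteq> ?L"
    by (intro sigma_algebra.sigma_sets_subset) auto
  then have "sets borel \<subseteq> ?L"
    unfolding borel_eq_closed by simp
  then show ?thesis
    using measure_down[OF ms, of "sets borel"] sets.sigma_algebra_axioms[of "borel::'a measure"]
    by simp
qed

lemma sets_hausdorff_measure [measurable_cong, simp]: "sets (hausdorff_measure d) = sets borel"
  unfolding hausdorff_measure_def by (metis sets.sets_measure_of_eq space_borel)

lemma space_hausdorff_measure [simp]: "space (hausdorff_measure d) = UNIV"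
  unfolding hausdorff_measure_def by (simp add: space_measure_of_conv)

lemma emeasure_hausdorff_measure:
  assumes "d > 0" "A \<in> sets borel"
  shows "emeasure (hausdorff_measure d) A = hausdorff_outer d A"
  unfolding hausdorff_measure_def
  using measure_space_hausdorff[OF assms(1)] assms(2)
  by (intro emeasure_measure_of_sigma) (auto simp: measure_space_def)

section \<open>Domains and Sobolev spaces\<close>

text \<open>Elements of Lebesgue and Sobolev spaces over a set \<open>\<Omega>\<close> are represented by functions on the whole
  space of which only the almost everywhere class on \<open>\<Omega>\<close> matters; equality in these spaces is
  equality almost everywhere.\<close>

definition lipschitz_boundary :: "(real^3) set \<Rightarrow> bool" where
  "lipschitz_boundary \<Omega> \<longleftrightarrow>
     (\<forall>x\<in>frontier \<Omega>. \<exists>r>0. \<exists>n \<gamma> C. norm n = 1 \<and> C-lipschitz_on UNIV \<gamma> \<and>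
        \<Omega> \<inter> ball x r = {y \<in> ball x r. \<gamma> (y - (y \<bullet> n) *\<^sub>R n) < y \<bullet> n})"

definition domain3 :: "(real^3) set \<Rightarrow> bool" where
  "domain3 \<Omega> \<longleftrightarrow> open \<Omega> \<and> bounded \<Omega> \<and> connected \<Omega> \<and> lipschitz_boundary \<Omega>"

definition polyhedral_domain :: "(real^3) set \<Rightarrow> bool" where
  "polyhedral_domain \<Omega> \<longleftrightarrow>
     domain3 \<Omega> \<and> (\<exists>P. finite P \<and> (\<forall>p\<in>P. polytope p) \<and> closure \<Omega> = \<Union>P)"

definition Lp_space :: "real \<Rightarrow> 'a measure \<Rightarrow> ('a \<Rightarrow> 'b::euclidean_space) set" where
  "Lp_space p M = {f \<in> borel_measurable M. integrable M (\<lambda>x. norm (f x) powr p)}"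

definition partial_deriv :: "3 \<Rightarrow> (real^3 \<Rightarrow> real) \<Rightarrow> real^3 \<Rightarrow> real" where
  "partial_deriv i \<phi> x = frechet_derivative \<phi> (at x) (axis i 1)"

primrec continuously_differentiable :: "nat \<Rightarrow> (real^3 \<Rightarrow> real) \<Rightarrow> bool" where
  "continuously_differentiable 0 \<phi> \<longleftrightarrow> continuous_on UNIV \<phi>"
| "continuously_differentiable (Suc k) \<phi> \<longleftrightarrow>
     \<phi> differentiable_on UNIV \<and> (\<forall>i. continuously_differentiable k (partial_deriv i \<phi>))"

definition test_functions :: "(real^3) set \<Rightarrow> (real^3 \<Rightarrow> real) set" where
  "test_functions \<Omega> =
     {\<phi>. (\<forall>k. continuously_differentiable k \<phi>) \<and>
          compact (closure {x. \<phi> x \<noteq> 0}) \<and> closure {x. \<phi> x \<noteq> 0} \<subseteq> \<Omega>}"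

definition is_weak_grad :: "(real^3) set \<Rightarrow> (real^3 \<Rightarrow> real^3) \<Rightarrow> (real^3 \<Rightarrow> real^3^3) \<Rightarrow> bool" where
  "is_weak_grad \<Omega> v G \<longleftrightarrow>
     (\<forall>\<phi>\<in>test_functions \<Omega>. \<forall>i j.
        (LINT x|lebesgue_on \<Omega>. v x $ i * partial_deriv j \<phi> x)
          = - (LINT x|lebesgue_on \<Omega>. G x $ i $ j * \<phi> x))"

definition H1 :: "(real^3) set \<Rightarrow> (real^3 \<Rightarrow> real^3) set" where
  "H1 \<Omega> = {v \<in> Lp_space 2 (lebesgue_on \<Omega>). \<exists>G \<in> Lp_space 2 (lebesgue_on \<Omega>). is_weak_grad \<Omega> v G}"

definition weak_grad :: "(real^3) set \<Rightarrow> (real^3 \<Rightarrow> real^3) \<Rightarrow> (real^3 \<Rightarrow> real^3^3)" where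
  "weak_grad \<Omega> v = (SOME G. G \<in> Lp_space 2 (lebesgue_on \<Omega>) \<and> is_weak_grad \<Omega> v G)"

definition sym_grad :: "(real^3) set \<Rightarrow> (real^3 \<Rightarrow> real^3) \<Rightarrow> (real^3 \<Rightarrow> real^3^3)" where
  "sym_grad \<Omega> v x = (1/2) *\<^sub>R (transpose (weak_grad \<Omega> v x) + weak_grad \<Omega> v x)"

definition rigid :: "(real^3) set \<Rightarrow> (real^3 \<Rightarrow> real^3) set" where
  "rigid \<Omega> = {r \<in> H1 \<Omega>. AE x in lebesgue_on \<Omega>. sym_grad \<Omega> r x = 0}"

definition rigid_rel :: "(real^3) set \<Rightarrow> ((real^3 \<Rightarrow> real^3) \<times> (real^3 \<Rightarrow> real^3)) set" where
  "rigid_rel \<Omega> = {(v, w). v \<in> H1 \<Omega> \<and> w \<in> H1 \<Omega> \<and> (\<lambda>x. v x - w x) \<in> rigid \<Omega>}"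

definition H1_dot :: "(real^3) set \<Rightarrow> (real^3 \<Rightarrow> real^3) set set" where
  "H1_dot \<Omega> = H1 \<Omega> // rigid_rel \<Omega>"

definition quotient_lift :: "('a \<Rightarrow> real) \<Rightarrow> 'a set \<Rightarrow> real" where
  "quotient_lift F c = (THE t. \<forall>v\<in>c. F v = t)"

text \<open>\<open>is_class_strain \<Omega> c e\<close>: the symmetrized gradient of the class \<open>c\<close> of displacements modulo
  rigid displacements is \<open>e\<close>.\<close>

definition is_class_strain ::
    "(real^3) set \<Rightarrow> (real^3 \<Rightarrow> real^3) set \<Rightarrow> (real^3 \<Rightarrow> real^3^3) \<Rightarrow> bool" where
  "is_class_strain \<Omega> c e \<longleftrightarrow> (\<forall>v\<in>c. AE x in lebesgue_on \<Omega>. sym_grad \<Omega> v x = e x)"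

definition surface_measure :: "(real^3) set \<Rightarrow> (real^3) measure" where
  "surface_measure \<Omega> = restrict_space (hausdorff_measure 2) (frontier \<Omega>)"

text \<open>The boundary trace of a Sobolev function on a Lipschitz domain, in the pointwise form of the
  boundary trace theorem (Ambrosio, Fusco and Pallara, Functions of Bounded Variation and Free
  Discontinuity Problems, Theorem 3.87): at almost every boundary point there is exactly one vector
  satisfying the limit condition. It depends only on the almost everywhere class of \<open>v\<close> and is the
  boundary value of \<open>v\<close> whenever \<open>v\<close> is continuous up to the boundary.\<close>

definition boundary_trace :: "(real^3) set \<Rightarrow> (real^3 \<Rightarrow> real^3) \<Rightarrow> real^3 \<Rightarrow> real^3" where
  "boundary_trace \<Omega> v x =
     (THE z. ((\<lambda>r. (LINT y|lebesgue_on (\<Omega> \<inter> ball x r). norm (v y - z))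
                     / measure lebesgue (\<Omega> \<inter> ball x r)) \<longlongrightarrow> 0) (at_right 0))"

section \<open>Linearized elasticity\<close>

definition hooke :: "real \<Rightarrow> real \<Rightarrow> real^3^3 \<Rightarrow> real^3^3" where
  "hooke lam mu e = (lam * trace e) *\<^sub>R mat 1 + (2 * mu) *\<^sub>R e"

definition load ::
    "(real^3 \<Rightarrow> real^3) \<Rightarrow> (real^3 \<Rightarrow> real^3) \<Rightarrow> (real^3) set \<Rightarrow> (real^3 \<Rightarrow> real^3) \<Rightarrow> real" where
  "load f g \<Omega> v = (LINT x|lebesgue_on \<Omega>. f x \<bullet> v x)
                   + (LINT x|surface_measure \<Omega>. g x \<bullet> boundary_trace \<Omega> v x)"

definition elasticity_data ::
    "real \<Rightarrow> real \<Rightarrow> (real^3 \<Rightarrow> real^3) \<Rightarrow> (real^3 \<Rightarrow> real^3) \<Rightarrow> (real^3) set \<Rightarrow> bool" where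
  "elasticity_data lam mu f g \<Omega> \<longleftrightarrow>
     lam > 0 \<and> mu > 0 \<and>
     f \<in> Lp_space (6/5) (lebesgue_on \<Omega>) \<and> g \<in> Lp_space (4/3) (surface_measure \<Omega>) \<and>
     (\<forall>r\<in>rigid \<Omega>. load f g \<Omega> r = 0)"

text \<open>The inner product of the type \<open>real^3^3\<close> is the matrix inner product, that is, the sum of the
  products of corresponding entries.\<close>

definition displacement_energy ::
    "real \<Rightarrow> real \<Rightarrow> (real^3 \<Rightarrow> real^3) \<Rightarrow> (real^3 \<Rightarrow> real^3) \<Rightarrow> (real^3) set
      \<Rightarrow> (real^3 \<Rightarrow> real^3) \<Rightarrow> real" where
  "displacement_energy lam mu f g \<Omega> v =
     (1/2) * (LINT x|lebesgue_on \<Omega>. hooke lam mu (sym_grad \<Omega> v x) \<bullet> sym_grad \<Omega> v x)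
       - load f g \<Omega> v"

definition displacement_energy_dot ::
    "real \<Rightarrow> real \<Rightarrow> (real^3 \<Rightarrow> real^3) \<Rightarrow> (real^3 \<Rightarrow> real^3) \<Rightarrow> (real^3) set
      \<Rightarrow> (real^3 \<Rightarrow> real^3) set \<Rightarrow> real" where
  "displacement_energy_dot lam mu f g \<Omega> = quotient_lift (displacement_energy lam mu f g \<Omega>)"

definition levi_civita :: "3 \<Rightarrow> 3 \<Rightarrow> 3 \<Rightarrow> real" where
  "levi_civita i j k = cross3 (axis i 1) (axis j 1) \<bullet> axis k 1"

text \<open>The last condition is \<open>curl curl e = 0\<close> in the sense of distributions. This is the same as
  equality in \<open>H\<^sup>-\<^sup>2\<close>, the dual of \<open>H\<^sub>0\<^sup>2\<close>, in which the test functions are dense.\<close>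

definition strain_space :: "(real^3) set \<Rightarrow> (real^3 \<Rightarrow> real^3^3) set" where
  "strain_space \<Omega> =
     {e \<in> Lp_space 2 (lebesgue_on \<Omega>).
        (AE x in lebesgue_on \<Omega>. transpose (e x) = e x) \<and>
        (\<forall>\<phi>\<in>test_functions \<Omega>. \<forall>i j.
           (LINT x|lebesgue_on \<Omega>. (\<Sum>k\<in>UNIV. \<Sum>l\<in>UNIV. \<Sum>m\<in>UNIV. \<Sum>n\<in>UNIV.
              levi_civita i l k * levi_civita j m n
                * (e x $ k $ n * partial_deriv l (partial_deriv m \<phi>) x))) = 0)}"

definition kappa :: "(real^3) set \<Rightarrow> (real^3 \<Rightarrow> real^3^3) \<Rightarrow> (real^3 \<Rightarrow> real^3) set" where
  "kappa \<Omega> = (\<lambda>e\<in>strain_space \<Omega>. THE c. c \<in> H1_dot \<Omega> \<and> is_class_strain \<Omega> c e)"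

definition strain_energy ::
    "real \<Rightarrow> real \<Rightarrow> (real^3 \<Rightarrow> real^3) \<Rightarrow> (real^3 \<Rightarrow> real^3) \<Rightarrow> (real^3) set
      \<Rightarrow> (real^3 \<Rightarrow> real^3^3) \<Rightarrow> real" where
  "strain_energy lam mu f g \<Omega> e =
     (1/2) * (LINT x|lebesgue_on \<Omega>. hooke lam mu (e x) \<bullet> e x)
       - quotient_lift (load f g \<Omega>) (kappa \<Omega> e)"

section \<open>Finite element spaces\<close>

text \<open>Conformity, i.e. that any two tetrahedra meet in a common face, is part of the library
  predicate \<open>triangulation\<close>.\<close>

definition tetrahedral_mesh :: "(real^3) set \<Rightarrow> (real^3) set set \<Rightarrow> bool" where
  "tetrahedral_mesh \<Omega> \<T> \<longleftrightarrow>
     triangulation \<T> \<and> (\<forall>T\<in>\<T>. 3 simplex T) \<and> \<Union>\<T> = closure \<Omega>"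

definition mesh_edges :: "(real^3) set set \<Rightarrow> (real^3) set set" where
  "mesh_edges \<T> = {\<sigma>. \<exists>T\<in>\<T>. \<sigma> edge_of T}"

definition mesh_vertices :: "(real^3) set set \<Rightarrow> (real^3) set" where
  "mesh_vertices \<T> = {a. \<exists>T\<in>\<T>. a extreme_point_of T}"

definition cells_at :: "(real^3) set set \<Rightarrow> real^3 \<Rightarrow> (real^3) set set" where
  "cells_at \<T> a = {T \<in> \<T>. a extreme_point_of T}"

definition star :: "(real^3) set set \<Rightarrow> real^3 \<Rightarrow> (real^3) set" where
  "star \<T> a = \<Union>(cells_at \<T> a)"

definition edge_tangents :: "(real^3) set set \<Rightarrow> ((real^3) set \<Rightarrow> real^3) \<Rightarrow> bool" where
  "edge_tangents \<T> \<tau> \<longleftrightarrow>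
     (\<forall>\<sigma>\<in>mesh_edges \<T>. norm (\<tau> \<sigma>) = 1 \<and> (\<forall>x\<in>\<sigma>. \<forall>y\<in>\<sigma>. \<exists>s. x - y = s *\<^sub>R \<tau> \<sigma>))"

definition cell_value :: "(real^3 \<Rightarrow> real^3^3) \<Rightarrow> (real^3) set \<Rightarrow> real^3^3" where
  "cell_value e T = (THE C. AE x in lebesgue_on T. e x = C)"

definition edge_moment ::
    "((real^3) set \<Rightarrow> real^3) \<Rightarrow> (real^3 \<Rightarrow> real^3^3) \<Rightarrow> (real^3) set \<Rightarrow> (real^3) set \<Rightarrow> real" where
  "edge_moment \<tau> e T \<sigma> =
     (LINT x|restrict_space (hausdorff_measure 1) \<sigma>. \<tau> \<sigma> \<bullet> (cell_value e T *v \<tau> \<sigma>))"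

definition edge_strain_space ::
    "(real^3) set \<Rightarrow> (real^3) set set \<Rightarrow> ((real^3) set \<Rightarrow> real^3) \<Rightarrow> (real^3 \<Rightarrow> real^3^3) set" where
  "edge_strain_space \<Omega> \<T> \<tau> =
     {e \<in> Lp_space 2 (lebesgue_on \<Omega>).
        (AE x in lebesgue_on \<Omega>. transpose (e x) = e x) \<and>
        (\<forall>T\<in>\<T>. \<exists>C. AE x in lebesgue_on T. e x = C) \<and>
        (\<forall>\<sigma>\<in>mesh_edges \<T>. \<not> \<sigma> \<subseteq> frontier \<Omega> \<longrightarrow>
           (\<forall>T\<in>\<T>. \<forall>T'\<in>\<T>. \<sigma> \<subseteq> T \<and> \<sigma> \<subseteq> T' \<longrightarrow> edge_moment \<tau> e T \<sigma> = edge_moment \<tau> e T' \<sigma>))}"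

definition piecewise_affine :: "(real^3) set set \<Rightarrow> (real^3 \<Rightarrow> real^3) set" where
  "piecewise_affine \<S> =
     {v. continuous_on (\<Union>\<S>) v \<and> (\<forall>T\<in>\<S>. \<exists>(A :: real^3^3) b. \<forall>x\<in>T. v x = A *v x + b)}"

text \<open>The quotient is taken with respect to the relation on \<open>H1\<close>, so that it consists of elements
  of \<open>H1_dot\<close>.\<close>

definition fe_displacements_dot ::
    "(real^3) set \<Rightarrow> (real^3) set set \<Rightarrow> (real^3 \<Rightarrow> real^3) set set" where
  "fe_displacements_dot \<Omega> \<T> = piecewise_affine \<T> // rigid_rel \<Omega>"

text \<open>For each vertex \<open>a\<close>, the forms \<open>\<phi> a j\<close> with \<open>j < N a\<close>: they are linear on
  \<open>edge_strain_space\<close>, depend only on the restriction to the star of \<open>a\<close>, are linearly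
  independent, and vanish simultaneously exactly on the fields that are strains of continuous
  piecewise affine displacements of the star.\<close>

definition compatibility_forms ::
    "(real^3) set \<Rightarrow> (real^3) set set \<Rightarrow> ((real^3) set \<Rightarrow> real^3)
      \<Rightarrow> (real^3 \<Rightarrow> nat) \<Rightarrow> (real^3 \<Rightarrow> nat \<Rightarrow> (real^3 \<Rightarrow> real^3^3) \<Rightarrow> real) \<Rightarrow> bool" where
  "compatibility_forms \<Omega> \<T> \<tau> N \<phi> \<longleftrightarrow>
     (let E = edge_strain_space \<Omega> \<T> \<tau> in
      \<forall>a\<in>mesh_vertices \<T>.
        (\<forall>j<N a.
           (\<forall>e\<in>E. \<forall>e'\<in>E. \<phi> a j (\<lambda>x. e x + e' x) = \<phi> a j e + \<phi> a j e') \<and>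
           (\<forall>s. \<forall>e\<in>E. \<phi> a j (\<lambda>x. s *\<^sub>R e x) = s * \<phi> a j e) \<and>
           (\<forall>e\<in>E. \<forall>e'\<in>E. (AE x in lebesgue_on (star \<T> a). e x = e' x) \<longrightarrow> \<phi> a j e = \<phi> a j e')) \<and>
        (\<forall>s. (\<forall>e\<in>E. (\<Sum>j<N a. s j * \<phi> a j e) = 0) \<longrightarrow> (\<forall>j<N a. s j = 0)) \<and>
        (\<forall>e\<in>E. (\<forall>j<N a. \<phi> a j e = 0) \<longleftrightarrow>
           (\<exists>v\<in>piecewise_affine (cells_at \<T> a).
              AE x in lebesgue_on (star \<T> a). sym_grad (interior (star \<T> a)) v x = e x)))"

definition fe_strains ::
    "(real^3) set \<Rightarrow> (real^3) set set \<Rightarrow> ((real^3) set \<Rightarrow> real^3)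
      \<Rightarrow> (real^3 \<Rightarrow> nat) \<Rightarrow> (real^3 \<Rightarrow> nat \<Rightarrow> (real^3 \<Rightarrow> real^3^3) \<Rightarrow> real)
      \<Rightarrow> (real^3 \<Rightarrow> real^3^3) set" where
  "fe_strains \<Omega> \<T> \<tau> N \<phi> =
     {e \<in> edge_strain_space \<Omega> \<T> \<tau>. \<forall>a\<in>mesh_vertices \<T>. \<forall>j<N a. \<phi> a j e = 0}"

text \<open>The infimum is taken in the extended reals, where it is meaningful without knowing that the
  functional is bounded below.\<close>

definition attains_inf :: "('a \<Rightarrow> real) \<Rightarrow> 'a set \<Rightarrow> 'a \<Rightarrow> bool" where
  "attains_inf F S x \<longleftrightarrow> x \<in> S \<and> ereal (F x) = (INF y\<in>S. ereal (F y))"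

end

theory Submission
  imports Defs
begin

text \<open>A compatible finite element strain is, on every vertex star, the strain of a continuous
  piecewise affine displacement. Two such local displacements differ by a rigid displacement, so
  they form a locally constant cocycle with values in an additive group; on a simply connected
  domain it is a coboundary, and the local displacements glue to a global one. Since the cells at a
  boundary point share a vertex and a Lipschitz domain is locally connected at its boundary, the
  glued displacement is continuous up to the boundary. Hence the strain problem is the displacement
  problem rewritten. The latter is a quadratic minimisation over a finite dimensional space, positive
  definite on strains; it descends to the quotient because displacements with vanishing weak
  symmetrised gradient are almost everywhere affine.\<close>

subsection \<open>Test functions\<close>

text \<open>The encodings shape the proof. \<open>strain_energy\<close> reaches the load only
  through \<open>kappa\<close>, a definite description over classes of \<open>H1\<close> functions.
  So for a finite element strain its double curl must vanish, its class must be unique, and the load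
  must take one value on the whole class. Members of a class agree with piecewise affine fields only
  almost everywhere, and the load is compared on them through the trace, which ignores null sets.
  \<open>weak_grad\<close> is an arbitrary choice; it is pinned down by testing with tensor products
  of one-dimensional bumps, for which everything is computed factor by factor.

  Gluing is done on balls rather than stars: on a ball, two displacements with the same cell strains
  differ by one rigid field, by the same theorem on vanishing symmetrised gradients, so adjacency of
  cells never has to be followed. At a boundary point only the part of a ball inside the domain is
  available, which is why the gluing is completed there separately. The minimiser comes from
  finitely many coordinates, the entries of the cell strains: where they all vanish the field is
  rigid and the load is zero.\<close>

lemma partial_deriv_along_line:
  assumes "\<phi> differentiable (at (x + t *\<^sub>R axis j 1))"
  shows "((\<lambda>t. \<phi> (x + t *\<^sub>R axis j 1)) has_real_derivative partial_deriv j \<phi> (x + t *\<^sub>R axis j 1)) (at t)"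
proof -
  let ?y = "x + t *\<^sub>R axis j (1::real)"
  have "(\<phi> has_derivative frechet_derivative \<phi> (at ?y)) (at ?y)"
    using assms frechet_derivative_works by blast
  moreover have "((\<lambda>t. x + t *\<^sub>R axis j (1::real)) has_derivative (\<lambda>s. s *\<^sub>R axis j 1)) (at t)"
    by (auto intro!: derivative_eq_intros)
  ultimately have "((\<lambda>t. \<phi> (x + t *\<^sub>R axis j 1)) has_derivative (\<lambda>s. frechet_derivative \<phi> (at ?y) (s *\<^sub>R axis j 1))) (at t)"
    using has_derivative_compose by fastforce
  moreover have "(\<lambda>s. frechet_derivative \<phi> (at ?y) (s *\<^sub>R axis j 1)) = (*) (partial_deriv j \<phi> ?y)"
    using linear_frechet_derivative[OF assms] by (auto simp: partial_deriv_def linear_cmul)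
  ultimately show ?thesis by (simp add: has_field_derivative_def)
qed

lemma partial_deriv_mean_value:
  assumes "\<And>y. \<phi> differentiable (at y)" "0 < s"
  obtains t where "0 < t" "t < s" "\<phi> (x + s *\<^sub>R axis j 1) - \<phi> x = s * partial_deriv j \<phi> (x + t *\<^sub>R axis j 1)"
proof -
  have "\<exists>t>0. t < s \<and> \<phi> (x + s *\<^sub>R axis j 1) - \<phi> (x + 0 *\<^sub>R axis j 1) = (s - 0) * partial_deriv j \<phi> (x + t *\<^sub>R axis j 1)"
    by (rule MVT2) (use assms in \<open>auto intro: partial_deriv_along_line\<close>)
  then show ?thesis using that by auto
qed

lemma partial_deriv_diff:
  assumes "f differentiable (at x)" "g differentiable (at x)"
  shows "partial_deriv i (\<lambda>y. f y - g y) x = partial_deriv i f x - partial_deriv i g x"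
proof -
  have "((\<lambda>y. f y - g y) has_derivative (\<lambda>h. frechet_derivative f (at x) h - frechet_derivative g (at x) h)) (at x)"
    using assms by (intro has_derivative_diff) (auto simp: frechet_derivative_works)
  then have "frechet_derivative (\<lambda>y. f y - g y) (at x) = (\<lambda>h. frechet_derivative f (at x) h - frechet_derivative g (at x) h)"
    by (rule frechet_derivative_at[symmetric])
  then show ?thesis by (simp add: partial_deriv_def)
qed

lemma partial_deriv_translate:
  assumes "f differentiable (at (x + a))"
  shows "partial_deriv i (\<lambda>y. f (y + a)) x = partial_deriv i f (x + a)"
proof -
  have "(f has_derivative frechet_derivative f (at (x + a))) (at (x + a))"
    using assms frechet_derivative_works by blast
  then have "((\<lambda>y. f (y + a)) has_derivative frechet_derivative f (at (x + a))) (at x)"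
    by (rule has_derivative_compose[of "\<lambda>y. y + a" "\<lambda>y. y" x UNIV f, rotated]) (auto intro!: derivative_eq_intros)
  then show ?thesis unfolding partial_deriv_def using frechet_derivative_at by metis
qed

text \<open>The mean value theorem is used twice: in direction \<open>i\<close> for the increment of
  \<open>\<phi>\<close> in direction \<open>j\<close>, then in direction \<open>j\<close> for
  \<open>partial_deriv i \<phi>\<close>. Each use moves the point by less than \<open>s\<close>,
  hence the distance \<open>2 * s\<close>.\<close>

lemma second_difference:
  fixes \<phi> :: "real^3 \<Rightarrow> real"
  assumes d: "\<And>y. \<phi> differentiable (at y)" "\<And>y. partial_deriv i \<phi> differentiable (at y)" and s: "0 < s"
  obtains p where "dist p x \<le> 2 * s"
    "\<phi> (x + s *\<^sub>R axis i 1 + s *\<^sub>R axis j 1) - \<phi> (x + s *\<^sub>R axis i 1) - \<phi> (x + s *\<^sub>R axis j 1) + \<phi> x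
       = s * s * partial_deriv j (partial_deriv i \<phi>) p"
proof -
  let ?g = "\<lambda>y. \<phi> (y + s *\<^sub>R axis j 1) - \<phi> y"
  have sh: "(\<lambda>y. \<phi> (y + a)) differentiable (at y)" for a y
    using d(1)[of "y + a"] differentiable_chain_at[of "\<lambda>y. y + a" y \<phi>] by (simp add: o_def)
  have "?g differentiable (at y)" for y by (intro differentiable_diff sh d)
  then obtain \<xi> where \<xi>: "0 < \<xi>" "\<xi> < s" "?g (x + s *\<^sub>R axis i 1) - ?g x = s * partial_deriv i ?g (x + \<xi> *\<^sub>R axis i 1)"
    using partial_deriv_mean_value[of ?g s x i] s by blast
  let ?y = "x + \<xi> *\<^sub>R axis i 1"
  have "partial_deriv i ?g ?y = partial_deriv i \<phi> (?y + s *\<^sub>R axis j 1) - partial_deriv i \<phi> ?y"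
    using partial_deriv_diff[OF sh d(1)] partial_deriv_translate[OF d(1)] by simp
  moreover obtain \<eta> where \<eta>: "0 < \<eta>" "\<eta> < s"
     "partial_deriv i \<phi> (?y + s *\<^sub>R axis j 1) - partial_deriv i \<phi> ?y = s * partial_deriv j (partial_deriv i \<phi>) (?y + \<eta> *\<^sub>R axis j 1)"
    using partial_deriv_mean_value[of "partial_deriv i \<phi>" s ?y j] d(2) s by blast
  moreover have "dist (?y + \<eta> *\<^sub>R axis j 1) x \<le> 2 * s"
  proof -
    have "dist (?y + \<eta> *\<^sub>R axis j 1) x = norm (\<xi> *\<^sub>R axis i (1::real) + \<eta> *\<^sub>R axis j 1 :: real^3)"
      by (simp add: dist_norm algebra_simps)
    also have "\<dots> \<le> norm (\<xi> *\<^sub>R axis i (1::real) :: real^3) + norm (\<eta> *\<^sub>R axis j (1::real) :: real^3)"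
      by (rule norm_triangle_ineq)
    also have "\<dots> \<le> 2 * s" using \<xi> \<eta> by simp
    finally show ?thesis .
  qed
  ultimately show ?thesis using that[of "?y + \<eta> *\<^sub>R axis j 1"] \<xi>(3) by (simp add: algebra_simps)
qed

text \<open>The second difference is symmetric in the two directions, so the two mixed derivatives
  have equal values at two points within \<open>2 * s\<close> of \<open>x\<close>. Letting
  \<open>s\<close> tend to 0, continuity moves both values to \<open>x\<close>.\<close>

lemma partial_deriv_commute:
  fixes \<phi> :: "real^3 \<Rightarrow> real"
  assumes "continuously_differentiable 2 \<phi>"
  shows "partial_deriv i (partial_deriv j \<phi>) x = partial_deriv j (partial_deriv i \<phi>) x"
proof -
  have d: "\<phi> differentiable (at y)" "partial_deriv k \<phi> differentiable (at y)"
    "continuous_on UNIV (partial_deriv l (partial_deriv k \<phi>))" for y k l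
    using assms by (auto simp: numeral_2_eq_2 differentiable_on_def)
  define P where "P = partial_deriv i (partial_deriv j \<phi>)"
  define Q where "Q = partial_deriv j (partial_deriv i \<phi>)"
  have "\<exists>p q. dist p x \<le> 2 * s \<and> dist q x \<le> 2 * s \<and> P p = Q q" if s: "0 < s" for s
  proof -
    obtain q where q: "dist q x \<le> 2 * s"
      "\<phi> (x + s *\<^sub>R axis i 1 + s *\<^sub>R axis j 1) - \<phi> (x + s *\<^sub>R axis i 1) - \<phi> (x + s *\<^sub>R axis j 1) + \<phi> x = s * s * Q q"
      using second_difference[OF d(1,2) s, where i=i and j=j and x=x] unfolding Q_def by blast
    obtain p where p: "dist p x \<le> 2 * s"
      "\<phi> (x + s *\<^sub>R axis j 1 + s *\<^sub>R axis i 1) - \<phi> (x + s *\<^sub>R axis j 1) - \<phi> (x + s *\<^sub>R axis i 1) + \<phi> x = s * s * P p"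
      using second_difference[OF d(1,2) s, where i=j and j=i and x=x] unfolding P_def by blast
    have "s * s * P p = s * s * Q q" using p(2) q(2) by (simp add: algebra_simps)
    then have "P p = Q q" using s by simp
    then show ?thesis using p q by blast
  qed
  then have "\<exists>p q. dist p x \<le> 2 * (1 / real (Suc n)) \<and> dist q x \<le> 2 * (1 / real (Suc n)) \<and> P p = Q q" for n
    by (metis of_nat_0_less_iff zero_less_Suc zero_less_divide_1_iff)
  then obtain p q where pq: "\<And>n. dist (p n) x \<le> 2 * (1 / real (Suc n))" "\<And>n. dist (q n) x \<le> 2 * (1 / real (Suc n))"
      "\<And>n. P (p n) = Q (q n)" by metis
  have lim0: "(\<lambda>n. 2 * (1 / real (Suc n))) \<longlonglongrightarrow> 0"
    using tendsto_mult_right_zero[OF LIMSEQ_inverse_real_of_nat, of 2] by (simp add: inverse_eq_divide)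
  have pl: "p \<longlonglongrightarrow> x" "q \<longlonglongrightarrow> x"
    by (rule metric_tendsto_imp_tendsto[OF lim0], use pq in \<open>auto intro!: always_eventually simp: dist_real_def\<close>)+
  have "(\<lambda>n. P (p n)) \<longlonglongrightarrow> P x" "(\<lambda>n. Q (q n)) \<longlonglongrightarrow> Q x"
    unfolding P_def Q_def
    by (rule continuous_on_tendsto_compose[OF d(3) pl(1)] continuous_on_tendsto_compose[OF d(3) pl(2)]; simp)+
  then have "P x = Q x" using pq(3) LIMSEQ_unique by simp
  then show ?thesis by (simp add: P_def Q_def)
qed

lemma test_function_differentiable: "\<phi> \<in> test_functions U \<Longrightarrow> \<phi> differentiable (at x)"
  unfolding test_functions_def by (auto dest!: spec[of _ "Suc 0"] simp: differentiable_on_def)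

lemma partial_deriv_zero_outside:
  assumes "x \<notin> closure {x. \<phi> x \<noteq> 0}" shows "partial_deriv j \<phi> x = 0"
proof -
  have "(\<phi> has_derivative (\<lambda>_. 0)) (at x)"
    by (rule has_derivative_transform_within_open[of "\<lambda>_. 0" _ _ _ "- closure {x. \<phi> x \<noteq> 0}"])
       (use assms closure_subset[of "{x. \<phi> x \<noteq> 0}"] in auto)
  then have "frechet_derivative \<phi> (at x) = (\<lambda>_. 0)" using frechet_derivative_at by metis
  then show ?thesis by (simp add: partial_deriv_def)
qed

lemma test_function_partial_deriv:
  assumes "\<phi> \<in> test_functions U" shows "partial_deriv j \<phi> \<in> test_functions U"
proof -
  have "closure {x. partial_deriv j \<phi> x \<noteq> 0} \<subseteq> closure {x. \<phi> x \<noteq> 0}"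
    by (rule closure_minimal) (use partial_deriv_zero_outside in auto)
  moreover have "continuously_differentiable k (partial_deriv j \<phi>)" for k
    using assms unfolding test_functions_def by (auto dest!: spec[of _ "Suc k"])
  ultimately show ?thesis
    using assms bounded_subset[of "closure {x. \<phi> x \<noteq> 0}"] unfolding test_functions_def
    by (auto simp: compact_eq_bounded_closed)
qed

lemma test_function_continuous: "\<phi> \<in> test_functions U \<Longrightarrow> continuous_on A \<phi>"
  by (rule continuous_on_subset[of UNIV]) (auto simp: test_functions_def dest!: spec[of _ 0])

lemma test_function_bounded:
  assumes "\<phi> \<in> test_functions U" obtains C where "\<And>x. \<bar>\<phi> x\<bar> \<le> C" "C > 0"
proof -
  let ?K = "closure {x. \<phi> x \<noteq> 0}"
  have "compact (\<phi> ` ?K)"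
    using assms test_function_continuous[OF assms] by (intro compact_continuous_image) (auto simp: test_functions_def)
  then obtain C where C: "C > 0" "\<And>y. y \<in> \<phi> ` ?K \<Longrightarrow> norm y \<le> C"
    using compact_imp_bounded bounded_pos by metis
  have "\<bar>\<phi> x\<bar> \<le> C" for x
    using C(2)[of "\<phi> x"] closure_subset[of "{x. \<phi> x \<noteq> 0}"] C(1) by (cases "\<phi> x = 0") auto
  then show ?thesis using that C by blast
qed

lemma test_function_measurable: "\<phi> \<in> test_functions U \<Longrightarrow> \<phi> \<in> borel_measurable borel"
  by (intro borel_measurable_continuous_onI test_function_continuous)

subsection \<open>Tensor products of smooth bumps\<close>

text \<open>One-variable counterpart of \<open>continuously_differentiable\<close>. The derivative
  is an existential witness, so the closure properties follow by exhibiting it.\<close>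

primrec times_differentiable :: "nat \<Rightarrow> (real \<Rightarrow> real) \<Rightarrow> bool" where
  "times_differentiable 0 h \<longleftrightarrow> continuous_on UNIV h"
| "times_differentiable (Suc k) h \<longleftrightarrow>
     (\<exists>h'. (\<forall>t. (h has_real_derivative h' t) (at t)) \<and> times_differentiable k h')"

lemma times_differentiable_mono: "times_differentiable (Suc k) h \<Longrightarrow> times_differentiable k h"
proof (induction k arbitrary: h)
  case 0
  then obtain h' where "\<And>t. (h has_real_derivative h' t) (at t)" by auto
  then show ?case by (auto intro: DERIV_continuous_on)
next
  case (Suc k)
  then obtain h' where "\<And>t. (h has_real_derivative h' t) (at t)" "times_differentiable (Suc k) h'"
    by (auto simp only: times_differentiable.simps(2)[of "Suc k"])
  then show ?case using Suc.IH[of h'] by (auto simp only: times_differentiable.simps(2)[of k h])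
qed

lemma times_differentiable_const: "times_differentiable k (\<lambda>_. c)"
proof (induction k arbitrary: c)
  case (Suc k)
  then show ?case using Suc[of 0] by (auto intro!: exI[of _ "\<lambda>_. 0"])
qed auto

lemma times_differentiable_add:
  "times_differentiable k f \<Longrightarrow> times_differentiable k g \<Longrightarrow> times_differentiable k (\<lambda>t. f t + g t)"
proof (induction k arbitrary: f g)
  case 0 then show ?case by (auto intro: continuous_intros)
next
  case (Suc k)
  then obtain f' g' where "\<And>t. (f has_real_derivative f' t) (at t)" "times_differentiable k f'"
    "\<And>t. (g has_real_derivative g' t) (at t)" "times_differentiable k g'" by auto
  then show ?case using Suc.IH
    by (auto intro!: exI[of _ "\<lambda>t. f' t + g' t"] derivative_intros)
qed

lemma times_differentiable_mult:
  "times_differentiable k f \<Longrightarrow> times_differentiable k g \<Longrightarrow> times_differentiable k (\<lambda>t. f t * g t)"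
proof (induction k arbitrary: f g)
  case 0 then show ?case by (auto intro: continuous_intros)
next
  case (Suc k)
  then obtain f' g' where *: "\<And>t. (f has_real_derivative f' t) (at t)" "times_differentiable k f'"
    "\<And>t. (g has_real_derivative g' t) (at t)" "times_differentiable k g'" by auto
  have "times_differentiable k f" "times_differentiable k g"
    using Suc.prems times_differentiable_mono by auto
  then have "times_differentiable k (\<lambda>t. f' t * g t + g' t * f t)"
    by (intro times_differentiable_add Suc.IH *)
  then show ?case using * by (auto intro!: exI[of _ "\<lambda>t. f' t * g t + g' t * f t"] DERIV_mult)
qed

lemma times_differentiable_affine:
  "times_differentiable k f \<Longrightarrow> times_differentiable k (\<lambda>t. f (c * t + d))"
proof (induction k arbitrary: f)
  case 0 then show ?case by (auto intro!: continuous_on_compose2[of UNIV f] continuous_intros)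
next
  case (Suc k)
  then obtain f' where *: "\<And>t. (f has_real_derivative f' t) (at t)" "times_differentiable k f'" by auto
  have "((\<lambda>t. f (c * t + d)) has_real_derivative f' (c * t + d) * c) (at t)" for t
    by (rule DERIV_chain2[OF *(1)]) (auto intro!: derivative_eq_intros)
  moreover have "times_differentiable k (\<lambda>t. f' (c * t + d) * c)"
    by (intro times_differentiable_mult times_differentiable_const Suc.IH *)
  ultimately show ?case
    by (simp only: times_differentiable.simps(2)) (rule exI[of _ "\<lambda>t. f' (c * t + d) * c"], simp)
qed

text \<open>For \<open>k = 0\<close> this is the classical smooth function exp(-1/t) extended by 0.
  The powers of 1/t are included to make the span of the family closed under
  differentiation.\<close>

definition bump :: "nat \<Rightarrow> real \<Rightarrow> real" where
  "bump k t = (if t > 0 then (1 / t) ^ k * exp (- (1 / t)) else 0)"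

lemma bump_tendsto: "(bump k \<longlongrightarrow> 0) (at 0)"
proof -
  have "((\<lambda>t. (inverse t) ^ k / exp (inverse t)) \<longlongrightarrow> (0::real)) (at_right 0)"
    by (rule filterlim_compose[OF tendsto_power_div_exp_0 filterlim_inverse_at_top_right])
  then have "(bump k \<longlongrightarrow> 0) (at_right 0)"
    by (rule Lim_transform_eventually)
       (auto simp: eventually_at_right_less bump_def exp_minus divide_inverse eventually_at_filter)
  moreover have "(bump k \<longlongrightarrow> 0) (at_left 0)"
    by (rule Lim_transform_eventually[of "\<lambda>_. 0"]) (auto simp: bump_def eventually_at_filter)
  ultimately show ?thesis by (simp add: filterlim_split_at)
qed

text \<open>Away from 0 this is the product rule. At 0 the difference quotient of
  \<open>bump k\<close> is \<open>bump (Suc k)\<close>, which tends to 0, the value of the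
  right-hand side there.\<close>

lemma bump_derivative: "(bump k has_real_derivative bump (k + 2) t - real k * bump (k + 1) t) (at t)"
proof -
  consider "t > 0" | "t < 0" | "t = 0" by linarith
  then show ?thesis
  proof cases
    case 1
    have "((\<lambda>t. 1 / t) has_real_derivative - ((1 / t) ^ 2)) (at t)"
      using 1 by (auto intro!: derivative_eq_intros simp: power2_eq_square divide_simps)
    then have "((\<lambda>t. (1 / t) ^ k * exp (- (1 / t))) has_real_derivative
        of_nat k * (- ((1 / t) ^ 2) * (1 / t) ^ (k - Suc 0)) * exp (- (1 / t)) + exp (- (1 / t)) * (- (- ((1 / t) ^ 2))) * (1 / t) ^ k) (at t)"
      by (intro DERIV_mult DERIV_power DERIV_fun_exp DERIV_minus)
    moreover have "of_nat k * (- ((1 / t) ^ 2) * (1 / t) ^ (k - Suc 0)) * exp (- (1 / t)) + exp (- (1 / t)) * (- (- ((1 / t) ^ 2))) * (1 / t) ^ k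
        = bump (k + 2) t - real k * bump (k + 1) t"
      using 1 by (cases k) (auto simp: bump_def power2_eq_square algebra_simps)
    ultimately have "((\<lambda>t. (1 / t) ^ k * exp (- (1 / t))) has_real_derivative bump (k + 2) t - real k * bump (k + 1) t) (at t)"
      by simp
    then show ?thesis
      by (rule has_field_derivative_transform_within_open[of _ _ _ "{0<..}"]) (use 1 in \<open>auto simp: bump_def\<close>)
  next
    case 2
    have "((\<lambda>t. 0) has_real_derivative 0) (at t)" by simp
    then have "(bump k has_real_derivative 0) (at t)"
      by (rule has_field_derivative_transform_within_open[of _ _ _ "{..<0}"]) (use 2 in \<open>auto simp: bump_def\<close>)
    then show ?thesis using 2 by (simp add: bump_def)
  next
    case 3
    have "((\<lambda>h. (bump k (0 + h) - bump k 0) / h) \<longlongrightarrow> 0) (at 0)"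
      by (rule Lim_transform_eventually[OF bump_tendsto[of "Suc k"]])
         (auto simp: bump_def eventually_at_filter)
    then have "(bump k has_real_derivative 0) (at 0)" by (simp add: DERIV_def)
    then show ?thesis using 3 by (simp add: bump_def)
  qed
qed

lemma times_differentiable_bump: "times_differentiable n (bump k)"
proof (induction n arbitrary: k)
  case 0 then show ?case using bump_derivative by (auto intro!: DERIV_continuous_on)
next
  case (Suc n)
  have "times_differentiable n (\<lambda>t. bump (k + 2) t + (- real k) * bump (k + 1) t)"
    by (intro times_differentiable_add times_differentiable_mult times_differentiable_const Suc)
  then show ?case using bump_derivative
    by (auto intro!: exI[of _ "\<lambda>t. bump (k + 2) t - real k * bump (k + 1) t"])
qed

definition smooth_on_interval :: "real \<Rightarrow> real \<Rightarrow> (real \<Rightarrow> real) set" where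
  "smooth_on_interval a b = {h. (\<forall>k. times_differentiable k h) \<and> (\<forall>t. t < a \<or> b < t \<longrightarrow> h t = 0)}"

text \<open>The arguments are \<open>n * (t - a)\<close> and \<open>n * (b - t)\<close>, written out
  in the form expected by \<open>times_differentiable_affine\<close>. The factor \<open>n\<close>
  steepens the flanks, since exp(-1/(n s)) tends to 1 for every positive s.\<close>

definition interval_bump :: "nat \<Rightarrow> real \<Rightarrow> real \<Rightarrow> real \<Rightarrow> real" where
  "interval_bump n a b t = bump 0 (real n * t + real n * (- a)) * bump 0 ((- real n) * t + real n * b)"

lemma interval_bump_smooth: "interval_bump n a b \<in> smooth_on_interval a b"
proof -
  have "times_differentiable k (interval_bump n a b)" for k
    unfolding interval_bump_def[abs_def]
    by (intro times_differentiable_mult times_differentiable_affine times_differentiable_bump)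
  moreover have "interval_bump n a b t = 0" if "t < a \<or> b < t" for t
    using that by (auto simp: interval_bump_def bump_def right_diff_distrib[symmetric] zero_less_mult_iff)
  ultimately show ?thesis by (auto simp: smooth_on_interval_def)
qed

lemma interval_bump_nonneg: "0 \<le> interval_bump n a b t"
  by (auto simp: interval_bump_def bump_def)

lemma interval_bump_le1: "interval_bump n a b t \<le> 1"
proof -
  have "bump 0 s \<le> 1" "bump 0 s \<ge> 0" for s by (auto simp: bump_def)
  then show ?thesis unfolding interval_bump_def by (intro mult_le_one) auto
qed

lemma interval_bump_pos: "n > 0 \<Longrightarrow> a < t \<Longrightarrow> t < b \<Longrightarrow> 0 < interval_bump n a b t"
  by (auto simp: interval_bump_def bump_def right_diff_distrib[symmetric] zero_less_mult_iff)

lemma interval_bump_tendsto: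
  "(\<lambda>n. interval_bump (Suc n) a b t) \<longlonglongrightarrow> (if a < t \<and> t < b then 1 else 0)"
proof -
  have *: "(\<lambda>n. bump 0 (real (Suc n) * s)) \<longlonglongrightarrow> (if s > 0 then 1 else 0)" for s
  proof (cases "s > 0")
    case True
    have "(\<lambda>n. exp (- (inverse (real (Suc n)) / s))) \<longlonglongrightarrow> exp (- (0 / s))"
      by (intro tendsto_intros LIMSEQ_inverse_real_of_nat) (use True in auto)
    then show ?thesis using True
      by (auto simp: bump_def zero_less_mult_iff divide_inverse mult_ac)
  next
    case False
    then have "bump 0 (real (Suc n) * s) = 0" for n by (simp add: bump_def zero_less_mult_iff)
    then show ?thesis using False by simp
  qed
  have "(\<lambda>n. bump 0 (real (Suc n) * (t - a)) * bump 0 (real (Suc n) * (b - t))) \<longlonglongrightarrow>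
     (if t - a > 0 then 1 else 0) * (if b - t > 0 then 1 else 0)"
    by (intro tendsto_mult *)
  moreover have "real (Suc n) * (t - a) = real (Suc n) * t + real (Suc n) * (- a)"
      "real (Suc n) * (b - t) = (- real (Suc n)) * t + real (Suc n) * b" for n
    by (simp_all only: algebra_simps)
  ultimately show ?thesis unfolding interval_bump_def by (auto split: if_splits)
qed

lemma smooth_on_interval_derivative:
  assumes "h \<in> smooth_on_interval a b"
  shows "(h has_real_derivative deriv h t) (at t)" "deriv h \<in> smooth_on_interval a b"
proof -
  have D: "\<exists>h'. (\<forall>t. (h has_real_derivative h' t) (at t)) \<and> times_differentiable k h'" for k
    using assms unfolding smooth_on_interval_def by (auto dest!: spec[of _ "Suc k"])
  then show 1: "(h has_real_derivative deriv h t) (at t)" for t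
    using DERIV_imp_deriv by metis
  have "times_differentiable k (deriv h)" for k
    using D[of k] DERIV_imp_deriv by (metis ext)
  moreover have "deriv h t = 0" if "t < a \<or> b < t" for t
  proof -
    have "((\<lambda>_. 0) has_real_derivative 0) (at t)" by simp
    then have "(h has_real_derivative 0) (at t)"
      by (rule has_field_derivative_transform_within_open[of _ _ _ "{..<a} \<union> {b<..}"])
         (use that assms in \<open>auto simp: smooth_on_interval_def\<close>)
    then show ?thesis by (rule DERIV_imp_deriv)
  qed
  ultimately show "deriv h \<in> smooth_on_interval a b" by (simp add: smooth_on_interval_def)
qed

lemma smooth_on_interval_continuous: "h \<in> smooth_on_interval a b \<Longrightarrow> continuous_on A h"
  by (rule continuous_on_subset[of UNIV]) (auto simp: smooth_on_interval_def dest!: spec[of _ 0])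

lemma smooth_on_interval_add_scale:
  "f \<in> smooth_on_interval a b \<Longrightarrow> g \<in> smooth_on_interval a b \<Longrightarrow> (\<lambda>t. f t + c * g t) \<in> smooth_on_interval a b"
  by (auto simp: smooth_on_interval_def intro!: times_differentiable_add times_differentiable_mult times_differentiable_const)

text \<open>Any primitive is constant on each side of the interval. The vanishing integral makes the
  two constants equal, so one subtraction removes both.\<close>

lemma smooth_on_interval_primitive:
  assumes h: "h \<in> smooth_on_interval a b" and "a < b" and 0: "integral {a..b} h = 0"
  obtains H where "H \<in> smooth_on_interval a b" "deriv H = h"
proof -
  have c: "continuous_on A h" for A by (rule smooth_on_interval_continuous[OF h])
  obtain F where "\<And>t. (F has_vector_derivative h t) (at t)"
    using einterval_antiderivative[of "-\<infinity>" "\<infinity>" h] c[of UNIV] by (auto simp: continuous_on_eq_continuous_at)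
  then have F: "(F has_real_derivative h t) (at t)" for t
    by (simp add: has_real_derivative_iff_has_vector_derivative)
  \<comment> \<open>The definition gives zeros only strictly outside the interval. Continuity adds
    the end points, so that the primitive is constant on the closed half-lines.\<close>
  have z: "h t = 0" if "t \<le> a \<or> b \<le> t" for t
  proof -
    have *: "closed {t. h t = 0}" using c[of UNIV]
      by (auto intro!: closed_Collect_eq)
    have "{t. t < a \<or> b < t} \<subseteq> {t. h t = 0}" using h by (auto simp: smooth_on_interval_def)
    then have "closure {t. t < a \<or> b < t} \<subseteq> {t. h t = 0}" using * closure_minimal by blast
    moreover have "closure {t. t < a \<or> b < t} = {..a} \<union> {b..}"
      proof -
      have "{t. t < a \<or> b < t} = {..<a} \<union> {b<..}" by auto
      then show ?thesis by (simp only: closure_Un closure_lessThan closure_greaterThan)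
    qed
    ultimately show ?thesis using that by auto
  qed
  have const: "\<exists>c. \<forall>t\<in>A. F t = c" if "convex A" "\<And>t. t \<in> A \<Longrightarrow> h t = 0" for A
    by (rule has_field_derivative_zero_constant[OF that(1)]) (use F that(2) in \<open>metis has_field_derivative_at_within\<close>)
  have "\<exists>c. \<forall>t\<in>{..a}. F t = c" "\<exists>c. \<forall>t\<in>{b..}. F t = c"
    by (rule const; use z in auto)+
  then obtain c d where "\<And>t. t \<le> a \<Longrightarrow> F t = c" "\<And>t. b \<le> t \<Longrightarrow> F t = d" by auto
  then have Fa: "\<And>t. t \<le> a \<Longrightarrow> F t = F a" and Fb: "\<And>t. b \<le> t \<Longrightarrow> F t = F b" by simp_all
  have "(h has_integral F b - F a) {a..b}"
    by (rule fundamental_theorem_of_calculus)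
       (use \<open>a < b\<close> F in \<open>auto simp: has_real_derivative_iff_has_vector_derivative[symmetric] intro: has_field_derivative_at_within\<close>)
  then have ab: "F b = F a" using 0 by (simp add: integral_unique)
  define H where "H = (\<lambda>t. F t - F a)"
  have H: "(H has_real_derivative h t) (at t)" for t
    unfolding H_def using F[of t] by (auto intro!: derivative_eq_intros)
  have "times_differentiable k H" for k
  proof (cases k)
    case 0 then show ?thesis using H by (auto intro!: DERIV_continuous_on)
  next
    case (Suc m) then show ?thesis using H h by (auto simp: smooth_on_interval_def)
  qed
  moreover have "H t = 0" if "t < a \<or> b < t" for t
    using that Fa[of t] Fb[of t] ab by (auto simp: H_def)
  ultimately have "H \<in> smooth_on_interval a b" by (simp add: smooth_on_interval_def)
  moreover have "deriv H = h" using H DERIV_imp_deriv by blast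
  ultimately show ?thesis using that by blast
qed

definition tensor :: "(3 \<Rightarrow> real \<Rightarrow> real) \<Rightarrow> real^3 \<Rightarrow> real" where
  "tensor h x = (\<Prod>i\<in>UNIV. h i (x $ i))"

lemma tensor_update: "tensor (h(j := g)) x = g (x $ j) * (\<Prod>i\<in>UNIV - {j}. h i (x $ i))"
  unfolding tensor_def by (subst prod.remove[of UNIV j]) (auto intro!: prod.cong)

lemma tensor_has_derivative:
  assumes "\<And>i t. (h i has_real_derivative h' i t) (at t)"
  shows "(tensor h has_derivative (\<lambda>y. \<Sum>i\<in>UNIV. (h' i (x $ i) * y $ i) * (\<Prod>j\<in>UNIV - {i}. h j (x $ j)))) (at x)"
  unfolding tensor_def
proof (rule has_derivative_prod)
  fix i
  have "(h i has_derivative (*) (h' i (x $ i))) (at (x $ i))"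
    using assms[of i "x $ i"] by (simp add: has_field_derivative_def)
  moreover have "((\<lambda>x. x $ i) has_derivative (\<lambda>y. y $ i)) (at x)"
    by (intro bounded_linear_imp_has_derivative bounded_linear_vec_nth)
  ultimately show "((\<lambda>x. h i (x $ i)) has_derivative (\<lambda>y. h' i (x $ i) * y $ i)) (at x)"
    using has_derivative_compose[of "\<lambda>x. x $ i" "\<lambda>y. y $ i" x UNIV "h i" "(*) (h' i (x $ i))"] by simp
qed

text \<open>A partial derivative acts on one factor only, so tensor products are closed under
  differentiation. Both their smoothness and the separation of variables rest on this.\<close>

lemma partial_deriv_tensor:
  assumes "\<And>i t. (h i has_real_derivative h' i t) (at t)"
  shows "partial_deriv j (tensor h) = tensor (h(j := h' j))"
proof
  fix x
  have "frechet_derivative (tensor h) (at x) = (\<lambda>y. \<Sum>i\<in>UNIV. (h' i (x $ i) * y $ i) * (\<Prod>j\<in>UNIV - {i}. h j (x $ j)))"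
    using frechet_derivative_at[OF tensor_has_derivative[OF assms]] by simp
  then have "partial_deriv j (tensor h) x = (\<Sum>i\<in>UNIV. (h' i (x $ i) * axis j 1 $ i) * (\<Prod>j\<in>UNIV - {i}. h j (x $ j)))"
    by (simp add: partial_deriv_def)
  also have "\<dots> = (\<Sum>i\<in>UNIV. if i = j then h' i (x $ i) * (\<Prod>j\<in>UNIV - {i}. h j (x $ j)) else 0)"
    by (intro sum.cong) (auto simp: axis_def)
  also have "\<dots> = tensor (h(j := h' j)) x" by (simp add: tensor_update)
  finally show "partial_deriv j (tensor h) x = tensor (h(j := h' j)) x" .
qed

lemma continuously_differentiable_tensor:
  "(\<And>i. times_differentiable k (h i)) \<Longrightarrow> continuously_differentiable k (tensor h)"
proof (induction k arbitrary: h)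
  case 0
  have "continuous_on UNIV (\<lambda>x. h i (x $ i))" for i
    by (rule continuous_on_compose2[of UNIV "h i"]) (use 0 in \<open>auto intro!: continuous_intros\<close>)
  then show ?case by (auto simp: tensor_def intro!: continuous_on_prod)
next
  case (Suc k)
  then have "\<exists>h'. (\<forall>t. (h i has_real_derivative h' t) (at t)) \<and> times_differentiable k h'" for i by auto
  then obtain h' where h': "\<And>i t. (h i has_real_derivative h' i t) (at t)" "\<And>i. times_differentiable k (h' i)" by metis
  have "tensor h differentiable_on UNIV"
    unfolding differentiable_on_def differentiable_def
    by (intro ballI exI) (rule tensor_has_derivative, rule h')
  moreover have "continuously_differentiable k (partial_deriv j (tensor h))" for j
    unfolding partial_deriv_tensor[OF h'(1)]
    by (rule Suc.IH) (use Suc.prems times_differentiable_mono h'(2) in auto)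
  ultimately show ?case by simp
qed

definition box_functions :: "real^3 \<Rightarrow> real^3 \<Rightarrow> (3 \<Rightarrow> real \<Rightarrow> real) set" where
  "box_functions a b = {h. \<forall>i. h i \<in> smooth_on_interval (a $ i) (b $ i)}"

lemma tensor_test_function:
  assumes h: "h \<in> box_functions a b" and "cbox a b \<subseteq> U"
  shows "tensor h \<in> test_functions U"
proof -
  have "h i (x $ i) = 0" if "x \<notin> cbox a b" "\<not> (a $ i \<le> x $ i \<and> x $ i \<le> b $ i)" for x i
    using h that(2) by (auto simp: box_functions_def smooth_on_interval_def not_le)
  then have "tensor h x = 0" if "x \<notin> cbox a b" for x
    using that unfolding tensor_def mem_box_cart by (metis UNIV_I finite prod_zero_iff)
  then have "closure {x. tensor h x \<noteq> 0} \<subseteq> cbox a b"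
    by (intro closure_minimal) (auto simp: closed_cbox)
  moreover have "continuously_differentiable k (tensor h)" for k
    by (rule continuously_differentiable_tensor) (use h in \<open>auto simp: box_functions_def smooth_on_interval_def\<close>)
  ultimately show ?thesis
    using assms(2) bounded_subset[OF bounded_cbox] by (auto simp: test_functions_def compact_eq_bounded_closed)
qed

lemma partial_deriv_tensor_box:
  assumes "h \<in> box_functions a b"
  shows "partial_deriv j (tensor h) = tensor (h(j := deriv (h j)))" "h(j := deriv (h j)) \<in> box_functions a b"
  using assms smooth_on_interval_derivative(2) smooth_on_interval_derivative(1)
  by (auto simp: box_functions_def intro!: partial_deriv_tensor) (metis smooth_on_interval_derivative(1))

section \<open>The fundamental lemma of the calculus of variations\<close>

lemma lebesgue_on_integral_indicator:
  fixes f :: "'a::euclidean_space \<Rightarrow> real"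
  assumes "U \<in> sets lebesgue"
  shows "(LINT x|lebesgue_on U. f x) = (LINT x|lebesgue. indicator U x * f x)"
  by (subst integral_restrict_space) (use assms in auto)

text \<open>A Dynkin system argument: boxes are stable under intersection and generate the Borel
  sets, so the integral of \<open>u\<close> vanishes over every Borel set.\<close>

lemma AE_zero_if_box_integrals_zero:
  fixes u :: "'a::euclidean_space \<Rightarrow> real"
  assumes u: "integrable lborel u" and box0: "\<And>a b. (LINT x|lborel. indicator (box a b) x * u x) = 0"
  shows "AE x in lborel. u x = 0"
proof -
  have i: "integrable lborel (\<lambda>x. indicator A x * u x)" if "A \<in> sets borel" for A
    using integrable_mult_indicator[OF _ u, of A] that by simp
  have um: "u \<in> borel_measurable borel" using u by auto
  \<comment> \<open>Complements in the Dynkin system require the integral over the whole space,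
    which is a dominated limit over growing boxes.\<close>
  have whole: "(LINT x|lborel. u x) = 0"
  proof -
    let ?B = "\<lambda>n. box (- (real n *\<^sub>R One)) (real n *\<^sub>R One :: 'a)"
    have "(\<lambda>n. LINT x|lborel. indicator (?B n) x * u x) \<longlonglongrightarrow> (LINT x|lborel. u x)"
    proof (rule integral_dominated_convergence[where w = "\<lambda>x. \<bar>u x\<bar>"])
      show "AE x in lborel. (\<lambda>n. indicator (?B n) x * u x) \<longlonglongrightarrow> u x"
      proof (intro AE_I2 tendsto_eventually)
        fix x :: 'a
        obtain N where N: "x \<in> ?B N" using UN_box_eq_UNIV by blast
        have "x \<in> ?B n" if "n \<ge> N" for n
        proof -
          have "real N \<le> real n" using that by simp
          then show ?thesis using N by (force simp: mem_box)
        qed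
        then show "\<forall>\<^sub>F n in sequentially. indicator (?B n) x * u x = u x"
          by (intro eventually_sequentiallyI[of N]) simp
      qed
    qed (use u um in \<open>auto simp: indicator_def\<close>)
    then show ?thesis using box0 by (simp add: LIMSEQ_const_iff)
  qed
  have stable: "Int_stable (range (\<lambda>(a, b). box a b :: 'a set))"
    unfolding Int_stable_def by (auto simp: box_Int_box)
  have "(LINT x|lborel. indicator A x * u x) = 0" if A: "A \<in> sigma_sets UNIV (range (\<lambda>(a, b). box a b :: 'a set))" for A
    using stable subset_UNIV[of "range (\<lambda>(a, b). box a b :: 'a set)", folded Pow_UNIV] A
  proof (induction rule: sigma_sets_induct_disjoint)
    case (compl A)
    then have A: "A \<in> sets borel" by (simp add: borel_eq_box sets_measure_of)
    have "(LINT x|lborel. indicator (UNIV - A) x * u x) = (LINT x|lborel. u x - indicator A x * u x)"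
      by (intro Bochner_Integration.integral_cong) (auto simp: indicator_def)
    also have "\<dots> = 0" using compl whole u i[OF A] by simp
    finally show ?case .
  next
    case (union A)
    then have A: "A n \<in> sets borel" for n by (auto simp: borel_eq_box sets_measure_of)
    have "set_lebesgue_integral lborel (\<Union>n. A n) u = (\<Sum>n. set_lebesgue_integral lborel (A n) u)"
    proof (rule lebesgue_integral_countable_add)
      show "set_integrable lborel (\<Union>n. A n) u" using i[of "\<Union>n. A n"] A by (auto simp: set_integrable_def)
    qed (use A union in \<open>auto simp: disjoint_family_on_def\<close>)
    then show ?case using union by (simp add: set_lebesgue_integral_def)
  qed (use box0 in auto)
  then have "set_lebesgue_integral lborel A u = set_lebesgue_integral lborel A (\<lambda>_. 0)" if "A \<in> sets borel" for A
    using that by (simp add: borel_eq_box sets_measure_of set_lebesgue_integral_def)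
  then show ?thesis by (intro density_unique_real[OF u]) auto
qed

text \<open>By Lindelof, countably many of the neighbourhoods already cover \<open>S\<close>, and
  countably many null sets have a null union.\<close>

lemma AE_lebesgue_on_locally:
  fixes S :: "(real^3) set"
  assumes S: "open S"
    and B: "\<And>x. x \<in> S \<Longrightarrow> \<exists>V. open V \<and> x \<in> V \<and> (AE y in lebesgue_on V. P y)"
  shows "AE y in lebesgue_on S. P y"
proof -
  obtain V where V: "\<And>x. x \<in> S \<Longrightarrow> open (V x) \<and> x \<in> V x \<and> (AE y in lebesgue_on (V x). P y)"
    using B by metis
  have "\<And>W. W \<in> V ` S \<Longrightarrow> open W" using V by blast
  then obtain F where F: "F \<subseteq> V ` S" "countable F" "\<Union>F = \<Union>(V ` S)"
    using Lindelof[of "V ` S"] by metis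
  have "AE y in lebesgue. y \<in> W \<longrightarrow> P y" if W: "W \<in> F" for W
  proof -
    obtain x where "x \<in> S" "W = V x" using W F(1) by blast
    moreover from this have "V x \<in> sets lebesgue" using V[of x] by auto
    ultimately show ?thesis using V[of x] AE_restrict_space_iff[of "V x" lebesgue P] by simp
  qed
  then have "AE y in lebesgue. \<forall>W\<in>F. y \<in> W \<longrightarrow> P y"
    unfolding AE_ball_countable[OF F(2)] by blast
  then have "AE y in lebesgue. y \<in> S \<longrightarrow> P y"
    by eventually_elim (use F(3) V in blast)
  moreover have "S \<in> sets lebesgue" using S by auto
  ultimately show ?thesis by (simp add: AE_restrict_space_iff)
qed

lemma integrable_mult_bounded:
  fixes f g :: "'a \<Rightarrow> real"
  assumes "integrable M f" "g \<in> borel_measurable M" "\<And>x. \<bar>g x\<bar> \<le> C"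
  shows "integrable M (\<lambda>x. f x * g x)"
proof (rule Bochner_Integration.integrable_bound)
  show "integrable M (\<lambda>x. C * f x)" using assms(1) by simp
  have "\<bar>f x * g x\<bar> \<le> \<bar>C * f x\<bar>" for x
    using mult_mono[OF assms(3)[of x] order_refl, of "\<bar>f x\<bar>"] assms(3)[of x] abs_ge_zero[of "g x"]
    by (simp add: abs_mult mult_ac)
  then show "AE x in M. norm (f x * g x) \<le> norm (C * f x)" by auto
qed (use assms in auto)

lemma borel_measurable_lebesgue_on:
  fixes f :: "real^3 \<Rightarrow> 'b::euclidean_space"
  assumes "f \<in> borel_measurable borel" shows "f \<in> borel_measurable (lebesgue_on S)"
  using assms by (intro measurable_restrict_space1 measurable_completion) auto

lemma integrable_mult_test:
  assumes "integrable (lebesgue_on S) u" "\<phi> \<in> test_functions V"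
  shows "integrable (lebesgue_on S) (\<lambda>x. u x * \<phi> x)"
proof -
  obtain C where "\<And>x. \<bar>\<phi> x\<bar> \<le> C" using test_function_bounded[OF assms(2)] by metis
  then show ?thesis
    by (intro integrable_mult_bounded[OF assms(1) borel_measurable_lebesgue_on[OF test_function_measurable[OF assms(2)]]])
qed

lemma tensor_bump_tendsto:
  "(\<lambda>n. tensor (\<lambda>i. interval_bump (Suc n) (a $ i) (b $ i)) x) \<longlonglongrightarrow> indicator (box a b) (x :: real^3)"
proof -
  have "(\<lambda>n. tensor (\<lambda>i. interval_bump (Suc n) (a $ i) (b $ i)) x)
      \<longlonglongrightarrow> (\<Prod>i\<in>UNIV. if a $ i < x $ i \<and> x $ i < b $ i then 1 else 0)"
    unfolding tensor_def by (intro tendsto_prod interval_bump_tendsto)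
  moreover have "(\<Prod>i\<in>UNIV. if a $ i < x $ i \<and> x $ i < b $ i then 1 else (0::real)) = indicator (box a b) x"
    by (auto simp: indicator_def mem_box_cart prod.neutral prod_zero_iff)
  ultimately show ?thesis by simp
qed

lemma tensor_bump_bounds:
  "0 \<le> tensor (\<lambda>i. interval_bump n (a $ i) (b $ i)) x" "tensor (\<lambda>i. interval_bump n (a $ i) (b $ i)) x \<le> 1"
  unfolding tensor_def by (auto intro!: prod_nonneg prod_le_1 interval_bump_nonneg interval_bump_le1)

text \<open>The bumps converge to indicators of boxes, so it suffices to test against them.\<close>

lemma fundamental_lemma_box:
  fixes u :: "real^3 \<Rightarrow> real"
  assumes u: "integrable (lebesgue_on S) u" and S: "S \<in> sets lebesgue" and "cbox a b \<subseteq> S"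
    and test: "\<And>h. h \<in> box_functions a b \<Longrightarrow> (LINT x|lebesgue_on S. u x * tensor h x) = 0"
  shows "AE x in lebesgue_on (box a b). u x = 0"
proof -
  have box_zero: "(LINT x|lebesgue_on S. u x * indicator (box c d) x) = 0" if cd: "box c d \<subseteq> box a b" for c d
  proof (cases "box c d = {}")
    case False
    let ?h = "\<lambda>n i. interval_bump (Suc n) (c $ i) (d $ i)"
    have "cbox c d \<subseteq> cbox a b" using cd False
      by (metis closure_box closure_mono box_eq_empty(1) subset_empty)
    then have cd': "a $ i \<le> c $ i" "d $ i \<le> b $ i" for i
      using False by (auto simp: subset_interval_cart interval_ne_empty_cart less_imp_le)
    have h: "?h n \<in> box_functions a b" for n
      unfolding box_functions_def
    proof safe
      fix i
      have "\<And>t. t < a $ i \<or> b $ i < t \<Longrightarrow> t < c $ i \<or> d $ i < t" using cd'[of i] by linarith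
      then show "?h n i \<in> smooth_on_interval (a $ i) (b $ i)"
        using interval_bump_smooth[of "Suc n" "c $ i" "d $ i"] unfolding smooth_on_interval_def by blast
    qed
    have "(\<lambda>n. LINT x|lebesgue_on S. u x * tensor (?h n) x) \<longlonglongrightarrow> (LINT x|lebesgue_on S. u x * indicator (box c d) x)"
    proof (rule integral_dominated_convergence[where w = "\<lambda>x. \<bar>u x\<bar>"])
      show "(\<lambda>x. u x * indicator (box c d) x) \<in> borel_measurable (lebesgue_on S)"
        using u by (intro borel_measurable_times[OF borel_measurable_integrable borel_measurable_lebesgue_on]) auto
      show "(\<lambda>x. u x * tensor (?h n) x) \<in> borel_measurable (lebesgue_on S)" for n
        using u test_function_measurable[OF tensor_test_function[OF h order_refl]]
        by (intro borel_measurable_times[OF borel_measurable_integrable borel_measurable_lebesgue_on]) auto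
      show "AE x in lebesgue_on S. (\<lambda>n. u x * tensor (?h n) x) \<longlonglongrightarrow> u x * indicator (box c d) x"
        by (intro AE_I2 tendsto_intros tensor_bump_tendsto)
      show "AE x in lebesgue_on S. norm (u x * tensor (?h n) x) \<le> \<bar>u x\<bar>" for n
        using tensor_bump_bounds[where a = c and b = d and n = "Suc n"]
        by (intro AE_I2) (auto simp: abs_mult mult_left_le)
    qed (use u in auto)
    then show ?thesis using test[OF h] by (simp add: LIMSEQ_const_iff)
  qed simp
  define U where "U = (\<lambda>x. indicator (box a b) x * u x)"
  have "box a b \<subseteq> S" using assms(3) box_subset_cbox by blast
  then have US: "U x = indicator (box a b) x * (indicator S x * u x)" for x by (auto simp: U_def indicator_def)
  have "integrable lebesgue (\<lambda>x. indicator S x * u x)"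
    using u S by (simp add: integrable_restrict_space)
  then have Ui: "integrable lebesgue U" unfolding US[abs_def]
    using integrable_mult_indicator[of "box a b" lebesgue "\<lambda>x. indicator S x * u x"] by auto
  \<comment> \<open>\<open>u\<close> is only Lebesgue measurable, whereas the criterion with boxes
    is about \<open>lborel\<close>. A Borel version of the truncation \<open>U\<close> bridges the
    two.\<close>
  then obtain U' where U': "U' \<in> borel_measurable lborel" "AE x in lborel. U x = U' x"
    using completion_ex_borel_measurable_real[of U lborel] by auto
  have ae: "AE x in lebesgue. U x = U' x" using U'(2) by (rule AE_completion)
  have U'm: "U' \<in> borel_measurable lebesgue" using U'(1) by (rule measurable_completion)
  have "integrable lebesgue U'" using Ui U'm ae integrable_cong_AE[of U lebesgue U'] by auto
  then have U'i: "integrable lborel U'" using U'(1) integrable_completion by blast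
  have "AE x in lborel. U' x = 0"
  proof (rule AE_zero_if_box_integrals_zero[OF U'i])
    fix c d :: "real^3"
    obtain c' d' where cd: "box a b \<inter> box c d = box c' d'" by (rule that[OF box_Int_box])
    have "(LINT x|lborel. indicator (box c d) x * U' x) = (LINT x|lebesgue. indicator (box c d) x * U' x)"
      by (rule integral_completion[symmetric], intro borel_measurable_times borel_measurable_indicator U'(1)) simp
    also have "\<dots> = (LINT x|lebesgue. indicator (box c d) x * U x)"
    proof (rule integral_cong_AE)
      show "AE x in lebesgue. indicator (box c d) x * U' x = indicator (box c d) x * U x"
        using ae by eventually_elim simp
    qed (intro borel_measurable_times borel_measurable_indicator U'm borel_measurable_integrable[OF Ui]; simp)+
    also have "\<dots> = (LINT x|lebesgue. indicator S x * (u x * indicator (box c' d') x))"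
      using \<open>box a b \<subseteq> S\<close> cd
      by (intro Bochner_Integration.integral_cong) (auto simp: U_def indicator_def)
    also have "\<dots> = (LINT x|lebesgue_on S. u x * indicator (box c' d') x)"
      by (rule lebesgue_on_integral_indicator[OF S, symmetric])
    also have "\<dots> = 0" by (rule box_zero) (use cd in auto)
    finally show "(LINT x|lborel. indicator (box c d) x * U' x) = 0" .
  qed
  then have "AE x in lebesgue. U' x = 0" by (rule AE_completion)
  with ae have "AE x in lebesgue. x \<in> box a b \<longrightarrow> u x = 0"
    by eventually_elim (auto simp: U_def)
  then show ?thesis by (simp add: AE_restrict_space_iff)
qed

lemma open_contains_box_nbhd:
  fixes x :: "real^3"
  assumes "open S" "x \<in> S" obtains a b where "x \<in> box a b" "cbox a b \<subseteq> S"
  using open_contains_cbox[OF assms(1), of x] assms by (metis open_contains_cbox)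

theorem fundamental_lemma:
  fixes u :: "real^3 \<Rightarrow> real"
  assumes u: "integrable (lebesgue_on S) u" and S: "open S"
    and test: "\<And>\<phi>. \<phi> \<in> test_functions S \<Longrightarrow> (LINT x|lebesgue_on S. u x * \<phi> x) = 0"
  shows "AE x in lebesgue_on S. u x = 0"
proof (rule AE_lebesgue_on_locally[OF S])
  fix x assume "x \<in> S"
  then obtain a b where ab: "x \<in> box a b" "cbox a b \<subseteq> S" using open_contains_box_nbhd[OF S] by blast
  have "AE x in lebesgue_on (box a b). u x = 0"
    by (rule fundamental_lemma_box[OF u _ ab(2)]) (use S test tensor_test_function ab(2) in auto)
  then show "\<exists>V. open V \<and> x \<in> V \<and> (AE y in lebesgue_on V. u y = 0)" using ab(1) open_box by blast
qed

section \<open>Integration by parts for piecewise affine functions\<close>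

lemma integrable_bounded_support:
  fixes f :: "'a::euclidean_space \<Rightarrow> real"
  assumes "f \<in> borel_measurable borel" "bounded B" "\<And>x. \<bar>f x\<bar> \<le> C" "\<And>x. x \<notin> B \<Longrightarrow> f x = 0"
  shows "integrable lborel f"
proof -
  obtain a b where ab: "B \<subseteq> cbox a b" using bounded_subset_cbox_symmetric[OF assms(2)] by blast
  show ?thesis
  proof (rule integrableI_bounded_set[where A = "cbox a b" and B = C])
    show "emeasure lborel (cbox a b) < \<infinity>" by (simp add: emeasure_lborel_cbox_eq less_top[symmetric])
  qed (use assms ab in auto)
qed

lemma lborel_integral_shift:
  fixes f :: "'a::euclidean_space \<Rightarrow> real"
  assumes "f \<in> borel_measurable borel"
  shows "(LINT x|lborel. f (x + c)) = (LINT x|lborel. f x)"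
proof -
  have "(LINT x|lborel. f x) = (LINT x|distr lborel borel ((+) c). f x)"
    by (simp add: lborel_distr_plus)
  also have "\<dots> = (LINT x|lborel. f (c + x))"
    by (rule integral_distr) (use assms in auto)
  finally show ?thesis by (simp add: add.commute)
qed

text \<open>The cells cut the segment into finitely many closed pieces on which \<open>f\<close> is
  affine with slope at most \<open>L\<close>. Lipschitz bounds on closed pieces covering an interval
  combine without loss in the constant.\<close>

lemma segment_lipschitz:
  fixes f :: "real^3 \<Rightarrow> real"
  assumes "finite \<S>" "\<And>T. T \<in> \<S> \<Longrightarrow> closed T"
    and aff: "\<And>T x. T \<in> \<S> \<Longrightarrow> x \<in> T \<inter> U \<Longrightarrow> f x = a T \<bullet> x + b T"
    and seg: "closed_segment x y \<subseteq> U" and U: "U \<subseteq> \<Union>\<S>"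
    and L: "\<And>T. T \<in> \<S> \<Longrightarrow> norm (a T) \<le> L"
  shows "\<bar>f y - f x\<bar> \<le> L * norm (y - x)"
proof -
  define p where "p = (\<lambda>t. x + t *\<^sub>R (y - x))"
  have p: "p t \<in> closed_segment x y" if "t \<in> {0..1}" for t
    using that unfolding closed_segment_def p_def by (auto simp: algebra_simps intro!: exI[of _ t])
  have c: "continuous_on UNIV p" unfolding p_def by (intro continuous_intros)
  let ?V = "\<lambda>T. {0..1} \<inter> p -` T"
  have "x \<in> U" using seg by auto
  then have "\<S> \<noteq> {}" using U by auto
  then obtain T0 where "T0 \<in> \<S>" by blast
  then have L0: "0 \<le> L" using L[of T0] norm_ge_zero order_trans by blast
  have "(L * norm (y - x))-lipschitz_on {0..1} (f \<circ> p)"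
  proof (rule lipschitz_on_closed_Union[where I = \<S> and U = ?V])
    fix T assume T: "T \<in> \<S>"
    show "closed (?V T)"
      using c assms(2)[OF T] by (intro closed_Int closed_vimage) auto
    show "(L * norm (y - x))-lipschitz_on (?V T) (f \<circ> p)"
    proof (rule lipschitz_onI)
      fix s t assume st: "s \<in> ?V T" "t \<in> ?V T"
      then have "f (p s) = a T \<bullet> p s + b T" "f (p t) = a T \<bullet> p t + b T"
        using aff[OF T] p seg by auto
      then have "dist ((f \<circ> p) s) ((f \<circ> p) t) = \<bar>a T \<bullet> (p s - p t)\<bar>"
        by (simp add: dist_real_def inner_diff_right)
      also have "p s - p t = (s - t) *\<^sub>R (y - x)" by (simp add: p_def algebra_simps)
      also have "\<bar>a T \<bullet> ((s - t) *\<^sub>R (y - x))\<bar> \<le> norm (a T) * norm ((s - t) *\<^sub>R (y - x))"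
        by (rule Cauchy_Schwarz_ineq2)
      also have "\<dots> \<le> L * norm ((s - t) *\<^sub>R (y - x))" by (intro mult_right_mono L T) auto
      finally show "dist ((f \<circ> p) s) ((f \<circ> p) t) \<le> L * norm (y - x) * dist s t"
        by (simp add: dist_real_def mult_ac)
    qed (use L0 in auto)
  next
    show "{0..1} \<subseteq> (\<Union>T\<in>\<S>. ?V T)" using p seg U by fastforce
  qed (use assms L0 in auto)
  then have "dist ((f \<circ> p) 1) ((f \<circ> p) 0) \<le> L * norm (y - x) * dist 1 (0::real)"
    by (rule lipschitz_onD) auto
  then show ?thesis by (simp add: p_def dist_real_def)
qed

text \<open>The limit at a point is checked cell by cell. A closed cell missing the point does not
  come near it, and finitely many cells may be joined by \<open>at_within_union\<close>.\<close>

lemma continuous_on_piecewise: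
  fixes f :: "'a::topological_space \<Rightarrow> 'b::topological_space"
  assumes "finite \<S>" "\<And>T. T \<in> \<S> \<Longrightarrow> closed T" "U \<subseteq> \<Union>\<S>"
    "\<And>T. T \<in> \<S> \<Longrightarrow> continuous_on (T \<inter> U) f"
  shows "continuous_on U f"
proof -
  have "(f \<longlongrightarrow> f x) (at x within U)" if x: "x \<in> U" for x
  proof -
    have *: "(f \<longlongrightarrow> f x) (at x within T \<inter> U)" if T: "T \<in> \<S>" for T
    proof (cases "x \<in> T")
      case True
      then show ?thesis using assms(4)[OF T] x by (auto simp: continuous_on_def)
    next
      case False
      then have "\<forall>\<^sub>F y in at x within T \<inter> U. f x = f y"
        unfolding eventually_at_topological using assms(2)[OF T] by (intro exI[of _ "- T"]) auto
      then show ?thesis by (rule Lim_transform_eventually[OF tendsto_const])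
    qed
    have "(f \<longlongrightarrow> f x) (at x within (\<Union>T\<in>\<S>'. T \<inter> U))" if "finite \<S>'" "\<S>' \<subseteq> \<S>" for \<S>'
      using that
    proof (induction \<S>' rule: finite_induct)
      case (insert T \<S>')
      then show ?case using *[of T] by (simp add: at_within_union filterlim_sup)
    qed auto
    from this[OF assms(1) order_refl] show ?thesis
      using assms(3) by (simp add: Int_UN_distrib2[symmetric] Int_absorb1 flip: Int_Union2)
  qed
  then show ?thesis by (simp add: continuous_on_def)
qed

text \<open>Integration by parts through difference quotients: the quotients of the test function are moved to
  the piecewise affine function by translation invariance, where they converge off the null set of cell
  boundaries and are bounded by the Lipschitz constant along segments.\<close>

lemma piecewise_affine_integration_by_parts:
  fixes f :: "real^3 \<Rightarrow> real"
  assumes U: "open U" "bounded U" and fin: "finite \<S>" and cl: "\<And>T. T \<in> \<S> \<Longrightarrow> closed T"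
    and cv: "\<And>T. T \<in> \<S> \<Longrightarrow> convex T" and cover: "U \<subseteq> \<Union>\<S>"
    and aff: "\<And>T x. T \<in> \<S> \<Longrightarrow> x \<in> T \<inter> U \<Longrightarrow> f x = a T \<bullet> x + b T"
    and g: "g \<in> borel_measurable (lebesgue_on U)"
      "\<And>T x. T \<in> \<S> \<Longrightarrow> x \<in> interior T \<inter> U \<Longrightarrow> g x = a T $ j"
    and \<phi>: "\<phi> \<in> test_functions U"
  shows "(LINT x|lebesgue_on U. f x * partial_deriv j \<phi> x) = - (LINT x|lebesgue_on U. g x * \<phi> x)"
proof -
  let ?K = "closure {x. \<phi> x \<noteq> 0}"
  let ?e = "axis j (1::real)"
  \<comment> \<open>Extension by zero makes translation invariance of \<open>lborel\<close>
    applicable. The jump at the boundary of \<open>U\<close> is harmless because \<open>F\<close> is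
    always multiplied by a function supported inside.\<close>
  define F where "F = (\<lambda>x. indicator U x * f x)"
  have Uset: "U \<in> sets borel" "U \<in> sets lebesgue" using U(1) by auto
  have K: "compact ?K" "?K \<subseteq> U" using \<phi> by (auto simp: test_functions_def)
  have \<phi>K: "\<phi> x = 0" if "x \<notin> ?K" for x using that closure_subset[of "{x. \<phi> x \<noteq> 0}"] by auto
  have "continuous_on U f"
  proof (rule continuous_on_piecewise[OF fin cl cover])
    fix T assume T: "T \<in> \<S>"
    show "continuous_on (T \<inter> U) f"
      by (rule continuous_on_eq[of _ "\<lambda>x. a T \<bullet> x + b T"])
         (use aff[OF T] in \<open>auto intro!: continuous_intros\<close>)
  qed
  then have Fm: "F \<in> borel_measurable borel"
    unfolding F_def using borel_measurable_continuous_on_indicator[OF Uset(1), of f] by simp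
  obtain L where L: "\<And>T. T \<in> \<S> \<Longrightarrow> norm (a T) \<le> L" "\<And>T. T \<in> \<S> \<Longrightarrow> \<bar>b T\<bar> \<le> L" "L \<ge> 0"
  proof
    let ?L = "(\<Sum>T\<in>\<S>. norm (a T) + \<bar>b T\<bar>)"
    fix T assume T: "T \<in> \<S>"
    have "norm (a T) + \<bar>b T\<bar> \<le> ?L" using fin T by (intro member_le_sum) auto
    then show "norm (a T) \<le> ?L" "\<bar>b T\<bar> \<le> ?L" by (auto intro: order_trans[rotated])
  qed (auto intro: sum_nonneg)
  obtain R where R: "\<And>x. x \<in> U \<Longrightarrow> norm x \<le> R" "R > 0" using U(2) bounded_pos by metis
  have fb: "\<bar>f x\<bar> \<le> L * R + L" if x: "x \<in> U" for x
  proof -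
    obtain T where T: "T \<in> \<S>" "x \<in> T" using cover x by blast
    have "\<bar>a T \<bullet> x\<bar> \<le> norm (a T) * norm x" by (rule Cauchy_Schwarz_ineq2)
    also have "\<dots> \<le> L * R" using L(1)[OF T(1)] R(1)[OF x] L(3) by (intro mult_mono) auto
    finally show ?thesis using aff[OF T(1), of x] T x L(2)[OF T(1)] by auto
  qed
  define M where "M = L * R + L"
  have M0: "M \<ge> 0" using L R by (simp add: M_def)
  have FM: "\<bar>F x\<bar> \<le> M" for x using fb[of x] M0 by (auto simp: F_def M_def indicator_def)
  obtain D where D: "\<And>x. \<bar>partial_deriv j \<phi> x\<bar> \<le> D" "D > 0"
    using test_function_bounded[OF test_function_partial_deriv[OF \<phi>]] by metis
  obtain P where P: "\<And>x. \<bar>\<phi> x\<bar> \<le> P" "P > 0" using test_function_bounded[OF \<phi>] by metis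
  \<comment> \<open>A uniform distance between the support of \<open>\<phi>\<close> and the
    complement of \<open>U\<close>. It keeps the segment from \<open>x - h n *\<^sub>R ?e\<close> to
    \<open>x\<close> inside \<open>U\<close> for \<open>x\<close> in the support, where
    \<open>segment_lipschitz\<close> applies.\<close>
  obtain \<delta> where \<delta>: "\<delta> > 0" "\<And>x y. x \<in> ?K \<Longrightarrow> dist x y < \<delta> \<Longrightarrow> y \<in> U"
  proof -
    obtain e where "e > 0" "(\<Union>x\<in>?K. ball x e) \<subseteq> U"
      using compact_subset_open_imp_ball_epsilon_subset[OF K(1) U(1) K(2)] by blast
    then show ?thesis using that[of e] by (auto simp: subset_iff)
  qed
  \<comment> \<open>The denominators start at 2, so that \<open>h n < \<delta>\<close> holds
    strictly even for \<open>n = 0\<close>.\<close>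
  define h where "h = (\<lambda>n::nat. \<delta> * inverse (real (Suc (Suc n))))"
  have h: "0 < h n" "h n < \<delta>" for n using \<delta>(1) by (auto simp: h_def field_simps intro: add_pos_nonneg)
  have hl: "h \<longlonglongrightarrow> 0"
    unfolding h_def using tendsto_mult_right_zero[OF LIMSEQ_Suc[OF LIMSEQ_inverse_real_of_nat], of \<delta>] by simp
  have hl': "filterlim h (at 0) sequentially"
    using hl h(1) by (auto simp: filterlim_at intro!: always_eventually less_imp_neq[symmetric])
  note \<phi>m [measurable] = test_function_measurable[OF \<phi>] and Fm [measurable]
  have dm [measurable]: "partial_deriv j \<phi> \<in> borel_measurable borel"
    by (rule test_function_measurable[OF test_function_partial_deriv[OF \<phi>]])
  have Kb: "bounded ?K" using K(1) compact_imp_bounded by blast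
  \<comment> \<open>Summation by parts: the shift of the test function is turned into the opposite
    shift of \<open>F\<close>. The sign in the final formula originates here.\<close>
  have quot: "(LINT x|lborel. F x * ((\<phi> (x + h n *\<^sub>R ?e) - \<phi> x) / h n))
      = - (LINT x|lborel. ((F x - F (x - h n *\<^sub>R ?e)) / h n) * \<phi> x)" for n
  proof -
    have i1: "integrable lborel (\<lambda>x. F x * \<phi> (x + h n *\<^sub>R ?e))"
    proof (rule integrable_bounded_support[OF _ U(2), where C = "M * P"])
      show "(\<lambda>x. F x * \<phi> (x + h n *\<^sub>R ?e)) \<in> borel_measurable borel" by measurable
      show "\<bar>F x * \<phi> (x + h n *\<^sub>R ?e)\<bar> \<le> M * P" for x
        using FM[of x] P(1)[of "x + h n *\<^sub>R ?e"] M0 unfolding abs_mult by (intro mult_mono) auto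
    qed (auto simp: F_def)
    have i2: "integrable lborel (\<lambda>x. F x * \<phi> x)"
    proof (rule integrable_bounded_support[OF _ U(2), where C = "M * P"])
      show "(\<lambda>x. F x * \<phi> x) \<in> borel_measurable borel" by measurable
      show "\<bar>F x * \<phi> x\<bar> \<le> M * P" for x
        using FM[of x] P(1)[of x] M0 unfolding abs_mult by (intro mult_mono) auto
    qed (auto simp: F_def)
    have i3: "integrable lborel (\<lambda>x. F (x - h n *\<^sub>R ?e) * \<phi> x)"
    proof (rule integrable_bounded_support[OF _ Kb, where C = "M * P"])
      show "(\<lambda>x. F (x - h n *\<^sub>R ?e) * \<phi> x) \<in> borel_measurable borel" by measurable
      show "\<bar>F (x - h n *\<^sub>R ?e) * \<phi> x\<bar> \<le> M * P" for x
        using FM[of "x - h n *\<^sub>R ?e"] P(1)[of x] M0 unfolding abs_mult by (intro mult_mono) auto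
      show "F (x - h n *\<^sub>R ?e) * \<phi> x = 0" if "x \<notin> ?K" for x using \<phi>K[OF that] by simp
    qed
    have "(LINT x|lborel. F (x - h n *\<^sub>R ?e) * \<phi> x) = (LINT x|lborel. F x * \<phi> (x + h n *\<^sub>R ?e))"
    proof -
      have "(\<lambda>x. F (x - h n *\<^sub>R ?e) * \<phi> x) \<in> borel_measurable borel" by measurable
      from lborel_integral_shift[OF this, of "h n *\<^sub>R ?e"] show ?thesis by (simp only: add_diff_cancel)
    qed
    then have "(LINT x|lborel. F x * \<phi> (x + h n *\<^sub>R ?e) - F x * \<phi> x)
        = - (LINT x|lborel. F x * \<phi> x - F (x - h n *\<^sub>R ?e) * \<phi> x)"
      unfolding Bochner_Integration.integral_diff[OF i1 i2] Bochner_Integration.integral_diff[OF i2 i3]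
      by linarith
    then have *: "(LINT x|lborel. F x * \<phi> (x + h n *\<^sub>R ?e) - F x * \<phi> x) / h n
        = - ((LINT x|lborel. F x * \<phi> x - F (x - h n *\<^sub>R ?e) * \<phi> x) / h n)"
      by (simp only: minus_divide_left)
    have "F x * ((\<phi> (x + h n *\<^sub>R ?e) - \<phi> x) / h n) = (F x * \<phi> (x + h n *\<^sub>R ?e) - F x * \<phi> x) / h n"
      "((F x - F (x - h n *\<^sub>R ?e)) / h n) * \<phi> x = (F x * \<phi> x - F (x - h n *\<^sub>R ?e) * \<phi> x) / h n" for x
      by (simp_all add: right_diff_distrib left_diff_distrib diff_divide_distrib)
    then show ?thesis using * by (simp only: Bochner_Integration.integral_divide_zero)
  qed
  have lim1: "(\<lambda>n. LINT x|lborel. F x * ((\<phi> (x + h n *\<^sub>R ?e) - \<phi> x) / h n)) \<longlonglongrightarrow> (LINT x|lborel. F x * partial_deriv j \<phi> x)"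
  proof (rule integral_dominated_convergence[where w = "\<lambda>x. M * D * indicator U x"])
    show "integrable lborel (\<lambda>x. M * D * indicator U x)"
      by (rule integrable_bounded_support[OF _ U(2), where C = "M * D"]) (use M0 D Uset in \<open>auto simp: indicator_def\<close>)
    have "(\<lambda>n. (\<phi> (x + h n *\<^sub>R ?e) - \<phi> x) / h n) \<longlonglongrightarrow> partial_deriv j \<phi> x" for x
    proof -
      have "((\<lambda>t. \<phi> (x + t *\<^sub>R ?e)) has_real_derivative partial_deriv j \<phi> (x + 0 *\<^sub>R ?e)) (at 0)"
        by (rule partial_deriv_along_line[OF test_function_differentiable[OF \<phi>]])
      then have "((\<lambda>t. (\<phi> (x + t *\<^sub>R ?e) - \<phi> x) / t) \<longlongrightarrow> partial_deriv j \<phi> x) (at 0)"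
        by (simp add: DERIV_def)
      then show ?thesis using hl' by (rule filterlim_compose)
    qed
    then show "AE x in lborel. (\<lambda>n. F x * ((\<phi> (x + h n *\<^sub>R ?e) - \<phi> x) / h n)) \<longlonglongrightarrow> F x * partial_deriv j \<phi> x"
      by (intro AE_I2 tendsto_mult tendsto_const)
    fix n
    have qb: "\<bar>(\<phi> (x + h n *\<^sub>R ?e) - \<phi> x) / h n\<bar> \<le> D" for x
    proof -
      obtain t where "\<phi> (x + h n *\<^sub>R ?e) - \<phi> x = h n * partial_deriv j \<phi> (x + t *\<^sub>R ?e)"
        using partial_deriv_mean_value[OF test_function_differentiable[OF \<phi>] h(1)[of n]] by metis
      then show ?thesis using D(1)[of "x + t *\<^sub>R ?e"] h(1)[of n] by simp
    qed
    show "AE x in lborel. norm (F x * ((\<phi> (x + h n *\<^sub>R ?e) - \<phi> x) / h n)) \<le> M * D * indicator U x"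
    proof (intro AE_I2)
      fix x
      show "norm (F x * ((\<phi> (x + h n *\<^sub>R ?e) - \<phi> x) / h n)) \<le> M * D * indicator U x"
      proof (cases "x \<in> U")
        case True
        have "\<bar>F x * ((\<phi> (x + h n *\<^sub>R ?e) - \<phi> x) / h n)\<bar> \<le> M * D"
          unfolding abs_mult[of "F x"] by (rule mult_mono[OF FM qb M0]) auto
        then show ?thesis using True by (simp only: real_norm_def indicator_simps mult_1_right)
      qed (simp add: F_def)
    qed
  qed measurable
  have null: "negligible (\<Union>T\<in>\<S>. frontier T)"
    using fin cv negligible_convex_frontier by (intro negligible_Union) auto
  have gm: "(\<lambda>x. indicator U x * g x) \<in> borel_measurable lebesgue"
    using g(1) Uset by (simp add: borel_measurable_restrict_space_iff mult.commute)
  have lim2: "(\<lambda>n. LINT x|lebesgue. ((F x - F (x - h n *\<^sub>R ?e)) / h n) * \<phi> x) \<longlonglongrightarrow> (LINT x|lebesgue. (indicator U x * g x) * \<phi> x)"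
  proof (rule integral_dominated_convergence[where w = "\<lambda>x. L * P * indicator ?K x"])
    show "(\<lambda>x. (indicator U x * g x) * \<phi> x) \<in> borel_measurable lebesgue"
      using borel_measurable_times[OF gm, of \<phi>] measurable_completion[of \<phi> lborel borel] \<phi>m by simp
    show "(\<lambda>x. ((F x - F (x - h n *\<^sub>R ?e)) / h n) * \<phi> x) \<in> borel_measurable lebesgue" for n
      by (rule measurable_completion) measurable
    have "integrable lborel (\<lambda>x. L * P * indicator ?K x)"
      by (rule integrable_bounded_support[OF borel_measurable_times[OF borel_measurable_const borel_measurable_indicator] Kb, where C = "L * P"]) (use L P in \<open>simp_all add: borel_measurable_indicator indicator_def\<close>)
    then show "integrable lebesgue (\<lambda>x. L * P * indicator ?K x)" by (subst integrable_completion) auto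
    have ae: "AE x in lebesgue. x \<notin> (\<Union>T\<in>\<S>. frontier T)"
      using null by (intro AE_not_in) (simp add: negligible_iff_null_sets)
    show "AE x in lebesgue. (\<lambda>n. ((F x - F (x - h n *\<^sub>R ?e)) / h n) * \<phi> x) \<longlonglongrightarrow> (indicator U x * g x) * \<phi> x"
      using ae
    proof eventually_elim
      case (elim x)
      show ?case
      proof (cases "x \<in> ?K")
        case False then show ?thesis using \<phi>K[OF False] by simp
      next
        case True
        then have xU: "x \<in> U" using K by blast
        then obtain T where T: "T \<in> \<S>" "x \<in> T" using cover by blast
        then have xi: "x \<in> interior T \<inter> U" using elim xU cl[OF T(1)] by (auto simp: frontier_def)
        have "open (interior T \<inter> U)" using U by auto
        then obtain r where r: "r > 0" "ball x r \<subseteq> interior T \<inter> U" using xi openE by blast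
        \<comment> \<open>Once \<open>h n\<close> is below \<open>r\<close>, both points lie in the
          same cell and the quotient equals the slope exactly. The sequence is therefore eventually
          constant.\<close>
        have "\<forall>\<^sub>F n in sequentially. h n < r"
          using hl r(1) by (auto simp: order_tendsto_iff)
        then have "\<forall>\<^sub>F n in sequentially. (F x - F (x - h n *\<^sub>R ?e)) / h n = a T $ j"
        proof eventually_elim
          case (elim n)
          have "x - h n *\<^sub>R ?e \<in> ball x r" using elim h(1)[of n] by (simp add: dist_norm)
          then have "x - h n *\<^sub>R ?e \<in> T \<inter> U" using r interior_subset by blast
          then have "F x - F (x - h n *\<^sub>R ?e) = a T \<bullet> (h n *\<^sub>R ?e)"
            using aff[OF T(1)] xU T by (auto simp: F_def inner_diff_right)
          then show ?case using h(1)[of n] by (simp add: inner_axis)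
        qed
        then have "(\<lambda>n. (F x - F (x - h n *\<^sub>R ?e)) / h n) \<longlonglongrightarrow> a T $ j" by (rule tendsto_eventually)
        moreover have "indicator U x * g x = a T $ j" using g(2)[OF T(1) xi] xU by simp
        ultimately show ?thesis by (simp only:) (intro tendsto_mult tendsto_const)
      qed
    qed
    fix n
    show "AE x in lebesgue. norm (((F x - F (x - h n *\<^sub>R ?e)) / h n) * \<phi> x) \<le> L * P * indicator ?K x"
    proof (intro AE_I2)
      fix x
      show "norm (((F x - F (x - h n *\<^sub>R ?e)) / h n) * \<phi> x) \<le> L * P * indicator ?K x"
      proof (cases "x \<in> ?K")
        case False then show ?thesis using \<phi>K[OF False] by simp
      next
        case True
        let ?y = "x - h n *\<^sub>R ?e"
        have "?y \<in> ball x \<delta>" using h[of n] by (simp add: dist_norm)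
        then have "closed_segment ?y x \<subseteq> ball x \<delta>" using \<delta>(1) by (intro closed_segment_subset) auto
        then have seg: "closed_segment ?y x \<subseteq> U" using \<delta>(2)[OF True] by auto
        have "\<bar>f x - f ?y\<bar> \<le> L * norm (x - ?y)"
          by (rule segment_lipschitz[OF fin cl aff seg cover L(1)])
        moreover have "x \<in> U" "?y \<in> U" using seg ends_in_segment[of ?y x] by blast+
        ultimately have "\<bar>F x - F ?y\<bar> \<le> L * h n"
          using h(1)[of n] by (simp add: F_def)
        then have "\<bar>(F x - F ?y) / h n\<bar> \<le> L" using h(1)[of n] by (simp add: field_simps)
        then have "\<bar>((F x - F ?y) / h n) * \<phi> x\<bar> \<le> L * P"
          unfolding abs_mult[of _ "\<phi> x"] by (rule mult_mono[OF _ P(1) L(3)]) auto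
        then show ?thesis using True by (simp only: real_norm_def indicator_simps mult_1_right)
      qed
    qed
  qed
  \<comment> \<open>The limit had to be taken over \<open>lebesgue\<close>, because \<open>g\<close>
    is only Lebesgue measurable. The quotients are Borel, so their integrals are the same over both
    measures.\<close>
  have eq: "(LINT x|lebesgue. ((F x - F (x - h n *\<^sub>R ?e)) / h n) * \<phi> x) = (LINT x|lborel. ((F x - F (x - h n *\<^sub>R ?e)) / h n) * \<phi> x)" for n
    by (rule integral_completion) measurable
  have "(\<lambda>n. - (LINT x|lborel. ((F x - F (x - h n *\<^sub>R ?e)) / h n) * \<phi> x)) \<longlonglongrightarrow> - (LINT x|lebesgue. (indicator U x * g x) * \<phi> x)"
    using tendsto_minus[OF lim2] unfolding eq .
  then have "(LINT x|lborel. F x * partial_deriv j \<phi> x) = - (LINT x|lebesgue. (indicator U x * g x) * \<phi> x)"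
    using lim1 LIMSEQ_unique unfolding quot by blast
  moreover have "(LINT x|lborel. F x * partial_deriv j \<phi> x) = (LINT x|lebesgue. F x * partial_deriv j \<phi> x)"
    by (rule integral_completion[symmetric]) measurable
  ultimately show ?thesis
    unfolding lebesgue_on_integral_indicator[OF Uset(2)] F_def by (simp add: mult.assoc)
qed

subsection \<open>Weak gradients\<close>

text \<open>Increments along the coordinate axes inside a small ball recover the columns of the
  matrix. This is how all local affine data are compared later.\<close>

lemma affine_map_unique:
  fixes A A' :: "real^3^3"
  assumes "open V" "V \<noteq> {}" and eq: "\<And>x. x \<in> V \<Longrightarrow> A *v x + b = A' *v x + b'"
  shows "A = A'" "b = b'"
proof -
  obtain x0 where "x0 \<in> V" using assms(2) by blast
  then obtain r where r: "r > 0" "ball x0 r \<subseteq> V" by (rule openE[OF assms(1)])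
  have "column j A = column j A'" for j
  proof -
    let ?y = "x0 + (r / 2) *\<^sub>R axis j 1"
    have "?y \<in> ball x0 r" "x0 \<in> ball x0 r" using r(1) by (simp_all add: dist_norm)
    then have "A *v ?y + b = A' *v ?y + b'" "A *v x0 + b = A' *v x0 + b'" using eq r(2) by (simp_all add: subsetD)
    then have "A *v ?y - A *v x0 = A' *v ?y - A' *v x0" by (metis add_diff_cancel_right)
    then have "A *v ((r / 2) *\<^sub>R axis j 1) = A' *v ((r / 2) *\<^sub>R axis j 1)"
      by (simp only: matrix_vector_mult_diff_distrib[symmetric] add_diff_cancel_left')
    then have "(r / 2) *\<^sub>R (A *v axis j 1) = (r / 2) *\<^sub>R (A' *v axis j 1)"
      by (simp only: matrix_vector_mult_scaleR)
    then show ?thesis using r(1) by (simp add: matrix_vector_mult_basis)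
  qed
  then show A: "A = A'" by (simp add: vec_eq_iff column_def)
  obtain x where "x \<in> V" using assms(2) by blast
  then show "b = b'" using eq[of x] A by simp
qed

text \<open>For \<open>1 \<le> p\<close> the norm is dominated by 1 plus its \<open>p\<close>-th
  power, and constants are integrable over a finite measure.\<close>

lemma Lp_space_integrable:
  fixes f :: "'a \<Rightarrow> 'b::euclidean_space"
  assumes "f \<in> Lp_space p M" "finite_measure M" "1 \<le> p"
  shows "integrable M f"
proof (rule Bochner_Integration.integrable_bound)
  interpret finite_measure M by fact
  show "integrable M (\<lambda>x. 1 + norm (f x) powr p)" using assms(1) by (simp add: Lp_space_def)
  have "norm (f x) \<le> 1 + norm (f x) powr p" for x
  proof (cases "norm (f x) \<le> 1")
    case False
    then have "norm (f x) powr 1 \<le> norm (f x) powr p" using assms(3) by (intro powr_mono) auto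
    then show ?thesis using False by simp
  qed (auto intro: order_trans[of _ 1])
  then show "AE x in M. norm (f x) \<le> norm (1 + norm (f x) powr p)" by auto
qed (use assms(1) in \<open>simp add: Lp_space_def\<close>)

lemma L2_space_iff:
  fixes f :: "'a \<Rightarrow> 'b::euclidean_space"
  shows "f \<in> Lp_space 2 M \<longleftrightarrow> f \<in> borel_measurable M \<and> integrable M (\<lambda>x. (norm (f x))\<^sup>2)"
  by (simp add: Lp_space_def)

lemma L2_space_lincomb:
  fixes f g :: "'a \<Rightarrow> 'b::euclidean_space"
  assumes "f \<in> Lp_space 2 M" "g \<in> Lp_space 2 M"
  shows "(\<lambda>x. f x + c *\<^sub>R g x) \<in> Lp_space 2 M"
proof -
  have fg: "f \<in> borel_measurable M" "g \<in> borel_measurable M"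
    "integrable M (\<lambda>x. (norm (f x))\<^sup>2)" "integrable M (\<lambda>x. (norm (g x))\<^sup>2)"
    using assms by (auto simp: L2_space_iff)
  have m: "(\<lambda>x. f x + c *\<^sub>R g x) \<in> borel_measurable M"
    by (intro borel_measurable_add borel_measurable_scaleR fg borel_measurable_const)
  have "integrable M (\<lambda>x. (norm (f x + c *\<^sub>R g x))\<^sup>2)"
  proof (rule Bochner_Integration.integrable_bound)
    show "integrable M (\<lambda>x. 2 * (norm (f x))\<^sup>2 + 2 * c\<^sup>2 * (norm (g x))\<^sup>2)" using fg by simp
    show "(\<lambda>x. (norm (f x + c *\<^sub>R g x))\<^sup>2) \<in> borel_measurable M"
      by (intro borel_measurable_power measurable_compose[OF m borel_measurable_norm])
    have "(norm (f x + c *\<^sub>R g x))\<^sup>2 \<le> 2 * (norm (f x))\<^sup>2 + 2 * c\<^sup>2 * (norm (g x))\<^sup>2" for x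
    proof -
      have "(norm (f x + c *\<^sub>R g x))\<^sup>2 \<le> (norm (f x) + norm (c *\<^sub>R g x))\<^sup>2"
        by (intro power_mono norm_triangle_ineq) auto
      also have "\<dots> \<le> 2 * (norm (f x))\<^sup>2 + 2 * (norm (c *\<^sub>R g x))\<^sup>2"
        using sum_squares_bound[of "norm (f x)" "norm (c *\<^sub>R g x)"] by (simp add: power2_sum)
      finally show ?thesis by (simp add: power_mult_distrib)
    qed
    then show "AE x in M. norm ((norm (f x + c *\<^sub>R g x))\<^sup>2) \<le> norm (2 * (norm (f x))\<^sup>2 + 2 * c\<^sup>2 * (norm (g x))\<^sup>2)"
      by (intro AE_I2) (simp add: abs_of_nonneg)
  qed
  then show ?thesis using m by (simp add: L2_space_iff)
qed

lemma L2_space_bounded: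
  fixes f :: "'a \<Rightarrow> 'b::euclidean_space"
  assumes "finite_measure M" "f \<in> borel_measurable M" "AE x in M. norm (f x) \<le> C"
  shows "f \<in> Lp_space 2 M"
proof -
  interpret finite_measure M by fact
  have "integrable M (\<lambda>x. (norm (f x))\<^sup>2)"
  proof (rule integrable_const_bound[of _ "C\<^sup>2"])
    show "AE x in M. norm ((norm (f x))\<^sup>2) \<le> C\<^sup>2"
      using assms(3) by eventually_elim (simp add: power_mono)
    show "(\<lambda>x. (norm (f x))\<^sup>2) \<in> borel_measurable M"
      by (intro borel_measurable_power measurable_compose[OF assms(2) borel_measurable_norm])
  qed
  then show ?thesis using assms(2) by (simp add: L2_space_iff)
qed

lemma finite_measure_lebesgue_on_bounded:
  fixes S :: "'a::euclidean_space set"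
  shows "open S \<Longrightarrow> bounded S \<Longrightarrow> finite_measure (lebesgue_on S)"
  by (intro finite_measure_lebesgue_on lmeasurable_open)

text \<open>Turns an almost everywhere identity between constants, such as two cell matrices, into a
  genuine identity: a nonempty open set is not null.\<close>

lemma AE_lebesgue_on_open_nonempty:
  assumes "AE x in lebesgue_on V. P" "open V" "V \<noteq> {}" shows P
proof (rule ccontr)
  assume "\<not> P"
  moreover have V: "V \<in> sets lebesgue" using assms(2) by auto
  ultimately have "AE x in lebesgue. x \<notin> V" using assms(1) AE_restrict_space_iff[of V lebesgue "\<lambda>_. P"] by simp
  then have "V \<in> null_sets lebesgue" using V AE_iff_null_sets[of V lebesgue] by simp
  then have "negligible V" by (simp add: negligible_iff_null_sets)
  then show False using open_not_negligible assms by blast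
qed

lemma AE_lebesgue_on_subset:
  assumes "AE x in lebesgue_on S. P x" "T \<subseteq> S" "S \<in> sets lebesgue" "T \<in> sets lebesgue"
  shows "AE x in lebesgue_on T. P x"
proof -
  have "AE x in lebesgue. x \<in> S \<longrightarrow> P x" using assms AE_restrict_space_iff[of S lebesgue P] by simp
  then have "AE x in lebesgue. x \<in> T \<longrightarrow> P x" by eventually_elim (use assms(2) in auto)
  then show ?thesis using assms AE_restrict_space_iff[of T lebesgue P] by simp
qed

text \<open>Integration by parts against the constant 1, with the whole space as the only
  cell.\<close>

lemma integral_partial_deriv_eq_0:
  assumes "open S" "bounded S" "\<phi> \<in> test_functions S"
  shows "(LINT x|lebesgue_on S. partial_deriv j \<phi> x) = 0"
  using piecewise_affine_integration_by_parts[OF assms(1,2), of "{UNIV}" "\<lambda>_. 1" "\<lambda>_. 0" "\<lambda>_. 1" "\<lambda>_. 0" j \<phi>] assms(3)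
  by simp

text \<open>Du Bois-Reymond by separation of variables: modulo derivatives of test functions every factor of a
  tensor product is a multiple of a fixed bump, so \<open>u\<close> acts on tensor products like a constant.\<close>

lemma zero_gradient_box:
  fixes u :: "real^3 \<Rightarrow> real"
  assumes S: "open S" "bounded S" and u: "integrable (lebesgue_on S) u"
    and ab: "cbox a b \<subseteq> S" "\<And>i. a $ i < b $ i"
    and grad: "\<And>\<phi> j. \<phi> \<in> test_functions S \<Longrightarrow> (LINT x|lebesgue_on S. u x * partial_deriv j \<phi> x) = 0"
  shows "\<exists>c. AE x in lebesgue_on (box a b). u x = c"
proof -
  interpret finite_measure "lebesgue_on S" by (rule finite_measure_lebesgue_on_bounded[OF S])
  have Sm: "S \<in> sets lebesgue" using S(1) by auto
  define L where "L = (\<lambda>w h. LINT x|lebesgue_on S. w x * tensor h x)"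
  define \<eta> where "\<eta> = (\<lambda>i. interval_bump 1 (a $ i) (b $ i))"
  define I where "I = (\<lambda>i h. integral {a $ i..b $ i} h :: real)"
  have \<eta>: "\<eta> i \<in> smooth_on_interval (a $ i) (b $ i)" for i unfolding \<eta>_def by (rule interval_bump_smooth)
  \<comment> \<open>A continuous nonnegative function with vanishing integral is zero, but the bump
    is positive at the midpoint of its interval.\<close>
  have Ipos: "I i (\<eta> i) > 0" for i
  proof -
    let ?c = "(a $ i + b $ i) / 2"
    have "I i (\<eta> i) \<noteq> 0"
    proof
      assume "I i (\<eta> i) = 0"
      then have "(\<eta> i has_integral 0) (cbox (a $ i) (b $ i))"
        unfolding I_def using integrable_continuous_real[OF smooth_on_interval_continuous[OF \<eta>[of i]], of "a $ i" "b $ i"]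
        by (metis box_real(2) integrable_integral)
      then have "\<eta> i ?c = 0"
        by (rule has_integral_0_cbox_imp_0[rotated 2])
           (use ab(2)[of i] smooth_on_interval_continuous[OF \<eta>[of i]] in \<open>auto simp: \<eta>_def interval_bump_nonneg\<close>)
      moreover have "0 < \<eta> i ?c" unfolding \<eta>_def by (rule interval_bump_pos) (use ab(2)[of i] in auto)
      ultimately show False by simp
    qed
    moreover have "I i (\<eta> i) \<ge> 0"
      unfolding I_def \<eta>_def using interval_bump_nonneg
      by (intro integral_nonneg integrable_continuous_real smooth_on_interval_continuous[OF interval_bump_smooth]) auto
    ultimately show ?thesis by simp
  qed
  have step: "L w h = I j (h j) / I j (\<eta> j) * L w (h(j := \<eta> j))"
    if w: "integrable (lebesgue_on S) w"
      "\<And>\<phi> j. \<phi> \<in> test_functions S \<Longrightarrow> (LINT x|lebesgue_on S. w x * partial_deriv j \<phi> x) = 0"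
      and h: "h \<in> box_functions a b" for w h j
  proof -
    have hj: "h j \<in> smooth_on_interval (a $ j) (b $ j)" using h by (simp add: box_functions_def)
    \<comment> \<open>This multiple gives \<open>g\<close> mean zero. Then \<open>g\<close> is the
      derivative of some \<open>H\<close> supported in the same interval, and replacing factor
      \<open>j\<close> by \<open>g\<close> produces a partial derivative of a test function, on
      which \<open>w\<close> integrates to zero.\<close>
    define q where "q = I j (h j) / I j (\<eta> j)"
    define g where "g = (\<lambda>t. h j t + (- q) * \<eta> j t)"
    have gs: "g \<in> smooth_on_interval (a $ j) (b $ j)"
      unfolding g_def by (rule smooth_on_interval_add_scale[OF hj \<eta>])
    have int: "h j integrable_on {a $ j..b $ j}" "\<eta> j integrable_on {a $ j..b $ j}"
      by (auto intro!: integrable_continuous_real smooth_on_interval_continuous[OF hj] smooth_on_interval_continuous[OF \<eta>])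
    have "integral {a $ j..b $ j} g = I j (h j) + (- q) * I j (\<eta> j)"
      unfolding g_def I_def
      by (rule integral_unique[OF has_integral_add[OF integrable_integral[OF int(1)]
          has_integral_mult_right[OF integrable_integral[OF int(2)], of "- q"]]])
    then have "integral {a $ j..b $ j} g = 0" using Ipos[of j] by (simp add: q_def)
    then obtain H where H: "H \<in> smooth_on_interval (a $ j) (b $ j)" "deriv H = g"
      using smooth_on_interval_primitive[OF gs ab(2)] by metis
    have hH: "h(j := H) \<in> box_functions a b" using h H by (simp add: box_functions_def)
    have h\<eta>: "h(j := \<eta> j) \<in> box_functions a b" using h \<eta> by (simp add: box_functions_def)
    have "0 = (LINT x|lebesgue_on S. w x * partial_deriv j (tensor (h(j := H))) x)"
      by (rule w(2)[OF tensor_test_function[OF hH ab(1)], symmetric])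
    also have "partial_deriv j (tensor (h(j := H))) = tensor (h(j := g))"
      using partial_deriv_tensor_box(1)[OF hH, of j] H(2) by simp
    also have "(LINT x|lebesgue_on S. w x * tensor (h(j := g)) x)
        = (LINT x|lebesgue_on S. w x * tensor h x - q * (w x * tensor (h(j := \<eta> j)) x))"
    proof (intro Bochner_Integration.integral_cong refl)
      fix x
      have "tensor h x = tensor (h(j := h j)) x" by simp
      also have "\<dots> = h j (x $ j) * (\<Prod>i\<in>UNIV - {j}. h i (x $ i))" by (rule tensor_update)
      finally show "w x * tensor (h(j := g)) x = w x * tensor h x - q * (w x * tensor (h(j := \<eta> j)) x)"
        unfolding tensor_update g_def by (simp add: algebra_simps)
    qed
    also have "\<dots> = L w h - q * L w (h(j := \<eta> j))"
      unfolding L_def using integrable_mult_test[OF w(1) tensor_test_function[OF h ab(1)]]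
        integrable_mult_test[OF w(1) tensor_test_function[OF h\<eta> ab(1)]] by simp
    finally show ?thesis by (simp add: q_def)
  qed
  define q where "q = (\<lambda>h :: 3 \<Rightarrow> real \<Rightarrow> real. I 1 (h 1) / I 1 (\<eta> 1) * (I 2 (h 2) / I 2 (\<eta> 2)) * (I 3 (h 3) / I 3 (\<eta> 3)))"
  have prod: "L w h = q h * L w \<eta>"
    if w: "integrable (lebesgue_on S) w"
      "\<And>\<phi> j. \<phi> \<in> test_functions S \<Longrightarrow> (LINT x|lebesgue_on S. w x * partial_deriv j \<phi> x) = 0"
      and h: "h \<in> box_functions a b" for w h
  proof -
    have h1: "h(1 := \<eta> 1) \<in> box_functions a b" using h \<eta> by (simp add: box_functions_def)
    have h2: "h(1 := \<eta> 1, 2 := \<eta> 2) \<in> box_functions a b" using h1 \<eta> by (simp add: box_functions_def)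
    have "h(1 := \<eta> 1, 2 := \<eta> 2, 3 := \<eta> 3) = \<eta>"
    proof
      fix i :: 3 show "(h(1 := \<eta> 1, 2 := \<eta> 2, 3 := \<eta> 3)) i = \<eta> i" using exhaust_3[of i] by auto
    qed
    moreover have ne: "(2::3) \<noteq> 1" "(3::3) \<noteq> 1" "(3::3) \<noteq> 2" by auto
    ultimately show ?thesis
      using step[OF w h, of 1] step[OF w h1, of 2] step[OF w h2, of 3] by (simp add: q_def)
  qed
  \<comment> \<open>The constant 1 obeys the same product formula with the same scalar
    \<open>q h\<close>. The functionals of \<open>u\<close> and of 1 are therefore proportional,
    with ratio \<open>c\<close> defined below.\<close>
  have one: "L (\<lambda>_. 1) h = q h * L (\<lambda>_. 1) \<eta>" if "h \<in> box_functions a b" for h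
    by (rule prod[OF _ _ that]) (use integral_partial_deriv_eq_0[OF S] in auto)
  have ne: "L (\<lambda>_. 1) \<eta> \<noteq> 0"
  proof
    assume "L (\<lambda>_. 1) \<eta> = 0"
    then have "(LINT x|lebesgue_on S. 1 * tensor h x) = 0" if "h \<in> box_functions a b" for h
      using one[OF that] by (simp add: L_def)
    then have "AE x in lebesgue_on (box a b). (1::real) = 0"
      by (intro fundamental_lemma_box[OF _ Sm ab(1)]) auto
    then have "(1::real) = 0"
      by (rule AE_lebesgue_on_open_nonempty) (use ab(2) in \<open>auto simp: interval_ne_empty_cart\<close>)
    then show False by simp
  qed
  define c where "c = L u \<eta> / L (\<lambda>_. 1) \<eta>"
  have "AE x in lebesgue_on (box a b). u x - c = 0"
  proof (rule fundamental_lemma_box[OF _ Sm ab(1)])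
    show "integrable (lebesgue_on S) (\<lambda>x. u x - c)" using u by simp
    fix h assume h: "h \<in> box_functions a b"
    have i: "integrable (lebesgue_on S) (\<lambda>x. 1 * tensor h x)"
      by (rule integrable_mult_test[OF _ tensor_test_function[OF h ab(1)]]) simp
    have "(LINT x|lebesgue_on S. (u x - c) * tensor h x) = (LINT x|lebesgue_on S. u x * tensor h x - c * (1 * tensor h x))"
      by (simp add: algebra_simps)
    also have "\<dots> = L u h - c * L (\<lambda>_. 1) h"
      unfolding L_def using integrable_mult_test[OF u tensor_test_function[OF h ab(1)]] i by simp
    also have "\<dots> = 0" using prod[OF u grad h] one[OF h] ne by (simp add: c_def)
    finally show "(LINT x|lebesgue_on S. (u x - c) * tensor h x) = 0" .
  qed
  then have "AE x in lebesgue_on (box a b). u x = c" by eventually_elim simp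
  then show ?thesis by blast
qed

text \<open>Each point has a box on which \<open>u\<close> is almost everywhere constant. On the
  open overlap of two neighbourhoods the constants agree, so they form a locally constant function
  on the connected set \<open>S\<close>.\<close>

theorem zero_gradient_imp_constant:
  fixes u :: "real^3 \<Rightarrow> real"
  assumes S: "open S" "bounded S" "connected S" and u: "integrable (lebesgue_on S) u"
    and grad: "\<And>\<phi> j. \<phi> \<in> test_functions S \<Longrightarrow> (LINT x|lebesgue_on S. u x * partial_deriv j \<phi> x) = 0"
  obtains c where "AE x in lebesgue_on S. u x = c"
proof -
  have loc: "\<exists>V c. open V \<and> x \<in> V \<and> (AE y in lebesgue_on V. u y = c)" if x: "x \<in> S" for x
  proof -
    obtain a b where ab: "x \<in> box a b" "cbox a b \<subseteq> S" by (rule open_contains_box_nbhd[OF S(1) x])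
    have "a $ i < b $ i" for i using ab(1) by (auto simp: mem_box_cart intro: less_trans)
    then obtain c where "AE y in lebesgue_on (box a b). u y = c"
      using zero_gradient_box[OF S(1,2) u ab(2) _ grad] by blast
    then show ?thesis using ab(1) by blast
  qed
  define P where "P = (\<lambda>x (V, c). open V \<and> x \<in> V \<and> (AE y in lebesgue_on V. u y = c))"
  define f where "f = (\<lambda>x. SOME p. P x p)"
  define V where "V = (\<lambda>x. fst (f x))"
  define c where "c = (\<lambda>x. snd (f x))"
  have "P x (f x)" if x: "x \<in> S" for x
  proof -
    have "\<exists>p. P x p" using loc[OF x] by (auto simp: P_def)
    then show ?thesis unfolding f_def by (rule someI_ex)
  qed
  then have V: "open (V x)" "x \<in> V x" "AE y in lebesgue_on (V x). u y = c x" if "x \<in> S" for x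
    using that unfolding P_def V_def c_def case_prod_beta by blast+
  have eq: "c x = c y" if xy: "x \<in> S" "y \<in> S" "y \<in> V x" for x y
  proof -
    let ?W = "V x \<inter> V y"
    have W: "open ?W" "?W \<noteq> {}" using V(1,2)[OF xy(1)] V(1,2)[OF xy(2)] xy(3) by auto
    have "AE z in lebesgue_on ?W. u z = c x" "AE z in lebesgue_on ?W. u z = c y"
      by (rule AE_lebesgue_on_subset[OF V(3)[OF xy(1)]] AE_lebesgue_on_subset[OF V(3)[OF xy(2)]];
          use W V(1)[OF xy(1)] V(1)[OF xy(2)] in auto)+
    then have "AE z in lebesgue_on ?W. c x = c y" by eventually_elim simp
    then show ?thesis by (rule AE_lebesgue_on_open_nonempty[OF _ W])
  qed
  show ?thesis
  proof (cases "S = {}")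
    case True
    then have "AE x in lebesgue_on S. u x = 0" by (simp add: AE_restrict_space_iff)
    then show ?thesis by (rule that)
  next
    case False
    then obtain x0 where x0: "x0 \<in> S" by blast
    have const: "c x = c x0" if x: "x \<in> S" for x
    proof (rule connected_local_const[OF S(3) x x0], intro ballI)
      fix y assume y: "y \<in> S"
      show "\<forall>\<^sub>F z in at y within S. c y = c z"
        unfolding eventually_at_topological using V[OF y] eq[OF y] by blast
    qed
    have "AE x in lebesgue_on S. u x = c x0"
    proof (rule AE_lebesgue_on_locally[OF S(1)])
      fix x assume "x \<in> S"
      then show "\<exists>V. open V \<and> x \<in> V \<and> (AE y in lebesgue_on V. u y = c x0)"
        using V[of x] const[of x] by auto
    qed
    then show ?thesis by (rule that)
  qed
qed

lemma L2_component_integrable: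
  fixes G :: "'a \<Rightarrow> real^3^3"
  assumes "G \<in> Lp_space 2 M" "finite_measure M" shows "integrable M (\<lambda>x. G x $ i $ j)"
  using Lp_space_integrable[OF assms] bounded_linear_compose[OF bounded_linear_vec_nth bounded_linear_vec_nth]
  by (intro integrable_bounded_linear[of "\<lambda>y. y $ i $ j"]) auto

lemma L2_component_integrable1:
  fixes v :: "'a \<Rightarrow> real^3"
  assumes "v \<in> Lp_space 2 M" "finite_measure M" shows "integrable M (\<lambda>x. v x $ i)"
  using Lp_space_integrable[OF assms] by (intro integrable_bounded_linear[of "\<lambda>y. y $ i"] bounded_linear_vec_nth) auto

text \<open>Boundedness makes Lebesgue measure on \<open>S\<close> finite. Square integrable
  functions are then integrable and can be tested by the lemmas above.\<close>

locale bounded_open =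
  fixes S :: "(real^3) set" assumes open_S: "open S" and bounded_S: "bounded S"
begin

lemma finite_meas: "finite_measure (lebesgue_on S)"
  by (rule finite_measure_lebesgue_on_bounded[OF open_S bounded_S])

lemma sets_S: "S \<in> sets lebesgue" using open_S by auto

lemmas integrable2 = L2_component_integrable[OF _ finite_meas]
lemmas integrable1 = L2_component_integrable1[OF _ finite_meas]

lemma is_weak_gradD:
  "is_weak_grad S v G \<Longrightarrow> \<phi> \<in> test_functions S \<Longrightarrow>
    (LINT x|lebesgue_on S. v x $ i * partial_deriv j \<phi> x) = - (LINT x|lebesgue_on S. G x $ i $ j * \<phi> x)"
  by (simp add: is_weak_grad_def)

lemma is_weak_grad_lincomb:
  assumes v: "v \<in> Lp_space 2 (lebesgue_on S)" "G \<in> Lp_space 2 (lebesgue_on S)" "is_weak_grad S v G"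
    and w: "w \<in> Lp_space 2 (lebesgue_on S)" "H \<in> Lp_space 2 (lebesgue_on S)" "is_weak_grad S w H"
  shows "is_weak_grad S (\<lambda>x. v x + c *\<^sub>R w x) (\<lambda>x. G x + c *\<^sub>R H x)"
  unfolding is_weak_grad_def
proof (intro ballI allI)
  fix \<phi> i j assume \<phi>: "\<phi> \<in> test_functions S"
  note d\<phi> = test_function_partial_deriv[OF \<phi>, of j]
  have "(LINT x|lebesgue_on S. (v x + c *\<^sub>R w x) $ i * partial_deriv j \<phi> x)
      = (LINT x|lebesgue_on S. v x $ i * partial_deriv j \<phi> x + c * (w x $ i * partial_deriv j \<phi> x))"
    by (simp add: algebra_simps)
  also have "\<dots> = (LINT x|lebesgue_on S. v x $ i * partial_deriv j \<phi> x) + c * (LINT x|lebesgue_on S. w x $ i * partial_deriv j \<phi> x)"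
    using integrable_mult_test[OF integrable1[OF v(1)] d\<phi>, of i] integrable_mult_test[OF integrable1[OF w(1)] d\<phi>, of i]
    by simp
  also have "\<dots> = - ((LINT x|lebesgue_on S. G x $ i $ j * \<phi> x) + c * (LINT x|lebesgue_on S. H x $ i $ j * \<phi> x))"
    using is_weak_gradD[OF v(3) \<phi>] is_weak_gradD[OF w(3) \<phi>] by simp
  also have "\<dots> = - (LINT x|lebesgue_on S. G x $ i $ j * \<phi> x + c * (H x $ i $ j * \<phi> x))"
    using integrable_mult_test[OF integrable2[OF v(2)] \<phi>, of i j] integrable_mult_test[OF integrable2[OF w(2)] \<phi>, of i j]
    by simp
  also have "\<dots> = - (LINT x|lebesgue_on S. (G x + c *\<^sub>R H x) $ i $ j * \<phi> x)"
    by (simp add: algebra_simps)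
  finally show "(LINT x|lebesgue_on S. (v x + c *\<^sub>R w x) $ i * partial_deriv j \<phi> x) = \<dots>" .
qed

text \<open>Testing the difference entry by entry. This is what makes \<open>weak_grad\<close>, an
  arbitrary choice, computable up to null sets.\<close>

lemma weak_grad_unique:
  assumes "G \<in> Lp_space 2 (lebesgue_on S)" "is_weak_grad S v G"
    "H \<in> Lp_space 2 (lebesgue_on S)" "is_weak_grad S v H"
  shows "AE x in lebesgue_on S. G x = H x"
proof -
  have "AE x in lebesgue_on S. G x $ i $ j - H x $ i $ j = 0" for i j
  proof (rule fundamental_lemma[OF _ open_S])
    show "integrable (lebesgue_on S) (\<lambda>x. G x $ i $ j - H x $ i $ j)"
      using integrable2[OF assms(1), of i j] integrable2[OF assms(3), of i j] by simp
    fix \<phi> assume \<phi>: "\<phi> \<in> test_functions S"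
    have "(LINT x|lebesgue_on S. (G x $ i $ j - H x $ i $ j) * \<phi> x)
      = (LINT x|lebesgue_on S. G x $ i $ j * \<phi> x) - (LINT x|lebesgue_on S. H x $ i $ j * \<phi> x)"
      using integrable_mult_test[OF integrable2[OF assms(1)] \<phi>, of i j] integrable_mult_test[OF integrable2[OF assms(3)] \<phi>, of i j]
      by (simp add: left_diff_distrib)
    then show "(LINT x|lebesgue_on S. (G x $ i $ j - H x $ i $ j) * \<phi> x) = 0"
      using is_weak_gradD[OF assms(2) \<phi>, of i j] is_weak_gradD[OF assms(4) \<phi>, of i j] by simp
  qed
  then have "AE x in lebesgue_on S. \<forall>i\<in>UNIV. \<forall>j\<in>UNIV. G x $ i $ j - H x $ i $ j = 0"
    by (intro AE_finite_allI) auto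
  then show ?thesis by eventually_elim (simp add: vec_eq_iff)
qed

lemma weak_grad:
  assumes "v \<in> H1 S"
  shows "weak_grad S v \<in> Lp_space 2 (lebesgue_on S)" "is_weak_grad S v (weak_grad S v)"
proof -
  have "\<exists>G. G \<in> Lp_space 2 (lebesgue_on S) \<and> is_weak_grad S v G" using assms by (auto simp: H1_def)
  then have "weak_grad S v \<in> Lp_space 2 (lebesgue_on S) \<and> is_weak_grad S v (weak_grad S v)"
    unfolding weak_grad_def by (rule someI_ex)
  then show "weak_grad S v \<in> Lp_space 2 (lebesgue_on S)" "is_weak_grad S v (weak_grad S v)" by auto
qed

lemma H1_L2: "v \<in> H1 S \<Longrightarrow> v \<in> Lp_space 2 (lebesgue_on S)"
  by (simp add: H1_def)

lemma weak_grad_eqI: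
  assumes "v \<in> Lp_space 2 (lebesgue_on S)" "G \<in> Lp_space 2 (lebesgue_on S)" "is_weak_grad S v G"
  shows "v \<in> H1 S" "AE x in lebesgue_on S. weak_grad S v x = G x"
proof -
  show v: "v \<in> H1 S" using assms by (auto simp: H1_def)
  show "AE x in lebesgue_on S. weak_grad S v x = G x"
    by (rule weak_grad_unique[OF weak_grad[OF v] assms(2,3)])
qed

lemma H1_lincomb:
  assumes "v \<in> H1 S" "w \<in> H1 S"
  shows "(\<lambda>x. v x + c *\<^sub>R w x) \<in> H1 S"
    "AE x in lebesgue_on S. weak_grad S (\<lambda>x. v x + c *\<^sub>R w x) x = weak_grad S v x + c *\<^sub>R weak_grad S w x"
  using weak_grad_eqI[OF L2_space_lincomb[OF H1_L2[OF assms(1)] H1_L2[OF assms(2)]]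
      L2_space_lincomb[OF weak_grad(1)[OF assms(1)] weak_grad(1)[OF assms(2)]]
      is_weak_grad_lincomb[OF H1_L2[OF assms(1)] weak_grad[OF assms(1)] H1_L2[OF assms(2)] weak_grad[OF assms(2)]]]
  by auto

lemma sym_grad_lincomb:
  assumes "v \<in> H1 S" "w \<in> H1 S"
  shows "AE x in lebesgue_on S. sym_grad S (\<lambda>x. v x + c *\<^sub>R w x) x = sym_grad S v x + c *\<^sub>R sym_grad S w x"
  using H1_lincomb(2)[OF assms, of c]
  by eventually_elim (simp add: sym_grad_def transpose_def vec_eq_iff algebra_simps)

text \<open>The cellwise matrices form the weak gradient, by integration by parts in each component.
  Where interiors of cells overlap, the matrices agree because the affine maps do, so any finite
  closed convex cover will serve.\<close>

lemma piecewise_affine_H1: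
  assumes fin: "finite \<S>" and cl: "\<And>T. T \<in> \<S> \<Longrightarrow> closed T" and cv: "\<And>T. T \<in> \<S> \<Longrightarrow> convex T"
    and cover: "S \<subseteq> \<Union>\<S>"
    and aff: "\<And>T x. T \<in> \<S> \<Longrightarrow> x \<in> T \<inter> S \<Longrightarrow> v x = A T *v x + b T"
  shows "v \<in> H1 S" "AE x in lebesgue_on S. \<forall>T\<in>\<S>. x \<in> T \<longrightarrow> weak_grad S v x = A T"
proof -
  \<comment> \<open>The default 0 is taken in \<open>S\<close> only on cell frontiers, which are
    null by convexity.\<close>
  define G where "G = (\<lambda>x. if \<exists>T\<in>\<S>. x \<in> interior T then A (SOME T. T \<in> \<S> \<and> x \<in> interior T) else 0)"
  have GT: "G x = A T" if T: "T \<in> \<S>" and x: "x \<in> interior T \<inter> S" for T x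
  proof -
    define T' where "T' = (SOME T. T \<in> \<S> \<and> x \<in> interior T)"
    have T': "T' \<in> \<S> \<and> x \<in> interior T'" unfolding T'_def by (rule someI[of _ T]) (use T x in auto)
    have "A T = A T'"
    proof (rule affine_map_unique)
      show "open (interior T \<inter> interior T' \<inter> S)" using open_S by auto
      show "interior T \<inter> interior T' \<inter> S \<noteq> {}" using x T' by auto
      fix y assume "y \<in> interior T \<inter> interior T' \<inter> S"
      then have "y \<in> T \<inter> S" "y \<in> T' \<inter> S" using interior_subset by blast+
      then show "A T *v y + b T = A T' *v y + b T'" using aff[OF T] aff[of T'] T' by metis
    qed
    then show ?thesis using T x unfolding G_def T'_def by auto
  qed
  have v_cont: "continuous_on S v"
  proof (rule continuous_on_piecewise[OF fin cl cover])
    fix T assume T: "T \<in> \<S>"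
    show "continuous_on (T \<inter> S) v"
      by (rule continuous_on_eq[of _ "\<lambda>x. A T *v x + b T"])
         (use aff[OF T] in \<open>auto intro!: continuous_intros matrix_vector_mult_linear_continuous_on\<close>)
  qed
  have vm: "v \<in> borel_measurable (lebesgue_on S)"
    by (rule continuous_imp_measurable_on_sets_lebesgue[OF v_cont sets_S])
  obtain R where R: "\<And>x. x \<in> S \<Longrightarrow> norm x \<le> R" "R > 0" using bounded_S bounded_pos by metis
  have vb: "norm (v x) \<le> (\<Sum>T\<in>\<S>. onorm ((*v) (A T)) * R + norm (b T))" if x: "x \<in> S" for x
  proof -
    obtain T where T: "T \<in> \<S>" "x \<in> T" using cover x by blast
    have "norm (v x) \<le> norm (A T *v x) + norm (b T)" using aff[OF T(1)] T x norm_triangle_ineq by auto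
    also have "\<dots> \<le> onorm ((*v) (A T)) * R + norm (b T)"
      using onorm[OF matrix_vector_mul_bounded_linear, of "A T" x] mult_left_mono[OF R(1)[OF x] onorm_pos_le[OF matrix_vector_mul_bounded_linear[of "A T"]]]
      by simp
    also have "\<dots> \<le> (\<Sum>T\<in>\<S>. onorm ((*v) (A T)) * R + norm (b T))"
      using fin T(1) R(2) by (intro member_le_sum) (auto intro!: add_nonneg_nonneg mult_nonneg_nonneg onorm_pos_le matrix_vector_mul_bounded_linear)
    finally show ?thesis .
  qed
  have vL: "v \<in> Lp_space 2 (lebesgue_on S)"
    by (rule L2_space_bounded[OF finite_meas vm]) (use vb in \<open>auto intro!: AE_I2\<close>)
  have null: "negligible (\<Union>T\<in>\<S>. frontier T)"
    using fin cv negligible_convex_frontier by (intro negligible_Union) auto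
  then have "AE x in lebesgue. x \<notin> (\<Union>T\<in>\<S>. frontier T)"
    by (intro AE_not_in) (simp add: negligible_iff_null_sets)
  then have "AE x in lebesgue. x \<in> S \<longrightarrow> (\<forall>T\<in>\<S>. x \<in> T \<longrightarrow> G x = A T)"
  proof eventually_elim
    case (elim x)
    show ?case
    proof (intro impI ballI)
      fix T assume x: "x \<in> S" "T \<in> \<S>" "x \<in> T"
      then have "x \<in> interior T" using elim cl[OF x(2)] by (auto simp: frontier_def)
      then show "G x = A T" using GT[OF x(2)] x(1) by simp
    qed
  qed
  then have ae: "AE x in lebesgue_on S. \<forall>T\<in>\<S>. x \<in> T \<longrightarrow> G x = A T"
    using AE_restrict_space_iff[of S lebesgue "\<lambda>x. \<forall>T\<in>\<S>. x \<in> T \<longrightarrow> G x = A T"] sets_S by simp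
  \<comment> \<open>A finite Borel cover on each member of which \<open>G\<close> is constant within
    \<open>S\<close>; measurability of \<open>G\<close> is checked piece by piece.\<close>
  define cells where "cells = insert (- (\<Union>T\<in>\<S>. interior T)) (interior ` \<S>)"
  have Gm: "G \<in> borel_measurable (lebesgue_on S)"
  proof (rule measurable_piecewise_restrict[of cells])
    show "countable cells" unfolding cells_def using fin by (intro countable_finite) simp
    show "space (lebesgue_on S) \<subseteq> \<Union>cells" unfolding cells_def by auto
    fix D assume D: "D \<in> cells"
    have "D \<in> sets borel"
    proof -
      have "open (\<Union>T\<in>\<S>. interior T)" by auto
      then have "- (\<Union>T\<in>\<S>. interior T) \<in> sets borel" by (intro borel_closed closed_Compl)
      then show ?thesis using D unfolding cells_def by (elim insertE) auto
    qed
    then show "D \<inter> space (lebesgue_on S) \<in> sets (lebesgue_on S)"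
      using sets_S by (auto simp: sets_restrict_space)
    have "\<exists>C. \<forall>x\<in>D \<inter> S. G x = C"
    proof (cases "D = - (\<Union>T\<in>\<S>. interior T)")
      case True then show ?thesis by (intro exI[of _ 0]) (auto simp: G_def)
    next
      case False
      then obtain T where "T \<in> \<S>" "D = interior T" using D by (auto simp: cells_def)
      then show ?thesis using GT by blast
    qed
    then obtain C where "\<And>x. x \<in> D \<inter> S \<Longrightarrow> G x = C" by blast
    then show "G \<in> borel_measurable (restrict_space (lebesgue_on S) D)"
      by (subst measurable_cong[of _ _ "\<lambda>_. C"]) (auto simp: space_restrict_space)
  qed
  have Gb: "AE x in lebesgue_on S. norm (G x) \<le> (\<Sum>T\<in>\<S>. norm (A T))"
    using ae AE_space
  proof eventually_elim
    case (elim x)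
    then obtain T where T: "T \<in> \<S>" "x \<in> T" using cover by auto
    then show ?case using elim fin by (auto intro!: member_le_sum)
  qed
  have GL: "G \<in> Lp_space 2 (lebesgue_on S)" by (rule L2_space_bounded[OF finite_meas Gm Gb])
  have "is_weak_grad S v G"
    unfolding is_weak_grad_def
  proof (intro ballI allI)
    fix \<phi> i j assume \<phi>: "\<phi> \<in> test_functions S"
    show "(LINT x|lebesgue_on S. v x $ i * partial_deriv j \<phi> x) = - (LINT x|lebesgue_on S. G x $ i $ j * \<phi> x)"
    proof (rule piecewise_affine_integration_by_parts[OF open_S bounded_S fin cl cv cover _ _ _ \<phi>,
          where a = "\<lambda>T. A T $ i" and b = "\<lambda>T. b T $ i"])
      show "v x $ i = A T $ i \<bullet> x + b T $ i" if "T \<in> \<S>" "x \<in> T \<inter> S" for T x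
        using aff[OF that] by (simp add: matrix_vector_mul_component)
      show "G x $ i $ j = A T $ i $ j" if "T \<in> \<S>" "x \<in> interior T \<inter> S" for T x
        using GT[OF that] by simp
      show "(\<lambda>x. G x $ i $ j) \<in> borel_measurable (lebesgue_on S)"
        by (rule borel_measurable_integrable[OF integrable2[OF GL]])
    qed
  qed
  from weak_grad_eqI[OF vL GL this] show "v \<in> H1 S" "AE x in lebesgue_on S. \<forall>T\<in>\<S>. x \<in> T \<longrightarrow> weak_grad S v x = A T"
    using ae by (auto elim: eventually_elim2)
qed

lemma affine_H1:
  "(\<lambda>x. A *v x + b) \<in> H1 S" "AE x in lebesgue_on S. weak_grad S (\<lambda>x. A *v x + b) x = A"
  using piecewise_affine_H1[of "{UNIV}" "\<lambda>x. A *v x + b" "\<lambda>_. A" "\<lambda>_. b"] by auto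

lemma sym_grad_L2: assumes "v \<in> H1 S" shows "sym_grad S v \<in> Lp_space 2 (lebesgue_on S)"
proof -
  have G: "weak_grad S v \<in> Lp_space 2 (lebesgue_on S)" by (rule weak_grad(1)[OF assms])
  have lin: "bounded_linear (transpose :: real^3^3 \<Rightarrow> real^3^3)"
    by (intro linear_conv_bounded_linear[THEN iffD1] linearI) (auto simp: transpose_def vec_eq_iff)
  have m: "(\<lambda>x. transpose (weak_grad S v x)) \<in> borel_measurable (lebesgue_on S)"
    using G by (auto simp: L2_space_iff intro!: borel_measurable_continuous_on[OF linear_continuous_on[OF lin]])
  have n: "norm (transpose M) = norm M" for M :: "real^3^3"
  proof -
    have "(\<Sum>i\<in>UNIV. \<Sum>j\<in>UNIV. (M $ j $ i)\<^sup>2) = (\<Sum>i\<in>UNIV. \<Sum>j\<in>UNIV. (M $ i $ j)\<^sup>2)"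
      by (rule sum.swap)
    then have "transpose M \<bullet> transpose M = M \<bullet> M"
      by (simp add: inner_vec_def transpose_def power2_eq_square)
    then show ?thesis by (simp add: norm_eq_sqrt_inner)
  qed
  have T: "(\<lambda>x. transpose (weak_grad S v x)) \<in> Lp_space 2 (lebesgue_on S)"
    using G m by (simp add: L2_space_iff n)
  have z: "(\<lambda>_. 0 :: real^3^3) \<in> Lp_space 2 (lebesgue_on S)" by (simp add: L2_space_iff)
  show ?thesis
    using L2_space_lincomb[OF z L2_space_lincomb[OF T G, of 1], of "1/2"]
    unfolding sym_grad_def[abs_def] by simp
qed

lemma sym_grad_symmetric: "transpose (sym_grad S v x) = sym_grad S v x"
  by (simp add: sym_grad_def transpose_def vec_eq_iff add.commute)

text \<open>With \<open>K\<^sub>i\<^sub>j\<^sub>k = \<integral> r\<^sub>i \<partial>\<^sub>j \<partial>\<^sub>k \<phi>\<close>, antisymmetric in \<open>i, j\<close> and symmetric in \<open>j, k\<close>, one gets \<open>K = 0\<close>.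
  So the gradient of \<open>r\<close> is constant, and \<open>r\<close> is affine.\<close>

theorem rigid_imp_affine:
  assumes "connected S" and r: "r \<in> H1 S" and sym: "AE x in lebesgue_on S. sym_grad S r x = 0"
  obtains W b where "transpose W = - W" "AE x in lebesgue_on S. r x = W *v x + b"
proof (cases "S = {}")
  case True
  then show ?thesis by (intro that[of 0 0]) (auto simp: transpose_def vec_eq_iff AE_restrict_space_iff)
next
  case False
  let ?G = "weak_grad S r"
  note G = weak_grad[OF r]
  have anti: "AE x in lebesgue_on S. ?G x $ j $ i = - ?G x $ i $ j" for i j
    using sym
  proof eventually_elim
    case (elim x)
    then have "sym_grad S r x $ i $ j = 0" by simp
    then show ?case by (simp add: sym_grad_def transpose_def)
  qed
  have grad0: "(LINT x|lebesgue_on S. ?G x $ i $ j * partial_deriv k \<phi> x) = 0" if \<phi>: "\<phi> \<in> test_functions S" for \<phi> i j k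
  proof -
    define K where "K = (\<lambda>i j k. LINT x|lebesgue_on S. r x $ i * partial_deriv j (partial_deriv k \<phi>) x)"
    have KG: "K i j k = - (LINT x|lebesgue_on S. ?G x $ i $ j * partial_deriv k \<phi> x)" for i j k
      unfolding K_def by (rule is_weak_gradD[OF G(2) test_function_partial_deriv[OF \<phi>]])
    have "continuously_differentiable 2 \<phi>" using \<phi> by (simp add: test_functions_def)
    then have s: "K i j k = K i k j" for i j k
      unfolding K_def using partial_deriv_commute[of \<phi> j k] by simp
    have a: "K i j k = - K j i k" for i j k
    proof -
      have m: "(\<lambda>x. ?G x $ i $ j * partial_deriv k \<phi> x) \<in> borel_measurable (lebesgue_on S)" for i j
        by (rule borel_measurable_integrable[OF integrable_mult_test[OF integrable2[OF G(1)] test_function_partial_deriv[OF \<phi>]]])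
      have "(LINT x|lebesgue_on S. ?G x $ j $ i * partial_deriv k \<phi> x) = (LINT x|lebesgue_on S. - (?G x $ i $ j * partial_deriv k \<phi> x))"
        by (rule integral_cong_AE[OF m borel_measurable_uminus[OF m]]) (use anti[of j i] in \<open>auto elim: eventually_mono\<close>)
      then show ?thesis unfolding KG by simp
    qed
    have "K i j k = - K j i k" by (rule a)
    also have "\<dots> = - K j k i" by (simp add: s)
    also have "\<dots> = K k j i" using a[of j k i] by simp
    also have "\<dots> = K k i j" by (rule s)
    also have "\<dots> = - K i k j" by (rule a)
    also have "\<dots> = - K i j k" by (simp add: s)
    finally show ?thesis unfolding KG by simp
  qed
  have "\<exists>c. AE x in lebesgue_on S. ?G x $ i $ j = c" for i j
  proof -
    obtain c where "AE x in lebesgue_on S. ?G x $ i $ j = c"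
      by (rule zero_gradient_imp_constant[OF open_S bounded_S assms(1) integrable2[OF G(1)] grad0])
    then show ?thesis by blast
  qed
  then obtain w where w: "\<And>i j. AE x in lebesgue_on S. ?G x $ i $ j = w i j" by metis
  define W where "W = (\<chi> i j. w i j)"
  have GW: "AE x in lebesgue_on S. ?G x = W"
  proof -
    have "AE x in lebesgue_on S. \<forall>i\<in>UNIV. \<forall>j\<in>UNIV. ?G x $ i $ j = w i j" using w by (intro AE_finite_allI) auto
    then show ?thesis by eventually_elim (simp add: W_def vec_eq_iff)
  qed
  have "AE x in lebesgue_on S. transpose W = - W"
    using GW sym
  proof eventually_elim
    case (elim x)
    then have "(1/2) *\<^sub>R (transpose W + W) = 0" by (simp add: sym_grad_def)
    then show ?case by (simp add: eq_neg_iff_add_eq_0)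
  qed
  then have tW: "transpose W = - W" by (rule AE_lebesgue_on_open_nonempty[OF _ open_S False])
  \<comment> \<open>Subtracting the linear field with the constant gradient \<open>W\<close> leaves
    a field with zero weak gradient, whose components are constant. The summand 0 only matches the
    shape of \<open>affine_H1\<close>.\<close>
  define d where "d = (\<lambda>x. r x + (-1) *\<^sub>R (W *v x + 0))"
  have d: "d \<in> H1 S" "AE x in lebesgue_on S. weak_grad S d x = 0"
  proof -
    show "d \<in> H1 S" unfolding d_def by (rule H1_lincomb(1)[OF r affine_H1(1)])
    show "AE x in lebesgue_on S. weak_grad S d x = 0"
      using H1_lincomb(2)[OF r affine_H1(1), of "-1" W 0] affine_H1(2)[of W 0] GW
      unfolding d_def by eventually_elim simp
  qed
  have "\<exists>c. AE x in lebesgue_on S. d x $ i = c" for i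
  proof -
    have gr: "(LINT x|lebesgue_on S. d x $ i * partial_deriv j \<phi> x) = 0" if \<phi>: "\<phi> \<in> test_functions S" for \<phi> j
    proof -
      have "(LINT x|lebesgue_on S. weak_grad S d x $ i $ j * \<phi> x) = (LINT x|lebesgue_on S. 0)"
        by (rule integral_cong_AE[OF borel_measurable_integrable[OF integrable_mult_test[OF integrable2[OF weak_grad(1)[OF d(1)]] \<phi>]]])
           (use d(2) in \<open>auto elim: eventually_mono\<close>)
      then show ?thesis using is_weak_gradD[OF weak_grad(2)[OF d(1)] \<phi>, of i j] by simp
    qed
    obtain c where "AE x in lebesgue_on S. d x $ i = c"
      by (rule zero_gradient_imp_constant[OF open_S bounded_S assms(1) integrable1[OF H1_L2[OF d(1)]] gr])
    then show ?thesis by blast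
  qed
  then obtain c where c: "\<And>i. AE x in lebesgue_on S. d x $ i = c i" by metis
  have "AE x in lebesgue_on S. \<forall>i\<in>UNIV. d x $ i = c i" using c by (intro AE_finite_allI) auto
  then have "AE x in lebesgue_on S. r x = W *v x + (\<chi> i. c i)"
  proof eventually_elim
    case (elim x)
    then have "d x = (\<chi> i. c i)" by (simp add: vec_eq_iff)
    then show ?case by (simp add: d_def algebra_simps)
  qed
  with tW show ?thesis by (rule that)
qed

lemma rigid_affine_AE:
  assumes "connected S"
  shows "r \<in> rigid S \<Longrightarrow> \<exists>W b. transpose W = - W \<and> (AE x in lebesgue_on S. r x = W *v x + b)"
  using rigid_imp_affine[OF assms, of r] unfolding rigid_def by blast

text \<open>Each of the two terms of the symmetrised gradient is annihilated by one of the two curls.\<close>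

theorem sym_grad_strain_space:
  assumes v: "v \<in> H1 S" and e: "e \<in> Lp_space 2 (lebesgue_on S)" "AE x in lebesgue_on S. e x = sym_grad S v x"
  shows "e \<in> strain_space S"
proof -
  let ?G = "weak_grad S v"
  note G = weak_grad[OF v]
  have "AE x in lebesgue_on S. transpose (e x) = e x"
    using e(2) by eventually_elim (simp add: sym_grad_symmetric)
  moreover have "(LINT x|lebesgue_on S. (\<Sum>k\<in>UNIV. \<Sum>l\<in>UNIV. \<Sum>m\<in>UNIV. \<Sum>n\<in>UNIV.
      levi_civita i l k * levi_civita j m n * (e x $ k $ n * partial_deriv l (partial_deriv m \<phi>) x))) = 0"
    if \<phi>: "\<phi> \<in> test_functions S" for \<phi> i j
  proof -
    have d\<phi>: "partial_deriv l (partial_deriv m \<phi>) \<in> test_functions S" for l m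
      by (intro test_function_partial_deriv \<phi>)
    have ie: "integrable (lebesgue_on S) (\<lambda>x. e x $ k $ n * partial_deriv l (partial_deriv m \<phi>) x)" for k n l m
      by (rule integrable_mult_test[OF integrable2[OF e(1)] d\<phi>])
    \<comment> \<open>All three derivatives now sit on the test function, so \<open>K\<close> is
      symmetric in its last three indices.\<close>
    define K where "K = (\<lambda>k n l m. LINT x|lebesgue_on S. v x $ k * partial_deriv n (partial_deriv l (partial_deriv m \<phi>)) x)"
    have cd: "continuously_differentiable 2 \<phi>" "continuously_differentiable 2 (partial_deriv m \<phi>)" for m
      using \<phi> test_function_partial_deriv[OF \<phi>] by (auto simp: test_functions_def)
    have s1: "K k n l m = K k l n m" for k n l m
      unfolding K_def using partial_deriv_commute[OF cd(2), of n l] by simp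
    have "partial_deriv l (partial_deriv m \<phi>) = partial_deriv m (partial_deriv l \<phi>)" for l m
      using partial_deriv_commute[OF cd(1), of l m] by blast
    then have s2: "K k n l m = K k n m l" for k n l m unfolding K_def by simp
    have E: "(LINT x|lebesgue_on S. e x $ k $ n * partial_deriv l (partial_deriv m \<phi>) x) = - (1/2) * (K k n l m + K n k l m)" for k n l m
    proof -
      have iG: "integrable (lebesgue_on S) (\<lambda>x. ?G x $ k $ n * partial_deriv l (partial_deriv m \<phi>) x)" for k n
        by (rule integrable_mult_test[OF integrable2[OF G(1)] d\<phi>])
      have "(LINT x|lebesgue_on S. e x $ k $ n * partial_deriv l (partial_deriv m \<phi>) x)
          = (LINT x|lebesgue_on S. (1/2) * (?G x $ k $ n * partial_deriv l (partial_deriv m \<phi>) x + ?G x $ n $ k * partial_deriv l (partial_deriv m \<phi>) x))"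
      proof (rule integral_cong_AE)
        show "(\<lambda>x. e x $ k $ n * partial_deriv l (partial_deriv m \<phi>) x) \<in> borel_measurable (lebesgue_on S)"
          by (rule borel_measurable_integrable[OF ie])
        show "(\<lambda>x. (1/2) * (?G x $ k $ n * partial_deriv l (partial_deriv m \<phi>) x + ?G x $ n $ k * partial_deriv l (partial_deriv m \<phi>) x)) \<in> borel_measurable (lebesgue_on S)"
          by (intro borel_measurable_times borel_measurable_const borel_measurable_add borel_measurable_integrable[OF iG])
        show "AE x in lebesgue_on S. e x $ k $ n * partial_deriv l (partial_deriv m \<phi>) x
          = (1/2) * (?G x $ k $ n * partial_deriv l (partial_deriv m \<phi>) x + ?G x $ n $ k * partial_deriv l (partial_deriv m \<phi>) x)"
          using e(2)
        proof eventually_elim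
          case (elim x)
          have "e x $ k $ n = (1/2) * (?G x $ k $ n + ?G x $ n $ k)"
            unfolding elim sym_grad_def transpose_def by simp
          then show ?case by (simp only:) (simp add: algebra_simps)
        qed
      qed
      also have "\<dots> = (1/2) * ((LINT x|lebesgue_on S. ?G x $ k $ n * partial_deriv l (partial_deriv m \<phi>) x) + (LINT x|lebesgue_on S. ?G x $ n $ k * partial_deriv l (partial_deriv m \<phi>) x))"
        using iG[of k n] iG[of n k] by simp
      finally have 1: "(LINT x|lebesgue_on S. e x $ k $ n * partial_deriv l (partial_deriv m \<phi>) x)
          = (1/2) * ((LINT x|lebesgue_on S. ?G x $ k $ n * partial_deriv l (partial_deriv m \<phi>) x)
              + (LINT x|lebesgue_on S. ?G x $ n $ k * partial_deriv l (partial_deriv m \<phi>) x))" .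
      have KG: "(LINT x|lebesgue_on S. ?G x $ k $ n * partial_deriv l (partial_deriv m \<phi>) x) = - K k n l m" for k n
        unfolding K_def using is_weak_gradD[OF G(2) d\<phi>, of k n l m] by simp
      show ?thesis unfolding 1 KG by (simp add: field_simps)
    qed
    \<comment> \<open>Cyclic invariance of the scalar triple product moves the two indices into the
      cross product, which is skew.\<close>
    have lc: "levi_civita i l k = - levi_civita i k l" for i l k
      unfolding levi_civita_def using cross_triple[of "axis i 1" "axis l 1" "axis k 1"]
        cross_triple[of "axis i 1" "axis k 1" "axis l 1"] cross_skew[of "axis l 1" "axis k 1"]
      by (simp add: cross_triple)
    let ?c = "\<lambda>k l m n. levi_civita i l k * levi_civita j m n"
    have "(LINT x|lebesgue_on S. (\<Sum>k\<in>UNIV. \<Sum>l\<in>UNIV. \<Sum>m\<in>UNIV. \<Sum>n\<in>UNIV. ?c k l m n * (e x $ k $ n * partial_deriv l (partial_deriv m \<phi>) x)))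
       = (\<Sum>k\<in>UNIV. \<Sum>l\<in>UNIV. \<Sum>m\<in>UNIV. \<Sum>n\<in>UNIV. ?c k l m n * (- (1/2) * (K k n l m + K n k l m)))"
      using ie by (simp add: E)
    also have "\<dots> = - (1/2) * (\<Sum>k\<in>UNIV. \<Sum>l\<in>UNIV. \<Sum>m\<in>UNIV. \<Sum>n\<in>UNIV. ?c k l m n * K k n l m)
        - (1/2) * (\<Sum>k\<in>UNIV. \<Sum>l\<in>UNIV. \<Sum>m\<in>UNIV. \<Sum>n\<in>UNIV. ?c k l m n * K n k l m)"
      by (simp add: sum_distrib_left sum_subtractf sum_negf sum.distrib algebra_simps)
    \<comment> \<open>Here \<open>K\<close> is symmetric in \<open>m\<close> and \<open>n\<close>,
      in which the second Levi-Civita symbol is skew.\<close>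
    also have "(\<Sum>k\<in>UNIV. \<Sum>l\<in>UNIV. \<Sum>m\<in>UNIV. \<Sum>n\<in>UNIV. ?c k l m n * K k n l m) = 0"
    proof -
      have "(\<Sum>m\<in>UNIV. \<Sum>n\<in>UNIV. ?c k l m n * K k n l m) = 0" for k l
      proof -
        have "(\<Sum>m\<in>UNIV. \<Sum>n\<in>UNIV. ?c k l m n * K k n l m) = (\<Sum>n\<in>UNIV. \<Sum>m\<in>UNIV. ?c k l m n * K k n l m)" by (rule sum.swap)
        also have "\<dots> = (\<Sum>n\<in>UNIV. \<Sum>m\<in>UNIV. - (?c k l n m * K k m l n))"
        proof (intro sum.cong refl)
          fix m n
          have "K k n l m = K k m l n" using s1 s2 by metis
          then show "?c k l m n * K k n l m = - (?c k l n m * K k m l n)" using lc[of j m n] by simp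
        qed
        also have "\<dots> = - (\<Sum>m\<in>UNIV. \<Sum>n\<in>UNIV. ?c k l m n * K k n l m)" by (simp add: sum_negf)
        finally show ?thesis by simp
      qed
      then show ?thesis by simp
    qed
    \<comment> \<open>Here \<open>K\<close> is symmetric in \<open>k\<close> and \<open>l\<close>,
      in which the first Levi-Civita symbol is skew.\<close>
    also have "(\<Sum>k\<in>UNIV. \<Sum>l\<in>UNIV. \<Sum>m\<in>UNIV. \<Sum>n\<in>UNIV. ?c k l m n * K n k l m) = 0"
    proof -
      let ?X = "\<lambda>k l. \<Sum>m\<in>UNIV. \<Sum>n\<in>UNIV. ?c k l m n * K n k l m"
      have anti: "?X k l = - ?X l k" for k l
      proof -
        have "?X k l = (\<Sum>m\<in>UNIV. \<Sum>n\<in>UNIV. - (?c l k m n * K n l k m))"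
          using s1 lc[of i l k] by (intro sum.cong refl) simp
        then show ?thesis by (simp add: sum_negf)
      qed
      have "(\<Sum>k\<in>UNIV. \<Sum>l\<in>UNIV. ?X k l) = (\<Sum>l\<in>UNIV. \<Sum>k\<in>UNIV. ?X k l)" by (rule sum.swap)
      also have "\<dots> = (\<Sum>l\<in>UNIV. \<Sum>k\<in>UNIV. - ?X l k)" by (intro sum.cong refl anti)
      also have "\<dots> = - (\<Sum>k\<in>UNIV. \<Sum>l\<in>UNIV. ?X k l)" by (simp only: sum_negf)
      finally show ?thesis by linarith
    qed
    finally show ?thesis by simp
  qed
  ultimately show ?thesis using e(1) by (simp add: strain_space_def)
qed

end

subsection \<open>Lipschitz domains\<close>

locale lipschitz_domain =
  fixes \<Omega> :: "(real^3) set"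
  assumes open_domain: "open \<Omega>" and bounded_domain: "bounded \<Omega>"
    and lipschitz: "lipschitz_boundary \<Omega>"
begin

lemma boundary_chart:
  assumes "x \<in> frontier \<Omega>"
  obtains r n \<gamma> C where "r > 0" "norm n = 1" "C-lipschitz_on UNIV \<gamma>"
    "\<And>y. y \<in> ball x r \<Longrightarrow> y \<in> \<Omega> \<longleftrightarrow> \<gamma> (y - (y \<bullet> n) *\<^sub>R n) < y \<bullet> n"
proof -
  obtain r n \<gamma> C where *: "r > 0" "norm n = 1" "C-lipschitz_on UNIV \<gamma>"
    "\<Omega> \<inter> ball x r = {y \<in> ball x r. \<gamma> (y - (y \<bullet> n) *\<^sub>R n) < y \<bullet> n}"
    using lipschitz assms unfolding lipschitz_boundary_def by blast
  then show ?thesis using that[of r n C \<gamma>] by blast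
qed

text \<open>A Lipschitz domain has exterior points arbitrarily close to every boundary point, which
  excludes slits. It will place the interiors of mesh cells inside \<open>\<Omega>\<close>.\<close>

lemma interior_closure_domain: "interior (closure \<Omega>) \<subseteq> \<Omega>"
proof
  fix x assume x: "x \<in> interior (closure \<Omega>)"
  show "x \<in> \<Omega>"
  proof (rule ccontr)
    assume nx: "x \<notin> \<Omega>"
    then have "x \<in> frontier \<Omega>"
      using x interior_subset[of "closure \<Omega>"] open_domain by (auto simp: frontier_def interior_open)
    then obtain r n \<gamma> C where c: "r > 0" "norm n = 1" "C-lipschitz_on UNIV \<gamma>"
      "\<And>y. y \<in> ball x r \<Longrightarrow> y \<in> \<Omega> \<longleftrightarrow> \<gamma> (y - (y \<bullet> n) *\<^sub>R n) < y \<bullet> n"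
      by (rule boundary_chart) blast
    have nn: "n \<bullet> n = 1" using c(2) by (simp add: norm_eq_1)
    obtain e where e: "e > 0" "ball x e \<subseteq> closure \<Omega>" using x mem_interior by blast
    define t where "t = min e r / 2"
    have t: "0 < t" "t < e" "t < r" using e c by (auto simp: t_def min_def)
    \<comment> \<open>Moving down along the chart direction leads strictly below the graph, into the
      open set \<open>Z\<close>, which misses \<open>\<Omega>\<close>.\<close>
    define y where "y = x - t *\<^sub>R n"
    define Z where "Z = ball x r \<inter> {z. z \<bullet> n < \<gamma> (z - (z \<bullet> n) *\<^sub>R n)}"
    have \<gamma>: "continuous_on UNIV \<gamma>" using c(3) lipschitz_on_continuous_on by blast
    have "open {z. z \<bullet> n < \<gamma> (z - (z \<bullet> n) *\<^sub>R n)}"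
      by (intro open_Collect_less continuous_intros continuous_on_compose2[OF \<gamma>]) auto
    then have "open Z" by (auto simp: Z_def)
    have d: "dist x y = t" using t c(2) by (simp add: y_def dist_norm)
    have "y - (y \<bullet> n) *\<^sub>R n = x - (x \<bullet> n) *\<^sub>R n" "y \<bullet> n = x \<bullet> n - t"
      using nn by (auto simp: y_def inner_diff_left algebra_simps)
    moreover have "\<not> \<gamma> (x - (x \<bullet> n) *\<^sub>R n) < x \<bullet> n" using c(4)[of x] nx c(1) by auto
    ultimately have "y \<in> Z" using d t by (auto simp: Z_def)
    moreover have "y \<in> closure \<Omega>" using e d t by auto
    ultimately have "\<Omega> \<inter> Z \<noteq> {}" using \<open>open Z\<close> open_Int_closure_eq_empty[of Z \<Omega>] by blast
    then show False using c(4) by (auto simp: Z_def)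
  qed
qed

text \<open>Near a boundary point two points of the domain are joined by going up in the direction of the
  chart, across above the graph, and down again.\<close>

lemma locally_connected_closure:
  assumes x: "x \<in> closure \<Omega>" and R: "R > 0"
  obtains r where "r > 0" "r \<le> R"
    "\<And>y z. y \<in> \<Omega> \<inter> ball x r \<Longrightarrow> z \<in> \<Omega> \<inter> ball x r \<Longrightarrow> connected_component (\<Omega> \<inter> ball x R) y z"
proof (cases "x \<in> \<Omega>")
  case True
  then obtain e where e: "e > 0" "ball x e \<subseteq> \<Omega>" using open_domain openE by blast
  show ?thesis
  proof (rule that[of "min e R"])
    fix y z assume yz: "y \<in> \<Omega> \<inter> ball x (min e R)" "z \<in> \<Omega> \<inter> ball x (min e R)"
    show "connected_component (\<Omega> \<inter> ball x R) y z"
      by (rule connected_componentI[of "ball x (min e R)"]) (use yz e in auto)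
  qed (use e R in auto)
next
  case False
  then have "x \<in> frontier \<Omega>" using x open_domain by (simp add: frontier_def interior_open)
  then obtain r0 n \<gamma> C where c: "r0 > 0" "norm n = 1" "C-lipschitz_on UNIV \<gamma>"
    "\<And>y. y \<in> ball x r0 \<Longrightarrow> y \<in> \<Omega> \<longleftrightarrow> \<gamma> (y - (y \<bullet> n) *\<^sub>R n) < y \<bullet> n"
    by (rule boundary_chart) blast
  have nn: "n \<bullet> n = 1" using c(2) by (simp add: norm_eq_1)
  have C0: "C \<ge> 0" using c(3) lipschitz_on_nonneg by blast
  define R' where "R' = min R r0"
  \<comment> \<open>Two points of \<open>ball x r\<close> differ in height by at most
    \<open>2 * r\<close>, and their projections by at most \<open>4 * r\<close>, so the graph rises
    by at most \<open>4 * C * r\<close> between them. A lift by \<open>h = (4 * C + 2) * r\<close>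
    therefore clears the graph, and \<open>r + h = (4 * C + 3) * r\<close> stays below
    \<open>R'\<close>.\<close>
  define r where "r = R' / (4 * C + 4)"
  define h where "h = (4 * C + 2) * r"
  have R': "R' > 0" "R' \<le> R" "R' \<le> r0" using R c by (auto simp: R'_def)
  have r0: "r > 0" using R' C0 by (simp add: r_def)
  have "(4 * C + 4) * r = R'" using C0 by (simp add: r_def)
  then have rh: "r + h < R'" using r0 by (simp add: h_def algebra_simps)
  have h0: "h \<ge> 0" using C0 r0 by (simp add: h_def)
  have inb: "w + t *\<^sub>R n \<in> ball x R'" if "w \<in> ball x r" "0 \<le> t" "t \<le> h" for w t
  proof -
    have "dist x (w + t *\<^sub>R n) \<le> dist x w + dist w (w + t *\<^sub>R n)" by (rule dist_triangle)
    also have "dist w (w + t *\<^sub>R n) = t" using that c(2) by (simp add: dist_norm)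
    finally show ?thesis using that rh by auto
  qed
  have proj: "(w + t *\<^sub>R n) - ((w + t *\<^sub>R n) \<bullet> n) *\<^sub>R n = w - (w \<bullet> n) *\<^sub>R n" "(w + t *\<^sub>R n) \<bullet> n = w \<bullet> n + t" for w t
    using nn by (auto simp: inner_add_left algebra_simps)
  have up: "y + t *\<^sub>R n \<in> \<Omega> \<inter> ball x R" if y: "y \<in> \<Omega> \<inter> ball x r" and t: "0 \<le> t" "t \<le> h" for y t
  proof -
    have b: "y + t *\<^sub>R n \<in> ball x R'" using inb y t by auto
    have "y \<in> ball x r0" using y inb[of y 0] h0 R' by auto
    then have "\<gamma> (y - (y \<bullet> n) *\<^sub>R n) < y \<bullet> n" using c(4)[of y] y by auto
    moreover have "y + t *\<^sub>R n \<in> ball x r0" using b R' by auto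
    from c(4)[OF this] have "y + t *\<^sub>R n \<in> \<Omega> \<longleftrightarrow> \<gamma> (y - (y \<bullet> n) *\<^sub>R n) < (y + t *\<^sub>R n) \<bullet> n"
      by (simp only: proj(1))
    ultimately have "y + t *\<^sub>R n \<in> \<Omega>" using t by (simp add: proj(2))
    then show ?thesis using b R' by auto
  qed
  \<comment> \<open>Here \<open>w\<close> is any point of the small ball: the segment between two
    points of the domain may dip below the graph, but its lifted copy may not.\<close>
  have across: "w + h *\<^sub>R n \<in> \<Omega> \<inter> ball x R" if y: "y \<in> \<Omega> \<inter> ball x r" and w: "w \<in> ball x r" for y w
  proof -
    have b: "w + h *\<^sub>R n \<in> ball x R'" using inb w h0 by auto
    have "y \<in> ball x r0" using y inb[of y 0] h0 R' by auto
    then have y1: "\<gamma> (y - (y \<bullet> n) *\<^sub>R n) < y \<bullet> n" using c(4)[of y] y by auto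
    have wy: "norm (w - y) \<le> 2 * r"
      using dist_triangle[of w y x] w y by (auto simp: dist_norm norm_minus_commute)
    have i: "\<bar>(w - y) \<bullet> n\<bar> \<le> norm (w - y)" using Cauchy_Schwarz_ineq2[of "w - y" n] c(2) by simp
    have "dist (w - (w \<bullet> n) *\<^sub>R n) (y - (y \<bullet> n) *\<^sub>R n) = norm ((w - y) - ((w - y) \<bullet> n) *\<^sub>R n)"
      by (simp add: dist_norm inner_diff_left algebra_simps)
    also have "\<dots> \<le> norm (w - y) + \<bar>(w - y) \<bullet> n\<bar>"
      using norm_triangle_ineq4[of "w - y" "((w - y) \<bullet> n) *\<^sub>R n"] c(2) by simp
    also have "\<dots> \<le> 4 * r" using i wy by linarith
    finally have pd: "dist (w - (w \<bullet> n) *\<^sub>R n) (y - (y \<bullet> n) *\<^sub>R n) \<le> 4 * r" .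
    have "dist (\<gamma> (w - (w \<bullet> n) *\<^sub>R n)) (\<gamma> (y - (y \<bullet> n) *\<^sub>R n)) \<le> C * dist (w - (w \<bullet> n) *\<^sub>R n) (y - (y \<bullet> n) *\<^sub>R n)"
      by (rule lipschitz_onD[OF c(3)]) auto
    also have "\<dots> \<le> C * (4 * r)" by (rule mult_left_mono[OF pd C0])
    finally have g: "\<gamma> (w - (w \<bullet> n) *\<^sub>R n) \<le> \<gamma> (y - (y \<bullet> n) *\<^sub>R n) + C * (4 * r)"
      by (simp add: dist_real_def)
    have "y \<bullet> n - 2 * r \<le> w \<bullet> n" using i wy by (auto simp: inner_diff_left)
    then have "\<gamma> (w - (w \<bullet> n) *\<^sub>R n) < w \<bullet> n + h" using g y1 by (simp add: h_def algebra_simps)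
    moreover have "w + h *\<^sub>R n \<in> ball x r0" using b R' by auto
    from c(4)[OF this] have "w + h *\<^sub>R n \<in> \<Omega> \<longleftrightarrow> \<gamma> (w - (w \<bullet> n) *\<^sub>R n) < (w + h *\<^sub>R n) \<bullet> n"
      by (simp only: proj(1))
    ultimately have "w + h *\<^sub>R n \<in> \<Omega>" by (simp only: proj(2))
    then show ?thesis using b R' by auto
  qed
  have seg: "connected_component (\<Omega> \<inter> ball x R) a b" if "closed_segment a b \<subseteq> \<Omega> \<inter> ball x R" for a b
    by (rule connected_componentI[of "closed_segment a b"]) (use that in auto)
  have vert: "connected_component (\<Omega> \<inter> ball x R) y (y + h *\<^sub>R n)" if y: "y \<in> \<Omega> \<inter> ball x r" for y
  proof (rule seg)
    show "closed_segment y (y + h *\<^sub>R n) \<subseteq> \<Omega> \<inter> ball x R"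
    proof
      fix z assume "z \<in> closed_segment y (y + h *\<^sub>R n)"
      then obtain u where u: "0 \<le> u" "u \<le> 1" "z = (1 - u) *\<^sub>R y + u *\<^sub>R (y + h *\<^sub>R n)"
        by (auto simp: closed_segment_def)
      then have "z = y + (u * h) *\<^sub>R n" by (simp add: algebra_simps)
      moreover have "u * h \<le> h" using u h0 by (simp add: mult_left_le_one_le)
      ultimately show "z \<in> \<Omega> \<inter> ball x R" using up[OF y, of "u * h"] u h0 by simp
    qed
  qed
  show ?thesis
  proof (rule that[of r])
    show "r \<le> R" using rh h0 R' by linarith
    fix y z assume y: "y \<in> \<Omega> \<inter> ball x r" and z: "z \<in> \<Omega> \<inter> ball x r"
    have hor: "connected_component (\<Omega> \<inter> ball x R) (y + h *\<^sub>R n) (z + h *\<^sub>R n)"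
    proof (rule seg)
      show "closed_segment (y + h *\<^sub>R n) (z + h *\<^sub>R n) \<subseteq> \<Omega> \<inter> ball x R"
      proof
        fix p assume "p \<in> closed_segment (y + h *\<^sub>R n) (z + h *\<^sub>R n)"
        then obtain u where u: "0 \<le> u" "u \<le> 1" "p = (1 - u) *\<^sub>R (y + h *\<^sub>R n) + u *\<^sub>R (z + h *\<^sub>R n)"
          by (auto simp: closed_segment_def)
        let ?w = "(1 - u) *\<^sub>R y + u *\<^sub>R z"
        have "?w \<in> closed_segment y z" using u by (auto simp: closed_segment_def)
        then have "?w \<in> ball x r" using closed_segment_subset[of y "ball x r" z] y z by auto
        moreover have "p = ?w + h *\<^sub>R n" using u(3) by (simp add: algebra_simps)
        ultimately show "p \<in> \<Omega> \<inter> ball x R" using across[OF y] by simp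
      qed
    qed
    show "connected_component (\<Omega> \<inter> ball x R) y z"
      by (rule connected_component_trans[OF vert[OF y] connected_component_trans[OF hor connected_component_sym[OF vert[OF z]]]])
  qed (rule r0)
qed

end

section \<open>Boundary values of fields with a continuous representative\<close>

context lipschitz_domain begin

text \<open>By continuity the averages of \<open>norm (w y - w x)\<close> tend to 0, and if
  \<open>z\<close> has the same property then \<open>norm (z - w x)\<close> is at most the sum of
  two vanishing averages. The field \<open>v\<close> agrees with \<open>w\<close> only almost
  everywhere because members of a displacement class do no better.\<close>

lemma boundary_trace_continuous:
  assumes w: "continuous_on (closure \<Omega>) w" and x: "x \<in> frontier \<Omega>"
    and v: "v \<in> borel_measurable (lebesgue_on \<Omega>)" and ae: "AE y in lebesgue_on \<Omega>. v y = w y"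
  shows "boundary_trace \<Omega> v x = w x"
proof -
  define D where "D = (\<lambda>r. \<Omega> \<inter> ball x r)"
  have xc: "x \<in> closure \<Omega>" using x by (simp add: frontier_def)
  have D: "open (D r)" "bounded (D r)" "D r \<subseteq> \<Omega>" for r
    using open_domain bounded_domain by (auto simp: D_def bounded_Int)
  have Dl: "D r \<in> lmeasurable" "D r \<in> sets lebesgue" for r
    using lmeasurable_open[OF D(2) D(1)] fmeasurableD by blast+
  have Dn: "D r \<noteq> {}" if "r > 0" for r
  proof -
    have "x \<in> ball x r \<inter> closure \<Omega>" using xc that by simp
    then have "ball x r \<inter> closure \<Omega> \<noteq> {}" by blast
    then have "ball x r \<inter> \<Omega> \<noteq> {}" using open_Int_closure_eq_empty[OF open_ball, of x r \<Omega>] by simp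
    then show ?thesis by (simp add: D_def Int_commute)
  qed
  have \<mu>: "measure lebesgue (D r) > 0" if "r > 0" for r
  proof -
    have "\<not> negligible (D r)" using open_not_negligible D(1) Dn[OF that] by blast
    then have "measure lebesgue (D r) \<noteq> 0"
      using Dl(1) by (metis negligible_iff_measure0)
    then show ?thesis using measure_nonneg[of lebesgue "D r"] by linarith
  qed
  have fin: "finite_measure (lebesgue_on (D r))" for r by (rule finite_measure_lebesgue_on[OF Dl(1)])
  have mD: "measure (lebesgue_on (D r)) (space (lebesgue_on (D r))) = measure lebesgue (D r)" for r
    using Dl(2)[of r] by (simp add: measure_restrict_space)
  have aeD: "AE y in lebesgue_on (D r). v y = w y" for r
    by (rule AE_lebesgue_on_subset[OF ae D(3)]) (use open_domain Dl in auto)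
  have wm: "w \<in> borel_measurable (lebesgue_on (D r))" for r
    by (rule continuous_imp_measurable_on_sets_lebesgue[OF continuous_on_subset[OF w] Dl(2)])
       (use D(3) closure_subset in blast)
  have "v \<in> borel_measurable (lebesgue_on (D r))" for r
    by (rule measurable_restrict_mono[OF v D(3)])
  then have nm: "(\<lambda>y. norm (u y - z)) \<in> borel_measurable (lebesgue_on (D r))" if "u \<in> {v, w}" for u z r
    using that wm[of r] by (auto intro!: measurable_compose[OF _ borel_measurable_norm] borel_measurable_diff)
  have avg: "(LINT y|lebesgue_on (D r). norm (v y - z)) = (LINT y|lebesgue_on (D r). norm (w y - z))" for r z
    by (rule integral_cong_AE[OF nm nm]) (use aeD[of r] in \<open>auto elim: eventually_mono\<close>)
  have bw: "\<exists>M. \<forall>y\<in>D r. norm (w y - z) \<le> M" for r z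
  proof -
    have "compact (w ` closure \<Omega>)"
      using w bounded_domain by (intro compact_continuous_image) (auto simp: compact_eq_bounded_closed)
    then obtain M where "\<And>p. p \<in> w ` closure \<Omega> \<Longrightarrow> norm p \<le> M" using compact_imp_bounded bounded_pos by metis
    then have "norm (w y - z) \<le> M + norm z" if "y \<in> D r" for y
      using that D(3)[of r] closure_subset[of \<Omega>] norm_triangle_ineq4[of "w y" z] by fastforce
    then show ?thesis by blast
  qed
  have iw: "integrable (lebesgue_on (D r)) (\<lambda>y. norm (w y - z))" for r z
  proof -
    obtain M where "\<forall>y\<in>D r. norm (w y - z) \<le> M" using bw by blast
    then show ?thesis
      by (intro finite_measure.integrable_const_bound[OF fin, of _ M] nm AE_I2) auto
  qed
  let ?A = "\<lambda>z r. (LINT y|lebesgue_on (D r). norm (v y - z)) / measure lebesgue (D r)"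
  have lim: "(?A (w x) \<longlongrightarrow> 0) (at_right 0)"
  proof (rule tendstoI)
    fix e :: real assume e: "e > 0"
    obtain d where d: "d > 0" "\<And>y. y \<in> closure \<Omega> \<Longrightarrow> dist y x < d \<Longrightarrow> dist (w y) (w x) < e / 2"
      using w xc e unfolding continuous_on_iff by (metis half_gt_zero)
    have "dist (?A (w x) r) 0 < e" if r: "0 < r" "r < d" for r
    proof -
      have "(LINT y|lebesgue_on (D r). norm (w y - w x)) \<le> (LINT y|lebesgue_on (D r). e / 2)"
      proof (rule integral_mono[OF iw])
        show "integrable (lebesgue_on (D r)) (\<lambda>_. e / 2)" using finite_measure.integrable_const[OF fin] by blast
        fix y assume "y \<in> space (lebesgue_on (D r))"
        then have "y \<in> closure \<Omega>" "dist y x < d" using r closure_subset by (auto simp: D_def dist_commute)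
        then show "norm (w y - w x) \<le> e / 2" using d(2)[of y] by (simp add: dist_norm)
      qed
      also have "\<dots> = measure lebesgue (D r) * (e / 2)" using mD[of r] by simp
      finally have "?A (w x) r \<le> e / 2"
        unfolding avg using \<mu>[OF r(1)] by (simp add: divide_le_eq mult.commute)
      moreover have "?A (w x) r \<ge> 0" by (intro divide_nonneg_nonneg Bochner_Integration.integral_nonneg) auto
      ultimately show ?thesis using e unfolding dist_real_def diff_0_right by linarith
    qed
    then show "\<forall>\<^sub>F r in at_right 0. dist (?A (w x) r) 0 < e"
      unfolding eventually_at_right_field using d(1) by blast
  qed
  have uniq: "z = w x" if z: "(?A z \<longlongrightarrow> 0) (at_right 0)" for z
  proof -
    have "\<forall>\<^sub>F r in at_right 0. norm (z - w x) \<le> ?A z r + ?A (w x) r"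
      unfolding eventually_at_right_field
    proof (intro exI[of _ 1] conjI allI impI)
      fix r :: real assume r: "0 < r" "r < 1"
      have "norm (z - w x) * measure lebesgue (D r) = (LINT y|lebesgue_on (D r). norm (z - w x))"
        using mD[of r] by simp
      also have "\<dots> \<le> (LINT y|lebesgue_on (D r). norm (w y - z) + norm (w y - w x))"
      proof (rule integral_mono)
        show "integrable (lebesgue_on (D r)) (\<lambda>_. norm (z - w x))" using finite_measure.integrable_const[OF fin] by blast
        show "integrable (lebesgue_on (D r)) (\<lambda>y. norm (w y - z) + norm (w y - w x))" using iw by simp
        show "norm (z - w x) \<le> norm (w y - z) + norm (w y - w x)" for y
          using norm_triangle_ineq4[of "w y - w x" "w y - z"] by (simp add: algebra_simps)
      qed
      also have "\<dots> = (LINT y|lebesgue_on (D r). norm (w y - z)) + (LINT y|lebesgue_on (D r). norm (w y - w x))"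
        using iw by simp
      finally show "norm (z - w x) \<le> ?A z r + ?A (w x) r"
        unfolding avg using \<mu>[OF r(1)] by (simp add: add_divide_distrib[symmetric] pos_le_divide_eq)
    qed simp
    moreover have "((\<lambda>r. ?A z r + ?A (w x) r) \<longlongrightarrow> 0 + 0) (at_right 0)" by (intro tendsto_add z lim)
    ultimately have "norm (z - w x) \<le> 0 + 0"
      by (intro tendsto_lowerbound[of _ _ "at_right 0"]) auto
    then show ?thesis by simp
  qed
  have "(THE z. (?A z \<longlongrightarrow> 0) (at_right 0)) = w x"
  proof (rule the_equality)
    show "(?A (w x) \<longlongrightarrow> 0) (at_right 0)" by (rule lim)
    show "z = w x" if "(?A z \<longlongrightarrow> 0) (at_right 0)" for z by (rule uniq[OF that])
  qed
  then show ?thesis by (simp only: boundary_trace_def D_def)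
qed

end

subsection \<open>Locally constant cocycles on simply connected sets\<close>

text \<open>\<open>\<rho> i x\<close> is meant as the jump between local data living on
  \<open>B i\<close> and on \<open>B x\<close>. The identity is required at small steps only; the
  values lie in an additive group because rigid displacements are combined by adding the
  fields.\<close>

locale local_cocycle =
  fixes S :: "'a::real_normed_vector set" and B :: "'a \<Rightarrow> 'a set"
    and \<rho> :: "'a \<Rightarrow> 'a \<Rightarrow> 'g::ab_group_add"
  assumes open_B: "x \<in> S \<Longrightarrow> open (B x)"
    and mem_B: "x \<in> S \<Longrightarrow> x \<in> B x"
    and cocycle: "\<lbrakk>i \<in> S; x \<in> S; y \<in> S; x \<in> B i; y \<in> B i; y \<in> B x\<rbrakk> \<Longrightarrow> \<rho> i x + \<rho> x y = \<rho> i y"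
begin

lemma cocycle_refl:
  assumes x: "x \<in> S" shows "\<rho> x x = 0"
proof -
  have "\<rho> x x + \<rho> x x = \<rho> x x" by (rule cocycle[OF x x x mem_B[OF x] mem_B[OF x] mem_B[OF x]])
  then show ?thesis by simp
qed

text \<open>A lift has, locally along \<open>h\<close>, the increments prescribed by \<open>\<rho>\<close>. Lifts exist on small sets, are unique
  up to a constant on connected sets, and can be glued. So they exist on a square, and the increment of
  a lift along a path depends only on the homotopy class of the path.\<close>

definition lift :: "('k::topological_space \<Rightarrow> 'a) \<Rightarrow> 'k set \<Rightarrow> ('k \<Rightarrow> 'g) \<Rightarrow> bool" where
  "lift h K m \<longleftrightarrow> (\<forall>k\<in>K. \<forall>\<^sub>F k' in at k within K. m k' = m k + \<rho> (h k) (h k'))"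

lemma lift_subset: "lift h K m \<Longrightarrow> L \<subseteq> K \<Longrightarrow> lift h L m"
  unfolding lift_def by (auto intro: filter_leD[OF at_le])

lemma lift_cong:
  assumes "lift h K m" "\<And>k. k \<in> K \<Longrightarrow> h k = h' k" "\<And>k. k \<in> K \<Longrightarrow> m k = m' k"
  shows "lift h' K m'"
  unfolding lift_def
proof
  fix k assume k: "k \<in> K"
  have "\<forall>\<^sub>F k' in at k within K. m k' = m k + \<rho> (h k) (h k')"
    using assms(1) k unfolding lift_def by blast
  moreover have "\<forall>\<^sub>F k' in at k within K. k' \<in> K" by (simp add: eventually_at_filter)
  ultimately show "\<forall>\<^sub>F k' in at k within K. m' k' = m' k + \<rho> (h' k) (h' k')"
    by eventually_elim (use k assms(2,3) in force)
qed

lemma lift_shift: "lift h K m \<Longrightarrow> lift h K (\<lambda>k. m k + c)"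
  unfolding lift_def by (auto elim!: eventually_mono simp: algebra_simps)

lemma lift_compose:
  assumes m: "lift h K m" and f: "continuous_on J f" "f ` J \<subseteq> K" and hS: "h ` K \<subseteq> S"
  shows "lift (h \<circ> f) J (m \<circ> f)"
  unfolding lift_def
proof
  fix j assume j: "j \<in> J"
  then have fj: "f j \<in> K" using f by auto
  obtain U where U: "open U" "f j \<in> U" "\<And>k. k \<in> U \<Longrightarrow> k \<in> K \<Longrightarrow> k \<noteq> f j \<Longrightarrow> m k = m (f j) + \<rho> (h (f j)) (h k)"
    using m fj unfolding lift_def eventually_at_topological by metis
  obtain V where V: "open V" "j \<in> V" "\<And>k. k \<in> V \<Longrightarrow> k \<in> J \<Longrightarrow> f k \<in> U"
    using f(1) j U(1,2) unfolding continuous_on_topological by metis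
  \<comment> \<open>The filter at \<open>f j\<close> says nothing about the point \<open>f j\<close>
    itself, to which \<open>f\<close> may return; there the prescribed increment is 0.\<close>
  have "\<rho> (h (f j)) (h (f j)) = 0" using hS fj cocycle_refl by auto
  then have "m (f k) = m (f j) + \<rho> (h (f j)) (h (f k))" if "k \<in> V" "k \<in> J" for k
    using U(3)[of "f k"] V(3)[OF that] f(2) that(2) by fastforce
  then show "\<forall>\<^sub>F k in at j within J. (m \<circ> f) k = (m \<circ> f) j + \<rho> ((h \<circ> f) j) ((h \<circ> f) k)"
    unfolding eventually_at_topological using V by auto
qed

text \<open>Inside a single \<open>B i\<close> the map \<open>\<rho> i\<close> itself has the
  prescribed increments; this is the cocycle identity.\<close>

lemma lift_small:
  assumes "continuous_on K h" "h ` K \<subseteq> S" "i \<in> S" "h ` K \<subseteq> B i"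
  shows "lift h K (\<lambda>k. c + \<rho> i (h k))"
  unfolding lift_def
proof
  fix k assume k: "k \<in> K"
  then have hk: "h k \<in> S" "h k \<in> B i" using assms by auto
  obtain V where V: "open V" "k \<in> V" "\<And>k'. k' \<in> V \<Longrightarrow> k' \<in> K \<Longrightarrow> h k' \<in> B (h k)"
    using assms(1) k open_B[OF hk(1)] mem_B[OF hk(1)] unfolding continuous_on_topological by metis
  have "c + \<rho> i (h k') = c + \<rho> i (h k) + \<rho> (h k) (h k')" if "k' \<in> V" "k' \<in> K" for k'
    using cocycle[OF assms(3) hk(1) _ hk(2) _ V(3)[OF that]] that assms(2,4)
    by (simp add: add.assoc image_subset_iff)
  then show "\<forall>\<^sub>F k' in at k within K. c + \<rho> i (h k') = c + \<rho> i (h k) + \<rho> (h k) (h k')"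
    unfolding eventually_at_topological using V by auto
qed

text \<open>Both lifts have the same local increments, so their difference is locally
  constant.\<close>

lemma lift_unique:
  assumes "connected K" "lift h K m1" "lift h K m2" "k0 \<in> K" "m1 k0 = m2 k0" "k \<in> K"
  shows "m1 k = m2 k"
proof -
  have "(\<lambda>k. m1 k - m2 k) k0 = (\<lambda>k. m1 k - m2 k) k"
  proof (rule connected_local_const[OF assms(1,4,6)], intro ballI)
    fix a assume "a \<in> K"
    then have "\<forall>\<^sub>F k' in at a within K. m1 k' = m1 a + \<rho> (h a) (h k')"
        "\<forall>\<^sub>F k' in at a within K. m2 k' = m2 a + \<rho> (h a) (h k')"
      using assms(2,3) unfolding lift_def by auto
    then show "\<forall>\<^sub>F b in at a within K. m1 a - m2 a = m1 b - m2 b"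
      by eventually_elim simp
  qed
  then show ?thesis using assms(5) by simp
qed

lemma lift_glue:
  assumes "closed K1" "closed K2" "lift h K1 m1" "lift h K2 m2"
    and eq: "\<And>k. k \<in> K1 \<Longrightarrow> k \<in> K2 \<Longrightarrow> m1 k = m2 k"
  shows "lift h (K1 \<union> K2) (\<lambda>k. if k \<in> K1 then m1 k else m2 k)"
  unfolding lift_def
proof
  let ?m = "\<lambda>k. if k \<in> K1 then m1 k else m2 k"
  have *: "\<forall>\<^sub>F k' in at k within L. ?m k' = ?m k + \<rho> (h k) (h k')"
    if "closed L" "lift h L m" "\<And>k. k \<in> L \<Longrightarrow> ?m k = m k" for k L m
  proof (cases "k \<in> L")
    case True
    then have "\<forall>\<^sub>F k' in at k within L. m k' = m k + \<rho> (h k) (h k')"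
      using that(2) unfolding lift_def by blast
    moreover have "\<forall>\<^sub>F k' in at k within L. k' \<in> L" by (simp add: eventually_at_filter)
    ultimately show ?thesis by eventually_elim (simp add: that(3) True)
  next
    case False
    then show ?thesis
      using that(1) unfolding eventually_at_topological by (intro exI[of _ "-L"]) auto
  qed
  fix k
  show "\<forall>\<^sub>F k' in at k within K1 \<union> K2. ?m k' = ?m k + \<rho> (h k) (h k')"
    unfolding at_within_union eventually_sup
    using *[OF assms(1,3)] *[OF assms(2,4)] eq by auto
qed

lemma liftable_Un:
  assumes "closed K1" "closed K2" "lift h K1 m1" "lift h K2 m2"
    "connected (K1 \<inter> K2)" "K1 \<inter> K2 \<noteq> {}"
  shows "\<exists>m. lift h (K1 \<union> K2) m"
proof -
  obtain q where q: "q \<in> K1 \<inter> K2" using assms by blast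
  define m where "m = (\<lambda>k. m2 k + (m1 q - m2 q))"
  have m: "lift h K2 m" unfolding m_def by (rule lift_shift[OF assms(4)])
  have "m1 k = m k" if "k \<in> K1" "k \<in> K2" for k
    by (rule lift_unique[OF assms(5) lift_subset[OF assms(3)] lift_subset[OF m] q])
       (use that in \<open>auto simp: m_def\<close>)
  then show ?thesis using lift_glue[OF assms(1,2,3) m] by blast
qed

text \<open>A Lebesgue number makes each cell of a fine grid small enough for
  \<open>lift_small\<close>. Cells are joined into rows and rows into the square; the pieces always
  meet in a segment, which is connected, as gluing demands.\<close>

lemma lift_square:
  fixes h :: "real \<times> real \<Rightarrow> 'a"
  assumes h: "continuous_on ({0..1} \<times> {0..1}) h" "h ` ({0..1} \<times> {0..1}) \<subseteq> S"
  obtains m where "lift h ({0..1} \<times> {0..1}) m"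
proof -
  define Q where "Q = {0..1::real} \<times> {0..1::real}"
  have hQ: "continuous_on Q h" "h ` Q \<subseteq> S" using h by (simp_all add: Q_def)
  have "\<exists>G. open G \<and> k \<in> G \<and> (\<forall>k'\<in>Q. k' \<in> G \<longrightarrow> h k' \<in> B (h k))" if "k \<in> Q" for k
  proof -
    have "h k \<in> S" using that hQ(2) by blast
    then have "open (B (h k))" "h k \<in> B (h k)" using open_B mem_B by auto
    then show ?thesis
      by (rule hQ(1)[unfolded continuous_on_topological, rule_format, OF that])
  qed
  then obtain G where G: "\<And>k. k \<in> Q \<Longrightarrow> open (G k)" "\<And>k. k \<in> Q \<Longrightarrow> k \<in> G k"
      "\<And>k k'. k \<in> Q \<Longrightarrow> k' \<in> Q \<Longrightarrow> k' \<in> G k \<Longrightarrow> h k' \<in> B (h k)"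
    by metis
  have "compact Q" unfolding Q_def by (intro compact_Times) auto
  moreover have "G ` Q \<noteq> {}" by (auto simp: Q_def)
  moreover have "Q \<subseteq> \<Union> (G ` Q)" using G(2) by blast
  moreover have "open D" if "D \<in> G ` Q" for D using that G(1) by blast
  ultimately have "\<exists>\<delta>>0. \<forall>T. T \<subseteq> Q \<longrightarrow> diameter T < \<delta> \<longrightarrow> (\<exists>D\<in>G ` Q. T \<subseteq> D)"
    by (rule Lebesgue_number_lemma) auto
  then obtain \<delta> where \<delta>: "\<delta> > 0" "\<And>T. T \<subseteq> Q \<Longrightarrow> diameter T < \<delta> \<Longrightarrow> \<exists>D\<in>G ` Q. T \<subseteq> D"
    by auto
  have small: "\<exists>m. lift h T m" if T: "T \<subseteq> Q" "diameter T < \<delta>" for T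
  proof -
    have "\<exists>D\<in>G ` Q. T \<subseteq> D" by (rule \<delta>(2)[OF T])
    then obtain k where k: "k \<in> Q" "T \<subseteq> G k" by auto
    then have "h ` T \<subseteq> B (h k)" using G(3)[OF k(1)] T(1) by blast
    moreover have "continuous_on T h" using hQ(1) T(1) continuous_on_subset by blast
    moreover have "h k \<in> S" "h ` T \<subseteq> S" using hQ(2) k T(1) by auto
    ultimately show ?thesis using lift_small by blast
  qed
  \<comment> \<open>\<open>2 / real n\<close> bounds the diameter of a grid cell, each coordinate
    contributing at most \<open>1 / real n\<close>.\<close>
  obtain n :: nat where n: "n > 0" "2 / real n < \<delta>"
  proof -
    obtain n :: nat where "2 / \<delta> < real n" using reals_Archimedean2 by blast
    moreover from this have "n > 0" using \<delta>(1) by (metis divide_pos_pos gr0I less_asym of_nat_0 zero_less_numeral)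
    ultimately show ?thesis using that \<delta>(1) by (simp add: field_simps)
  qed
  define t where "t = (\<lambda>i::nat. real i / real n)"
  have t: "0 \<le> t i" "t i \<le> t (Suc i)" "t (Suc i) - t i = 1 / real n" for i
    using n by (auto simp: t_def field_simps)
  have t1: "t i \<le> 1" if "i \<le> n" for i using that n by (simp add: t_def)
  have cell: "\<exists>m. lift h ({t i..t (Suc i)} \<times> {t j..t (Suc j)}) m" if "i < n" "j < n" for i j
  proof (rule small)
    show "{t i..t (Suc i)} \<times> {t j..t (Suc j)} \<subseteq> Q" unfolding Q_def
      using t(1)[of i] t(1)[of j] t1[of "Suc i"] t1[of "Suc j"] that
      by (intro Sigma_mono) (auto simp: subset_iff intro: order_trans)
    have "diameter ({t i..t (Suc i)} \<times> {t j..t (Suc j)}) \<le> 2 / real n"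
    proof (rule diameter_le)
      fix x y assume xy: "x \<in> {t i..t (Suc i)} \<times> {t j..t (Suc j)}" "y \<in> {t i..t (Suc i)} \<times> {t j..t (Suc j)}"
      have "norm (x - y) \<le> \<bar>fst x - fst y\<bar> + \<bar>snd x - snd y\<bar>"
        using norm_Pair_le[of "fst x - fst y" "snd x - snd y"] by (simp add: minus_prod_def)
      moreover have "\<bar>fst x - fst y\<bar> \<le> 1 / real n" "\<bar>snd x - snd y\<bar> \<le> 1 / real n"
        using xy t(3)[of i] t(3)[of j] by (auto simp: mem_Times_iff)
      ultimately show "norm (x - y) \<le> 2 / real n" by simp
    qed (use n t in auto)
    then show "diameter ({t i..t (Suc i)} \<times> {t j..t (Suc j)}) < \<delta>" using n by linarith
  qed
  have row: "\<exists>m. lift h ({t 0..t i} \<times> {t j..t (Suc j)}) m" if "i \<le> n" "j < n" for i j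
    using that
  proof (induction i)
    case 0
    then show ?case using cell[of 0 j] lift_subset t(2)[of 0]
      by (metis Sigma_mono atLeastatMost_subset_iff n(1) order_refl)
  next
    case (Suc i)
    have i: "t 0 \<le> t i" using t(1)[of i] by (simp add: t_def)
    have "{t 0..t (Suc i)} \<times> {t j..t (Suc j)}
        = {t 0..t i} \<times> {t j..t (Suc j)} \<union> {t i..t (Suc i)} \<times> {t j..t (Suc j)}"
      using i t(2)[of i] by auto
    moreover have "({t 0..t i} \<times> {t j..t (Suc j)}) \<inter> ({t i..t (Suc i)} \<times> {t j..t (Suc j)}) = {t i} \<times> {t j..t (Suc j)}"
      using i t(2)[of i] by auto
    moreover have "connected ({t i} \<times> {t j..t (Suc j)})" "{t i} \<times> {t j..t (Suc j)} \<noteq> {}"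
      using t(2)[of j] by (auto intro: connected_Times)
    ultimately show ?case
      using liftable_Un[of "{t 0..t i} \<times> {t j..t (Suc j)}" "{t i..t (Suc i)} \<times> {t j..t (Suc j)}" h] Suc cell[of i j]
      by (auto simp: closed_Times)
  qed
  have "\<exists>m. lift h ({t 0..t n} \<times> {t 0..t j}) m" if "j \<le> n" for j
    using that
  proof (induction j)
    case 0
    then show ?case using row[of n 0] lift_subset t(2)[of 0]
      by (metis Sigma_mono atLeastatMost_subset_iff n(1) order_refl)
  next
    case (Suc j)
    have i: "t 0 \<le> t j" "t 0 \<le> t n" using t(1)[of j] t(1)[of n] by (auto simp: t_def)
    have "{t 0..t n} \<times> {t 0..t (Suc j)} = {t 0..t n} \<times> {t 0..t j} \<union> {t 0..t n} \<times> {t j..t (Suc j)}"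
      using i t(2)[of j] by auto
    moreover have "({t 0..t n} \<times> {t 0..t j}) \<inter> ({t 0..t n} \<times> {t j..t (Suc j)}) = {t 0..t n} \<times> {t j}"
      using i t(2)[of j] by auto
    moreover have "connected ({t 0..t n} \<times> {t j})" "{t 0..t n} \<times> {t j} \<noteq> {}"
      using i by (auto intro: connected_Times)
    ultimately show ?case
      using liftable_Un[of "{t 0..t n} \<times> {t 0..t j}" "{t 0..t n} \<times> {t j..t (Suc j)}" h] Suc row[of n j]
      by (auto simp: closed_Times)
  qed
  from this[of n] show ?thesis using that n by (auto simp: t_def)
qed

definition path_shift :: "(real \<Rightarrow> 'a) \<Rightarrow> 'g \<Rightarrow> bool" where
  "path_shift p v \<longleftrightarrow> (\<exists>m. lift p {0..1} m \<and> m 0 = 0 \<and> m 1 = v)"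

lemma path_shift_unique: "path_shift p v \<Longrightarrow> path_shift p w \<Longrightarrow> v = w"
  unfolding path_shift_def using lift_unique[of "{0..1::real}" p] by fastforce

text \<open>A lift over the square of the homotopy restricts to lifts of both paths. Along the two
  sides where the homotopy fixes the end points the lift is constant, so both paths have the same
  total increment.\<close>

lemma path_shift_homotopic:
  assumes "homotopic_paths S p q"
  obtains v where "path_shift p v" "path_shift q v"
proof -
  let ?I = "{0..1::real}"
  obtain h where h: "continuous_on (?I \<times> ?I) h" "h ` (?I \<times> ?I) \<subseteq> S"
    "\<And>x. x \<in> ?I \<Longrightarrow> h (0,x) = p x" "\<And>x. x \<in> ?I \<Longrightarrow> h (1,x) = q x"
    "\<And>t. t \<in> ?I \<Longrightarrow> h (t,0) = p 0" "\<And>t. t \<in> ?I \<Longrightarrow> h (t,1) = p 1"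
    using assms unfolding homotopic_paths by (auto simp: pathstart_def pathfinish_def image_subset_iff Pi_iff)
  obtain m where "lift h (?I \<times> ?I) m" using lift_square h(1,2) by blast
  then have "lift h (?I \<times> ?I) (\<lambda>k. m k + (- m (0,0)))" by (rule lift_shift)
  then obtain m where m: "lift h (?I \<times> ?I) m" "m (0,0) = 0" by force
  have side: "lift (h \<circ> f) ?I (m \<circ> f)" if "continuous_on ?I f" "f ` ?I \<subseteq> ?I \<times> ?I" for f :: "real \<Rightarrow> _"
    by (rule lift_compose[OF m(1) that h(2)])
  \<comment> \<open>A constant function is a lift of a constant path because
    \<open>\<rho> z z = 0\<close>, and lifts with equal initial value coincide.\<close>
  have const: "m (t,y) = m (0,y)" if "t \<in> ?I" "y \<in> ?I" "\<And>t. t \<in> ?I \<Longrightarrow> h (t,y) = h (0,y)" for t y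
  proof -
    have S: "h (0,y) \<in> S" using h(2) that(2) by auto
    have "lift (h \<circ> (\<lambda>t. (t,y))) ?I (m \<circ> (\<lambda>t. (t,y)))"
      by (rule side) (use that in \<open>auto intro!: continuous_intros\<close>)
    moreover have "lift (h \<circ> (\<lambda>t. (t,y))) ?I (\<lambda>_. m (0,y))"
      unfolding lift_def
    proof
      fix k assume k: "k \<in> ?I"
      have "\<forall>\<^sub>F k' in at k within ?I. k' \<in> ?I" by (simp add: eventually_at_filter)
      then show "\<forall>\<^sub>F k' in at k within ?I. m (0,y) = m (0,y) + \<rho> ((h \<circ> (\<lambda>t. (t,y))) k) ((h \<circ> (\<lambda>t. (t,y))) k')"
      proof eventually_elim
        case (elim k')
        then show ?case using cocycle_refl[OF S] k that(3)[of k] that(3)[of k'] by simp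
      qed
    qed
    ultimately show ?thesis
      using lift_unique[of ?I "h \<circ> (\<lambda>t. (t,y))" "m \<circ> (\<lambda>t. (t,y))" "\<lambda>_. m (0,y)" 0 t] that by auto
  qed
  have "lift p ?I (\<lambda>t. m (0,t))"
    by (rule lift_cong[OF side[of "Pair 0"]]) (auto intro!: continuous_intros h)
  moreover have "lift q ?I (\<lambda>t. m (1,t))"
    by (rule lift_cong[OF side[of "Pair 1"]]) (auto intro!: continuous_intros h)
  moreover have "m (1,0) = m (0,0)" "m (1,1) = m (0,1)" by (auto intro!: const simp: h)
  ultimately show ?thesis using that[of "m (0,1)"] m(2) unfolding path_shift_def by metis
qed

lemma path_shift_exists:
  assumes "path p" "path_image p \<subseteq> S" obtains v where "path_shift p v"
  using assms path_shift_homotopic homotopic_paths_refl by metis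

text \<open>The appended path stays in one neighbourhood \<open>B (pathstart q)\<close>, so its lift
  is explicit. It only has to be started at the value \<open>v\<close> reached by
  \<open>p\<close>.\<close>

lemma path_shift_join:
  assumes p: "path_shift p v" and q: "path q" "path_image q \<subseteq> S" "path_image q \<subseteq> B (pathstart q)"
    and pq: "pathfinish p = pathstart q" and pS: "path_image p \<subseteq> S"
  shows "path_shift (p +++ q) (v + \<rho> (pathstart q) (pathfinish q))"
proof -
  obtain m where m: "lift p {0..1} m" "m 0 = 0" "m 1 = v" using p unfolding path_shift_def by blast
  have S: "pathstart q \<in> S" using q by auto
  have 1: "lift (p +++ q) {0..1/2} (\<lambda>t. m (2 * t))"
    by (rule lift_cong[OF lift_compose[OF m(1), of "{0..1/2}" "(*) 2"]])
       (use pS in \<open>auto intro!: continuous_intros simp: joinpaths_def path_image_def\<close>)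
  have q': "lift q {0..1} (\<lambda>t. v + \<rho> (pathstart q) (q t))"
    by (rule lift_small) (use q S in \<open>auto simp: path_def path_image_def\<close>)
  have c0: "\<rho> (pathstart q) (pathstart q) = 0" by (rule cocycle_refl[OF S])
  have pq1: "p 1 = q 0" "pathstart q = q 0" using pq by (auto simp: pathfinish_def pathstart_def)
  \<comment> \<open>At the parameter 1/2 the joined path is defined by the branch of
    \<open>p\<close>; there the two branches agree by \<open>pq\<close>.\<close>
  have 2: "lift (p +++ q) {1/2..1} (\<lambda>t. v + \<rho> (pathstart q) (q (2 * t - 1)))"
  proof (rule lift_cong[OF lift_compose[OF q', of "{1/2..1}" "\<lambda>t. 2 * t - 1"]])
    show "(q \<circ> (\<lambda>t. 2 * t - 1)) k = (p +++ q) k" if "k \<in> {1/2..1}" for k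
    proof (cases "k = 1/2")
      case False then show ?thesis using that by (simp add: joinpaths_def)
    next
      case True then have "2 * k = 1" by simp
      then show ?thesis by (simp add: joinpaths_def pq1(1))
    qed
  qed (use q in \<open>auto intro!: continuous_intros simp: path_image_def\<close>)
  have "lift (p +++ q) ({0..1/2} \<union> {1/2..1})
     (\<lambda>t. if t \<in> {0..1/2} then m (2 * t) else v + \<rho> (pathstart q) (q (2 * t - 1)))"
    proof (rule lift_glue[OF _ _ 1 2])
    fix t :: real assume "t \<in> {0..1/2}" "t \<in> {1/2..1}"
    then have "2 * t = 1" by simp
    then show "m (2 * t) = v + \<rho> (pathstart q) (q (2 * t - 1))" using m c0 pq1 by simp
  qed auto
  moreover have "{0..1/2} \<union> {1/2..1} = {0..1::real}" by auto
  ultimately show ?thesis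
    unfolding path_shift_def using m by (force simp: pathfinish_def)
qed

text \<open>\<open>C x\<close> is the total increment along a chosen path from a base point to
  \<open>x\<close>. For \<open>y\<close> near \<open>x\<close>, the path to \<open>x\<close>
  followed by a segment is homotopic to the chosen path to \<open>y\<close>, and the segment
  contributes \<open>\<rho> x y\<close>.\<close>

theorem simply_connected_coboundary:
  assumes "open S" "simply_connected S"
  shows "\<exists>C. \<forall>x\<in>S. \<exists>\<epsilon>>0. ball x \<epsilon> \<subseteq> S \<inter> B x \<and> (\<forall>y\<in>ball x \<epsilon>. C y = C x + \<rho> x y)"
proof (cases "S = {}")
  case True then show ?thesis by blast
next
  case False
  then obtain a where a: "a \<in> S" by blast
  define good where "good = (\<lambda>x p. path p \<and> path_image p \<subseteq> S \<and> pathstart p = a \<and> pathfinish p = x)"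
  define p where "p = (\<lambda>x. SOME q. good x q)"
  have "good x (p x)" if x: "x \<in> S" for x
  proof -
    have "\<exists>q. good x q"
      using simply_connected_imp_path_connected[OF assms(2), unfolded path_connected_def, rule_format, OF a x]
      by (simp only: good_def)
    then show ?thesis unfolding p_def by (rule someI_ex)
  qed
  then have p: "path (p x)" "path_image (p x) \<subseteq> S" "pathstart (p x) = a" "pathfinish (p x) = x"
    if "x \<in> S" for x using that by (auto simp: good_def)
  define C where "C = (\<lambda>x. SOME v. path_shift (p x) v)"
  have C: "path_shift (p x) (C x)" if x: "x \<in> S" for x
  proof -
    obtain v where "path_shift (p x) v" by (rule path_shift_exists[OF p(1,2)[OF x]])
    then show ?thesis unfolding C_def by (rule someI)
  qed
  show ?thesis
  proof (intro exI[of _ C] ballI)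
    fix x assume x: "x \<in> S"
    then have "open (S \<inter> B x)" "x \<in> S \<inter> B x" using assms(1) open_B mem_B by auto
    then obtain \<epsilon> where \<epsilon>: "\<epsilon> > 0" "ball x \<epsilon> \<subseteq> S \<inter> B x" using openE by blast
    have "C y = C x + \<rho> x y" if y: "y \<in> ball x \<epsilon>" for y
    proof -
      have im: "path_image (linepath x y) \<subseteq> ball x \<epsilon>"
        using \<epsilon>(1) y closed_segment_subset[of x "ball x \<epsilon>" y] by simp
      have yS: "y \<in> S" using y \<epsilon> by blast
      have 1: "path_shift (p x +++ linepath x y) (C x + \<rho> x y)"
        using path_shift_join[OF C[OF x], of "linepath x y"] im \<epsilon>(2) p[OF x] yS
        by (simp add: subset_iff path_image_def image_iff)
      have "homotopic_paths S (p x +++ linepath x y) (p y)"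
        using assms(2) p[OF x] p[OF yS] im \<epsilon>(2) unfolding simply_connected_eq_homotopic_paths
        by (auto simp: path_image_join)
      then obtain v where "path_shift (p x +++ linepath x y) v" "path_shift (p y) v"
        by (rule path_shift_homotopic)
      then show ?thesis using path_shift_unique[OF _ 1] path_shift_unique[OF _ C[OF yS]] by simp
    qed
    then show "\<exists>\<epsilon>>0. ball x \<epsilon> \<subseteq> S \<inter> B x \<and> (\<forall>y\<in>ball x \<epsilon>. C y = C x + \<rho> x y)" using \<epsilon> by blast
  qed
qed

end

subsection \<open>Gluing local displacements\<close>

lemma continuous_AE_eq:
  fixes f g :: "real^3 \<Rightarrow> real^3"
  assumes "open D" "continuous_on D f" "continuous_on D g" "AE x in lebesgue_on D. f x = g x" "y \<in> D"
  shows "f y = g y"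
proof (rule ccontr)
  assume ne: "f y \<noteq> g y"
  define E where "E = D \<inter> (\<lambda>x. f x - g x) -` (- {0})"
  have E: "open E" unfolding E_def
    by (rule continuous_open_preimage) (use assms in \<open>auto intro: continuous_on_diff\<close>)
  have "AE x in lebesgue_on E. f x = g x"
    by (rule AE_lebesgue_on_subset[OF assms(4)]) (use assms(1) E in \<open>auto simp: E_def\<close>)
  moreover have "AE x in lebesgue_on E. x \<in> E" using AE_space[of "lebesgue_on E"] by simp
  ultimately have "AE x in lebesgue_on E. False" by eventually_elim (simp add: E_def)
  moreover have "E \<noteq> {}" using ne assms(5) by (auto simp: E_def)
  ultimately show False using AE_lebesgue_on_open_nonempty[OF _ E] by blast
qed

text \<open>Every piece is rigid with its own skew matrix, so the symmetrised weak gradient of the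
  whole field is zero and \<open>rigid_imp_affine\<close> supplies one matrix for all pieces.
  Continuity upgrades the almost everywhere identity to every point.\<close>

lemma piecewise_rigid_imp_rigid:
  fixes D :: "(real^3) set" and d :: "real^3 \<Rightarrow> real^3"
  assumes D: "open D" "convex D" "bounded D" "D \<subseteq> \<Union>\<S>" "finite \<S>"
    and cl: "\<And>T. T \<in> \<S> \<Longrightarrow> closed T" and cv: "\<And>T. T \<in> \<S> \<Longrightarrow> convex T"
    and aff: "\<And>T. T \<in> \<S> \<Longrightarrow> \<exists>W b. transpose W = - W \<and> (\<forall>y\<in>T \<inter> D. d y = W *v y + b)"
  obtains W b where "transpose W = - W" "\<And>y. y \<in> D \<Longrightarrow> d y = W *v y + b"
proof -
  interpret bounded_open D by unfold_locales (rule D)+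
  obtain W b where Wb: "\<And>T. T \<in> \<S> \<Longrightarrow> transpose (W T) = - W T \<and> (\<forall>y\<in>T \<inter> D. d y = W T *v y + b T)"
    using aff by metis
  then have affd: "d x = W T *v x + b T" if "T \<in> \<S>" "x \<in> T \<inter> D" for T x using that by blast
  have pw: "d \<in> H1 D" "AE x in lebesgue_on D. \<forall>T\<in>\<S>. x \<in> T \<longrightarrow> weak_grad D d x = W T"
    by (rule piecewise_affine_H1[OF D(5) cl cv D(4) affd]; assumption)+
  have "AE x in lebesgue_on D. x \<in> D" using AE_space[of "lebesgue_on D"] by simp
  with pw(2) have "AE x in lebesgue_on D. sym_grad D d x = 0"
  proof eventually_elim
    case (elim x)
    then obtain T where T: "T \<in> \<S>" "x \<in> T" using D(4) by blast
    then have "weak_grad D d x = W T" using elim by blast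
    then show ?case using Wb[OF T(1)] by (simp add: sym_grad_def)
  qed
  then obtain W0 b0 where W0: "transpose W0 = - W0" "AE x in lebesgue_on D. d x = W0 *v x + b0"
    by (rule rigid_imp_affine[OF convex_connected[OF D(2)] pw(1)])
  have "continuous_on D d"
  proof (rule continuous_on_piecewise[OF D(5) cl D(4)])
    fix T assume T: "T \<in> \<S>"
    show "continuous_on (T \<inter> D) d"
      by (rule continuous_on_eq[of _ "\<lambda>x. W T *v x + b T"])
         (use affd[OF T] in \<open>auto intro!: continuous_intros matrix_vector_mult_linear_continuous_on\<close>)
  qed
  moreover have "continuous_on D (\<lambda>x. W0 *v x + b0)"
    by (intro continuous_intros matrix_vector_mult_linear_continuous_on)
  ultimately have "d y = W0 *v y + b0" if "y \<in> D" for y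
    using continuous_AE_eq[OF D(1) _ _ W0(2) that] by blast
  with W0(1) show ?thesis by (rule that)
qed

section \<open>Symmetric and skew parts, rigid displacement fields\<close>

definition sym_part :: "real^3^3 \<Rightarrow> real^3^3" where "sym_part A = (1/2) *\<^sub>R (transpose A + A)"

definition skew_part :: "real^3^3 \<Rightarrow> real^3^3" where "skew_part A = (1/2) *\<^sub>R (A - transpose A)"

lemma transpose_diff: "transpose (A - B :: real^3^3) = transpose A - transpose B"
  by (simp add: transpose_def vec_eq_iff)

lemma sym_part_eq_imp_skew_diff:
  assumes "sym_part A = sym_part B" shows "transpose (A - B) = - (A - B)"
proof -
  have "transpose A + A = transpose B + B" using assms unfolding sym_part_def by (simp only: scaleR_cancel_left) simp
  then have "transpose A = transpose B + B - A" by (simp add: eq_diff_eq)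
  then show ?thesis by (simp add: transpose_diff)
qed

lemma sym_part_add_skew_part: "sym_part (A + skew_part B) = sym_part A"
  by (simp add: sym_part_def skew_part_def vec_eq_iff transpose_def field_simps)

lemma skew_part_skew: "transpose W = - W \<Longrightarrow> skew_part W = W"
  by (simp add: skew_part_def vec_eq_iff)

lemma skew_part_add: "skew_part (A + B) = skew_part A + skew_part B"
  by (simp add: skew_part_def vec_eq_iff transpose_def field_simps)

text \<open>Projecting to the skew part lets every pair act as a rigid field. The cocycle can then
  take values in the full product type, which is an additive group.\<close>

definition rigid_action :: "(real^3^3) \<times> (real^3) \<Rightarrow> real^3 \<Rightarrow> real^3" where
  "rigid_action p y = skew_part (fst p) *v y + snd p"

lemma rigid_action_add: "rigid_action (p + q) y = rigid_action p y + rigid_action q y"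
  by (simp add: rigid_action_def skew_part_add matrix_vector_mult_add_rdistrib)

section \<open>Geometry of the mesh\<close>

locale mesh =
  fixes \<Omega> :: "(real^3) set" and \<T> :: "(real^3) set set"
  assumes domain: "domain3 \<Omega>" and mesh: "tetrahedral_mesh \<Omega> \<T>"

sublocale mesh \<subseteq> lipschitz_domain \<Omega>
  using domain by unfold_locales (auto simp: domain3_def)

sublocale mesh \<subseteq> bounded_open \<Omega>
  by unfold_locales (rule open_domain bounded_domain)+

context mesh
begin

lemma connected_domain: "connected \<Omega>" using domain by (simp add: domain3_def)

lemma finite_mesh: "finite \<T>" using mesh by (simp add: tetrahedral_mesh_def triangulation_def)

lemma Union_mesh: "\<Union>\<T> = closure \<Omega>" using mesh by (simp add: tetrahedral_mesh_def)

lemma domain_subset_mesh: "\<Omega> \<subseteq> \<Union>\<T>" using Union_mesh closure_subset by blast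

lemma cell_simplex: "T \<in> \<T> \<Longrightarrow> 3 simplex T" using mesh by (simp add: tetrahedral_mesh_def)

lemma cell_face: "T \<in> \<T> \<Longrightarrow> T' \<in> \<T> \<Longrightarrow> T \<inter> T' face_of T"
  using mesh by (simp add: tetrahedral_mesh_def triangulation_def)

lemma cell_compact: "T \<in> \<T> \<Longrightarrow> compact T" and cell_convex: "T \<in> \<T> \<Longrightarrow> convex T"
  using cell_simplex simplex_imp_polytope polytope_imp_compact polytope_imp_convex by blast+

lemma cell_closed: "T \<in> \<T> \<Longrightarrow> closed T" using cell_compact compact_imp_closed by blast

lemma cell_interior_nonempty:
  assumes "T \<in> \<T>" shows "interior T \<noteq> {}"
proof -
  obtain C where C: "\<not> affine_dependent C" "int (card C) = 3 + 1" "T = convex hull C"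
    using cell_simplex[OF assms] unfolding simplex by auto
  then have "card C = Suc (DIM(real^3))" by simp
  then show ?thesis using interior_convex_hull_eq_empty[of C] C by simp
qed

lemma closure_interior_cell: "T \<in> \<T> \<Longrightarrow> closure (interior T) = T"
  using convex_closure_interior[OF cell_convex cell_interior_nonempty] cell_closed by (simp add: closure_closed)

lemma interior_cell_subset: "T \<in> \<T> \<Longrightarrow> interior T \<subseteq> \<Omega>"
  using interior_closure_domain interior_mono[of T "closure \<Omega>"] Union_mesh by blast

text \<open>A cell is the closure of its interior. Near each of its points there is thus an open
  piece of the cell, on which affine maps can be compared.\<close>

lemma cell_meets_ball:
  assumes "T \<in> \<T>" "x \<in> T" "open V" "x \<in> V" shows "interior T \<inter> V \<noteq> {}"
  using closure_interior_cell[OF assms(1)] assms open_Int_closure_eq_empty[OF assms(3), of "interior T"] by blast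

text \<open>Interiors of cells lie in \<open>\<Omega>\<close>, so boundary points can only be on
  cell frontiers. This will bound the area of the boundary.\<close>

lemma frontier_subset: "frontier \<Omega> \<subseteq> (\<Union>T\<in>\<T>. frontier T)"
proof
  fix x assume x: "x \<in> frontier \<Omega>"
  then obtain T where T: "T \<in> \<T>" "x \<in> T" using Union_mesh by (auto simp: frontier_def)
  have "x \<notin> \<Omega>" using x open_domain by (simp add: frontier_def interior_open)
  then have "x \<notin> interior T" using interior_cell_subset[OF T(1)] by blast
  then show "x \<in> (\<Union>T\<in>\<T>. frontier T)" using T cell_closed[OF T(1)] by (auto simp: frontier_def intro!: bexI[of _ T])
qed

lemma near_cells: "\<exists>r>0. \<forall>T\<in>\<T>. T \<inter> ball x r \<noteq> {} \<longrightarrow> x \<in> T"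
proof -
  have "closed (\<Union>{T \<in> \<T>. x \<notin> T})" using finite_mesh cell_closed by (intro closed_Union) auto
  then have "open (- \<Union>{T \<in> \<T>. x \<notin> T})" by (rule open_Compl)
  moreover have "x \<in> - \<Union>{T \<in> \<T>. x \<notin> T}" by auto
  ultimately obtain r where "r > 0" "ball x r \<subseteq> - \<Union>{T \<in> \<T>. x \<notin> T}" by (rule openE)
  then show ?thesis by (intro exI[of _ r]) blast
qed

text \<open>By conformity the intersection of all cells containing \<open>x\<close> is a face of
  each of them. It is nonempty, compact and convex, and an extreme point of it is a vertex of all
  these cells.\<close>

lemma common_vertex:
  assumes "x \<in> closure \<Omega>"
  shows "\<exists>a\<in>mesh_vertices \<T>. \<forall>T\<in>\<T>. x \<in> T \<longrightarrow> a extreme_point_of T"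
proof -
  let ?X = "{T \<in> \<T>. x \<in> T}"
  obtain T0 where T0: "T0 \<in> \<T>" "x \<in> T0" using assms Union_mesh by blast
  define F where "F = \<Inter>?X"
  have xF: "x \<in> F" by (auto simp: F_def)
  have face: "F face_of T" if T: "T \<in> \<T>" "x \<in> T" for T
  proof -
    have "\<Inter>((\<lambda>T'. T \<inter> T') ` ?X) face_of T"
      by (rule face_of_Inter) (use T cell_face in auto)
    moreover have "\<Inter>((\<lambda>T'. T \<inter> T') ` ?X) = F" using T by (auto simp: F_def)
    ultimately show ?thesis by simp
  qed
  have "compact F" "convex F"
    using face[OF T0] face_of_imp_compact[OF cell_convex[OF T0(1)] cell_compact[OF T0(1)]] face_of_imp_convex by blast+
  then obtain a where a: "a extreme_point_of F" using xF extreme_point_exists_convex by blast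
  then have ext: "a extreme_point_of T" if "T \<in> \<T>" "x \<in> T" for T
    using face[OF that] by (meson face_of_singleton face_of_trans)
  show ?thesis by (rule bexI[of _ a]) (use ext T0 in \<open>auto simp: mesh_vertices_def\<close>)
qed

text \<open>\<open>C\<close> prescribes one strain per cell. Only the symmetric part of each matrix
  is fixed; the free skew part and translation are the rigid ambiguity to be removed by
  gluing.\<close>

definition is_displacement :: "((real^3) set \<Rightarrow> real^3^3) \<Rightarrow> (real^3) set \<Rightarrow> (real^3 \<Rightarrow> real^3) \<Rightarrow> bool" where
  "is_displacement C D v \<longleftrightarrow>
     (\<forall>T\<in>\<T>. T \<inter> D \<noteq> {} \<longrightarrow> (\<exists>A b. sym_part A = C T \<and> (\<forall>y\<in>T \<inter> D. v y = A *v y + b)))"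

lemma is_displacementD:
  "is_displacement C D v \<Longrightarrow> T \<in> \<T> \<Longrightarrow> T \<inter> D \<noteq> {} \<Longrightarrow> \<exists>A b. sym_part A = C T \<and> (\<forall>y\<in>T \<inter> D. v y = A *v y + b)"
  by (simp add: is_displacement_def)

lemma is_displacement_subset: "is_displacement C D v \<Longrightarrow> D' \<subseteq> D \<Longrightarrow> is_displacement C D' v"
  unfolding is_displacement_def
proof (intro ballI impI)
  fix T assume *: "\<forall>T\<in>\<T>. T \<inter> D \<noteq> {} \<longrightarrow> (\<exists>A b. sym_part A = C T \<and> (\<forall>y\<in>T \<inter> D. v y = A *v y + b))"
    "D' \<subseteq> D" "T \<in> \<T>" "T \<inter> D' \<noteq> {}"
  then have "T \<inter> D \<noteq> {}" by blast
  then obtain A b where "sym_part A = C T" "\<forall>y\<in>T \<inter> D. v y = A *v y + b" using * by blast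
  then show "\<exists>A b. sym_part A = C T \<and> (\<forall>y\<in>T \<inter> D'. v y = A *v y + b)" using *(2) by blast
qed

lemma displacement_difference:
  assumes D: "open D" "convex D" "D \<subseteq> \<Omega>" and v: "is_displacement C D v" and w: "is_displacement C D w"
  shows "\<exists>W b. transpose W = - W \<and> (\<forall>y\<in>D. v y - w y = W *v y + b)"
proof -
  have b: "bounded D" using D(3) bounded_domain bounded_subset by blast
  show ?thesis
  proof (rule piecewise_rigid_imp_rigid[OF D(1,2) b, of "{T \<in> \<T>. T \<inter> D \<noteq> {}}" "\<lambda>y. v y - w y"])
    show "D \<subseteq> \<Union>{T \<in> \<T>. T \<inter> D \<noteq> {}}" using D(3) domain_subset_mesh by blast
    show "finite {T \<in> \<T>. T \<inter> D \<noteq> {}}" using finite_mesh by simp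
    fix T assume "T \<in> {T \<in> \<T>. T \<inter> D \<noteq> {}}"
    then have T: "T \<in> \<T>" "T \<inter> D \<noteq> {}" by auto
    show "closed T" "convex T" using T cell_closed cell_convex by auto
    obtain A b where A: "sym_part A = C T" "\<forall>y\<in>T \<inter> D. v y = A *v y + b"
      using is_displacementD[OF v T] by blast
    obtain A' b' where A': "sym_part A' = C T" "\<forall>y\<in>T \<inter> D. w y = A' *v y + b'"
      using is_displacementD[OF w T] by blast
    have "transpose (A - A') = - (A - A')" by (rule sym_part_eq_imp_skew_diff) (simp add: A A')
    moreover have "\<forall>y\<in>T \<inter> D. v y - w y = (A - A') *v y + (b - b')"
      using A(2) A'(2) by (auto simp: matrix_vector_mult_diff_rdistrib)
    ultimately show "\<exists>W b. transpose W = - W \<and> (\<forall>y\<in>T \<inter> D. v y - w y = W *v y + b)" by blast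
  qed blast
qed

text \<open>The jump \<open>\<rho> x y\<close> is the rigid field by which the displacement chosen
  at \<open>x\<close> exceeds the one chosen at \<open>y\<close>. Once it is a coboundary, adding
  the rigid field \<open>K x\<close> to the displacement at \<open>x\<close> makes the choices
  compatible.\<close>

lemma displacement_coboundary:
  assumes sc: "simply_connected \<Omega>"
    and r: "\<And>x. x \<in> \<Omega> \<Longrightarrow> r x > 0 \<and> ball x (r x) \<subseteq> \<Omega>"
    and v: "\<And>x. x \<in> \<Omega> \<Longrightarrow> is_displacement C (ball x (r x)) (v x)"
  shows "\<exists>u. \<forall>x\<in>\<Omega>. \<exists>\<epsilon>>0. ball x \<epsilon> \<subseteq> \<Omega> \<and> is_displacement C (ball x \<epsilon>) u"
proof -
  define B where "B = (\<lambda>x. ball x (r x))"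
  define P where "P = (\<lambda>x y p. transpose (fst p) = - fst p \<and> (\<forall>z\<in>B x \<inter> B y. v x z - v y z = fst p *v z + snd p))"
  define \<rho> where "\<rho> = (\<lambda>x y. SOME p. P x y p)"
  have \<rho>: "P x y (\<rho> x y)" if xy: "x \<in> \<Omega>" "y \<in> \<Omega>" for x y
  proof -
    have "open (B x \<inter> B y)" "convex (B x \<inter> B y)" "B x \<inter> B y \<subseteq> \<Omega>"
      using r[OF xy(1)] by (auto simp: B_def convex_Int)
    moreover have "is_displacement C (B x \<inter> B y) (v x)" "is_displacement C (B x \<inter> B y) (v y)"
      using v[OF xy(1)] v[OF xy(2)] is_displacement_subset unfolding B_def by blast+
    ultimately have "\<exists>W b. transpose W = - W \<and> (\<forall>z\<in>B x \<inter> B y. v x z - v y z = W *v z + b)"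
      by (rule displacement_difference)
    then obtain W b where "P x y (W, b)" by (auto simp: P_def)
    then show ?thesis unfolding \<rho>_def by (rule someI)
  qed
  then have \<rho>_skew: "transpose (fst (\<rho> x y)) = - fst (\<rho> x y)"
    and \<rho>_eq: "\<And>z. z \<in> B x \<inter> B y \<Longrightarrow> v x z - v y z = fst (\<rho> x y) *v z + snd (\<rho> x y)"
    if "x \<in> \<Omega>" "y \<in> \<Omega>" for x y using that by (auto simp: P_def)
  interpret local_cocycle \<Omega> B \<rho>
  proof
    show "open (B x)" "x \<in> B x" if "x \<in> \<Omega>" for x using r[OF that] by (auto simp: B_def)
    fix i x y assume ixy: "i \<in> \<Omega>" "x \<in> \<Omega>" "y \<in> \<Omega>" "x \<in> B i" "y \<in> B i" "y \<in> B x"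
    \<comment> \<open>The triple overlap is open and contains \<open>y\<close>. Two affine fields
      agreeing on it have the same coefficients, which is the cocycle identity.\<close>
    let ?V = "B i \<inter> B x \<inter> B y"
    have V: "open ?V" "?V \<noteq> {}" using ixy r[of y] by (auto simp: B_def)
    have "(fst (\<rho> i x) + fst (\<rho> x y)) *v z + (snd (\<rho> i x) + snd (\<rho> x y)) = fst (\<rho> i y) *v z + snd (\<rho> i y)"
      if "z \<in> ?V" for z
      using \<rho>_eq[OF ixy(1,2), of z] \<rho>_eq[OF ixy(2,3), of z] \<rho>_eq[OF ixy(1,3), of z] that
      by (simp add: matrix_vector_mult_add_rdistrib algebra_simps)
    from affine_map_unique[OF V this] show "\<rho> i x + \<rho> x y = \<rho> i y"
      by (simp add: prod_eq_iff)
  qed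
  obtain K where K: "\<And>x. x \<in> \<Omega> \<Longrightarrow> \<exists>\<epsilon>>0. ball x \<epsilon> \<subseteq> \<Omega> \<inter> B x \<and> (\<forall>y\<in>ball x \<epsilon>. K y = K x + \<rho> x y)"
    using simply_connected_coboundary[OF open_domain sc] by blast
  \<comment> \<open>Each point uses the displacement of its own ball. Around \<open>x\<close>, the
    relation \<open>K y = K x + \<rho> x y\<close> turns \<open>v y y\<close> back into
    \<open>v x y\<close>, so \<open>u\<close> is \<open>v x\<close> plus the fixed rigid field of
    \<open>K x\<close>.\<close>
  define u where "u = (\<lambda>y. v y y + rigid_action (K y) y)"
  show ?thesis
  proof (intro exI[of _ u] ballI)
    fix x assume x: "x \<in> \<Omega>"
    then obtain \<epsilon> where \<epsilon>: "\<epsilon> > 0" "ball x \<epsilon> \<subseteq> \<Omega> \<inter> B x" "\<And>y. y \<in> ball x \<epsilon> \<Longrightarrow> K y = K x + \<rho> x y"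
      using K[OF x] by blast
    have ux: "u y = v x y + rigid_action (K x) y" if y: "y \<in> ball x \<epsilon>" for y
    proof -
      have yS: "y \<in> \<Omega>" "y \<in> B x \<inter> B y" using y \<epsilon>(2) mem_B by auto
      have "rigid_action (\<rho> x y) y = v x y - v y y"
        using \<rho>_eq[OF x yS(1,2)] skew_part_skew[OF \<rho>_skew[OF x yS(1)]] by (simp add: rigid_action_def)
      then show ?thesis unfolding u_def \<epsilon>(3)[OF y] rigid_action_add by simp
    qed
    have "is_displacement C (ball x \<epsilon>) u"
      unfolding is_displacement_def
    proof (intro ballI impI)
      fix T assume T: "T \<in> \<T>" "T \<inter> ball x \<epsilon> \<noteq> {}"
      have sub: "ball x \<epsilon> \<subseteq> ball x (r x)" using \<epsilon>(2) by (auto simp: B_def)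
      then have "T \<inter> ball x (r x) \<noteq> {}" using T(2) by blast
      then obtain A b where A: "sym_part A = C T" "\<forall>y\<in>T \<inter> ball x (r x). v x y = A *v y + b"
        using is_displacementD[OF v[OF x] T(1)] by blast
      have "\<forall>y\<in>T \<inter> ball x \<epsilon>. u y = (A + skew_part (fst (K x))) *v y + (b + snd (K x))"
      proof
        fix y assume y: "y \<in> T \<inter> ball x \<epsilon>"
        then have "u y = v x y + rigid_action (K x) y" "v x y = A *v y + b" using ux A(2) sub by blast+
        then show "u y = (A + skew_part (fst (K x))) *v y + (b + snd (K x))"
          by (simp add: rigid_action_def matrix_vector_mult_add_rdistrib)
      qed
      then show "\<exists>A b. sym_part A = C T \<and> (\<forall>y\<in>T \<inter> ball x \<epsilon>. u y = A *v y + b)"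
        using A(1) sym_part_add_skew_part by metis
    qed
    then show "\<exists>\<epsilon>>0. ball x \<epsilon> \<subseteq> \<Omega> \<and> is_displacement C (ball x \<epsilon>) u" using \<epsilon> by blast
  qed
qed

text \<open>The coefficients found near each point agree for nearby points, by comparison on an open
  piece of the cell. \<open>T \<inter> \<Omega>\<close> is connected, lying between the interior of
  \<open>T\<close> and its closure.\<close>

lemma displacement_affine_on_cell:
  assumes u: "\<And>x. x \<in> \<Omega> \<Longrightarrow> \<exists>\<epsilon>>0. ball x \<epsilon> \<subseteq> \<Omega> \<and> is_displacement C (ball x \<epsilon>) u" and T: "T \<in> \<T>"
  shows "\<exists>A b. sym_part A = C T \<and> (\<forall>y\<in>T \<inter> \<Omega>. u y = A *v y + b)"
proof -
  define P where "P = (\<lambda>x (\<epsilon>, A, b). \<epsilon> > 0 \<and> sym_part A = C T \<and> (\<forall>y\<in>T \<inter> ball x \<epsilon>. u y = A *v y + b))"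
  have "\<exists>p. P x p" if x: "x \<in> T \<inter> \<Omega>" for x
  proof -
    obtain \<epsilon> where \<epsilon>: "\<epsilon> > 0" "is_displacement C (ball x \<epsilon>) u" using u[of x] x by blast
    have "T \<inter> ball x \<epsilon> \<noteq> {}" using x \<epsilon>(1) by auto
    then obtain A b where "sym_part A = C T" "\<forall>y\<in>T \<inter> ball x \<epsilon>. u y = A *v y + b"
      using is_displacementD[OF \<epsilon>(2) T] by blast
    then have "P x (\<epsilon>, A, b)" using \<epsilon>(1) by (simp add: P_def)
    then show ?thesis by blast
  qed
  then obtain p where p: "\<And>x. x \<in> T \<inter> \<Omega> \<Longrightarrow> P x (p x)" by metis
  define \<epsilon> A b where "\<epsilon> = (\<lambda>x. fst (p x))" and "A = (\<lambda>x. fst (snd (p x)))" and "b = (\<lambda>x. snd (snd (p x)))"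
  have eA: "\<epsilon> x > 0" "sym_part (A x) = C T" "\<And>y. y \<in> T \<inter> ball x (\<epsilon> x) \<Longrightarrow> u y = A x *v y + b x" if "x \<in> T \<inter> \<Omega>" for x
    using p[OF that] by (auto simp: P_def \<epsilon>_def A_def b_def case_prod_beta)
  have eq: "(A x, b x) = (A y, b y)" if xy: "x \<in> T \<inter> \<Omega>" "y \<in> T \<inter> \<Omega>" "y \<in> ball x (\<epsilon> x)" for x y
  proof -
    let ?V = "interior T \<inter> (ball x (\<epsilon> x) \<inter> ball y (\<epsilon> y))"
    have V: "open ?V" by auto
    have "?V \<noteq> {}" by (rule cell_meets_ball[OF T, of y]) (use xy eA(1)[OF xy(2)] in auto)
    moreover have "A x *v z + b x = A y *v z + b y" if "z \<in> ?V" for z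
      using eA(3)[OF xy(1), of z] eA(3)[OF xy(2), of z] that interior_subset by fastforce
    ultimately show ?thesis using affine_map_unique[OF V] by blast
  qed
  have conn: "connected (T \<inter> \<Omega>)"
  proof (rule connected_intermediate_closure[of "interior T"])
    show "connected (interior T)" using convex_interior[OF cell_convex[OF T]] convex_connected by blast
    show "interior T \<subseteq> T \<inter> \<Omega>" using interior_subset interior_cell_subset[OF T] by blast
    show "T \<inter> \<Omega> \<subseteq> closure (interior T)" using closure_interior_cell[OF T] by blast
  qed
  obtain x0 where x0: "x0 \<in> T \<inter> \<Omega>" using cell_interior_nonempty[OF T] interior_subset interior_cell_subset[OF T] by blast
  have const: "(A x, b x) = (A x0, b x0)" if x: "x \<in> T \<inter> \<Omega>" for x
  proof (rule connected_local_const[OF conn x x0], intro ballI)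
    fix y assume y: "y \<in> T \<inter> \<Omega>"
    show "\<forall>\<^sub>F z in at y within T \<inter> \<Omega>. (A y, b y) = (A z, b z)"
      unfolding eventually_at_topological
      by (intro exI[of _ "ball y (\<epsilon> y)"]) (use eA(1)[OF y] eq[OF y] in auto)
  qed
  show ?thesis
  proof (intro exI[of _ "A x0"] exI[of _ "b x0"] conjI ballI)
    show "sym_part (A x0) = C T" by (rule eA(2)[OF x0])
    fix y assume y: "y \<in> T \<inter> \<Omega>"
    then show "u y = A x0 *v y + b x0" using eA(1)[OF y] eA(3)[OF y, of y] const[OF y] by auto
  qed
qed

text \<open>On balls the difference of the two displacements is rigid. The coefficients are locally
  constant, hence constant along a connected set. The intended \<open>S\<close> is the part of a
  ball inside the domain, which may be disconnected.\<close>

lemma displacement_difference_connected: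
  assumes u: "\<And>x. x \<in> \<Omega> \<Longrightarrow> \<exists>\<epsilon>>0. ball x \<epsilon> \<subseteq> \<Omega> \<and> is_displacement C (ball x \<epsilon>) u"
    and S: "open S" "S \<subseteq> \<Omega>" and v: "is_displacement C S v"
    and y0: "y0 \<in> S"
  shows "\<exists>W b. \<forall>y. connected_component S y0 y \<longrightarrow> u y - v y = W *v y + b"
proof -
  define P where "P = (\<lambda>x (\<epsilon>, W, b). \<epsilon> > 0 \<and> ball x \<epsilon> \<subseteq> S \<and> transpose W = - W \<and> (\<forall>y\<in>ball x \<epsilon>. u y - v y = W *v y + b))"
  have "\<exists>p. P x p" if x: "x \<in> S" for x
  proof -
    obtain e1 where e1: "e1 > 0" "is_displacement C (ball x e1) u" using u[of x] x S by blast
    obtain e2 where e2: "e2 > 0" "ball x e2 \<subseteq> S" using S(1) x openE by blast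
    define \<epsilon> where "\<epsilon> = min e1 e2"
    have \<epsilon>: "\<epsilon> > 0" "ball x \<epsilon> \<subseteq> S" "ball x \<epsilon> \<subseteq> ball x e1" using e1 e2 by (auto simp: \<epsilon>_def)
    have "is_displacement C (ball x \<epsilon>) u" "is_displacement C (ball x \<epsilon>) v"
      using is_displacement_subset[OF e1(2) \<epsilon>(3)] is_displacement_subset[OF v \<epsilon>(2)] by auto
    moreover have "ball x \<epsilon> \<subseteq> \<Omega>" using \<epsilon>(2) S(2) by blast
    ultimately obtain W b where "transpose W = - W" "\<forall>y\<in>ball x \<epsilon>. u y - v y = W *v y + b"
      using displacement_difference[OF open_ball convex_ball] by blast
    then have "P x (\<epsilon>, W, b)" using \<epsilon> by (simp add: P_def)
    then show ?thesis by blast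
  qed
  then obtain p where p: "\<And>x. x \<in> S \<Longrightarrow> P x (p x)" by metis
  define \<epsilon> W b where "\<epsilon> = (\<lambda>x. fst (p x))" and "W = (\<lambda>x. fst (snd (p x)))" and "b = (\<lambda>x. snd (snd (p x)))"
  have eW: "\<epsilon> x > 0" "ball x (\<epsilon> x) \<subseteq> S" "transpose (W x) = - W x"
    "\<And>y. y \<in> ball x (\<epsilon> x) \<Longrightarrow> u y - v y = W x *v y + b x" if "x \<in> S" for x
    using p[OF that] by (simp_all add: P_def \<epsilon>_def W_def b_def case_prod_beta)
  have eq: "(W x, b x) = (W y, b y)" if xy: "x \<in> S" "y \<in> S" "y \<in> ball x (\<epsilon> x)" for x y
  proof -
    let ?V = "ball x (\<epsilon> x) \<inter> ball y (\<epsilon> y)"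
    have "y \<in> ?V" using xy(3) eW(1)[OF xy(2)] by simp
    then have V: "open ?V" "?V \<noteq> {}" by auto
    have "W x *v z + b x = W y *v z + b y" if "z \<in> ?V" for z
      using eW(4)[OF xy(1), of z] eW(4)[OF xy(2), of z] that by auto
    from affine_map_unique[OF V this] show ?thesis by simp
  qed
  show ?thesis
  proof (intro exI[of _ "W y0"] exI[of _ "b y0"] allI impI)
    fix y assume "connected_component S y0 y"
    then obtain K where K: "connected K" "K \<subseteq> S" "y0 \<in> K" "y \<in> K" unfolding connected_component_def by blast
    have "(W y, b y) = (W y0, b y0)"
    proof (rule connected_local_const[OF K(1,4,3)], intro ballI)
      fix z assume "z \<in> K"
      then have z: "z \<in> S" using K by blast
      show "\<forall>\<^sub>F w in at z within K. (W z, b z) = (W w, b w)"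
        unfolding eventually_at_topological
        by (intro exI[of _ "ball z (\<epsilon> z)"]) (use eW(1)[OF z] eq[OF z] K(2) in auto)
    qed
    moreover have yS: "y \<in> S" using K by blast
    ultimately show "u y - v y = W y0 *v y + b y0"
      using eW(4)[OF yS, of y] eW(1)[OF yS] by auto
  qed
qed

text \<open>Around every point of the closure the displacement of a suitable star is available.
  Inside the domain these glue by simple connectedness; at boundary points the resulting affine
  pieces are shown to have the same limits from all cells.\<close>

theorem glue_displacements:
  assumes sc: "simply_connected \<Omega>"
    and loc: "\<And>a. a \<in> mesh_vertices \<T> \<Longrightarrow> \<exists>v. \<forall>T\<in>cells_at \<T> a. \<exists>A b. sym_part A = C T \<and> (\<forall>x\<in>T. v x = A *v x + b)"
  shows "\<exists>v\<in>piecewise_affine \<T>. \<exists>A b. \<forall>T\<in>\<T>. sym_part (A T) = C T \<and> (\<forall>x\<in>T. v x = A T *v x + b T)"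
proof -
  \<comment> \<open>All cells containing \<open>x\<close> share a vertex, so a single star
    displacement covers them.\<close>
  have "\<exists>v. \<forall>T\<in>\<T>. x \<in> T \<longrightarrow> (\<exists>A b. sym_part A = C T \<and> (\<forall>x\<in>T. v x = A *v x + b))" if x: "x \<in> closure \<Omega>" for x
  proof -
    obtain a where a: "a \<in> mesh_vertices \<T>" "\<forall>T\<in>\<T>. x \<in> T \<longrightarrow> a extreme_point_of T"
      using common_vertex[OF x] by blast
    obtain v where "\<forall>T\<in>cells_at \<T> a. \<exists>A b. sym_part A = C T \<and> (\<forall>x\<in>T. v x = A *v x + b)" using loc[OF a(1)] by blast
    then have "\<forall>T\<in>\<T>. x \<in> T \<longrightarrow> (\<exists>A b. sym_part A = C T \<and> (\<forall>x\<in>T. v x = A *v x + b))"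
      using a(2) by (simp add: cells_at_def)
    then show ?thesis by (intro exI[of _ v])
  qed
  then obtain w where w: "\<And>x T. x \<in> closure \<Omega> \<Longrightarrow> T \<in> \<T> \<Longrightarrow> x \<in> T \<Longrightarrow> \<exists>A b. sym_part A = C T \<and> (\<forall>y\<in>T. w x y = A *v y + b)"
    by metis
  have near: "\<exists>r>0. (\<forall>T\<in>\<T>. T \<inter> ball x r \<noteq> {} \<longrightarrow> x \<in> T) \<and> (x \<in> \<Omega> \<longrightarrow> ball x r \<subseteq> \<Omega>)" for x
  proof -
    obtain r1 where r1: "r1 > 0" "\<forall>T\<in>\<T>. T \<inter> ball x r1 \<noteq> {} \<longrightarrow> x \<in> T" using near_cells by blast
    show ?thesis
    proof (cases "x \<in> \<Omega>")
      case True
      then obtain r2 where "r2 > 0" "ball x r2 \<subseteq> \<Omega>" using open_domain openE by blast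
      moreover have "ball x (min r1 r2) \<subseteq> ball x r1" "ball x (min r1 r2) \<subseteq> ball x r2" by auto
      ultimately show ?thesis using r1 by (intro exI[of _ "min r1 r2"]) (simp, blast)
    qed (use r1 in blast)
  qed
  then obtain r where r: "\<And>x. r x > 0" "\<And>x T. T \<in> \<T> \<Longrightarrow> T \<inter> ball x (r x) \<noteq> {} \<Longrightarrow> x \<in> T"
    "\<And>x. x \<in> \<Omega> \<Longrightarrow> ball x (r x) \<subseteq> \<Omega>" by metis
  have wd: "is_displacement C (ball x (r x)) (w x)" if "x \<in> closure \<Omega>" for x
    unfolding is_displacement_def
  proof (intro ballI impI)
    fix T assume T: "T \<in> \<T>" "T \<inter> ball x (r x) \<noteq> {}"
    show "\<exists>A b. sym_part A = C T \<and> (\<forall>y\<in>T \<inter> ball x (r x). w x y = A *v y + b)"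
      using w[OF that T(1) r(2)[OF T]] by blast
  qed
  have "\<exists>u. \<forall>x\<in>\<Omega>. \<exists>\<epsilon>>0. ball x \<epsilon> \<subseteq> \<Omega> \<and> is_displacement C (ball x \<epsilon>) u"
  proof (rule displacement_coboundary[OF sc])
    show "r x > 0 \<and> ball x (r x) \<subseteq> \<Omega>" if "x \<in> \<Omega>" for x using r(1,3) that by simp
    show "is_displacement C (ball x (r x)) (w x)" if "x \<in> \<Omega>" for x
      by (rule wd[OF subsetD[OF closure_subset that]])
  qed
  then obtain u where u: "\<And>x. x \<in> \<Omega> \<Longrightarrow> \<exists>\<epsilon>>0. ball x \<epsilon> \<subseteq> \<Omega> \<and> is_displacement C (ball x \<epsilon>) u" by blast
  have "\<exists>A b. sym_part A = C T \<and> (\<forall>y\<in>T \<inter> \<Omega>. u y = A *v y + b)" if "T \<in> \<T>" for T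
    by (rule displacement_affine_on_cell[OF u that])
  then obtain A b where A: "\<And>T. T \<in> \<T> \<Longrightarrow> sym_part (A T) = C T" "\<And>T y. T \<in> \<T> \<Longrightarrow> y \<in> T \<inter> \<Omega> \<Longrightarrow> u y = A T *v y + b T"
    by metis
  \<comment> \<open>The two cells may meet only at a boundary point, where \<open>u\<close> is not
    controlled. Both are compared with the star displacement \<open>w x\<close>, which is
    single-valued at \<open>x\<close>; local connectedness makes \<open>u - w x\<close> one affine
    field near \<open>x\<close> inside the domain.\<close>
  have consistent: "A T *v x + b T = A T' *v x + b T'" if T: "T \<in> \<T>" "T' \<in> \<T>" "x \<in> T" "x \<in> T'" for T T' x
  proof -
    have x: "x \<in> closure \<Omega>" using T Union_mesh by blast
    obtain \<delta> where \<delta>: "\<delta> > 0" "\<delta> \<le> r x"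
      "\<And>y z. y \<in> \<Omega> \<inter> ball x \<delta> \<Longrightarrow> z \<in> \<Omega> \<inter> ball x \<delta> \<Longrightarrow> connected_component (\<Omega> \<inter> ball x (r x)) y z"
      by (rule locally_connected_closure[OF x r(1)[of x]]) blast
    have int_sub: "interior T \<inter> ball x \<delta> \<subseteq> \<Omega> \<inter> ball x \<delta>" if "T \<in> \<T>" for T using interior_cell_subset[OF that] by blast
    have "interior T \<inter> ball x \<delta> \<noteq> {}"
      by (rule cell_meets_ball[OF T(1,3) open_ball]) (simp add: \<delta>(1))
    then obtain y0 where y0: "y0 \<in> \<Omega> \<inter> ball x \<delta>" using int_sub[OF T(1)] by blast
    have "\<exists>W c. \<forall>y. connected_component (\<Omega> \<inter> ball x (r x)) y0 y \<longrightarrow> u y - w x y = W *v y + c"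
    proof (rule displacement_difference_connected[OF u, of "\<Omega> \<inter> ball x (r x)" "w x" y0])
      show "is_displacement C (\<Omega> \<inter> ball x (r x)) (w x)" by (rule is_displacement_subset[OF wd[OF x]]) auto
      show "y0 \<in> \<Omega> \<inter> ball x (r x)" using y0 \<delta>(2) by auto
    qed (use open_domain in auto)
    then obtain W c where Wc: "\<And>y. connected_component (\<Omega> \<inter> ball x (r x)) y0 y \<Longrightarrow> u y - w x y = W *v y + c" by blast
    \<comment> \<open>The right-hand side no longer mentions the cell \<open>S\<close>.\<close>
    have "A S *v x + b S = w x x + W *v x + c" if S: "S \<in> \<T>" "x \<in> S" for S
    proof -
      obtain A' b' where A': "\<And>y. y \<in> S \<Longrightarrow> w x y = A' *v y + b'" using w[OF x S] by blast
      have V: "open (interior S \<inter> ball x \<delta>)" by auto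
      have ne: "interior S \<inter> ball x \<delta> \<noteq> {}"
        by (rule cell_meets_ball[OF S open_ball]) (simp add: \<delta>(1))
      have "A S *v y + b S = (A' + W) *v y + (b' + c)" if y: "y \<in> interior S \<inter> ball x \<delta>" for y
      proof -
        have yS: "y \<in> S" "y \<in> \<Omega> \<inter> ball x \<delta>" using y interior_subset int_sub[OF S(1)] by blast+
        have "u y - w x y = W *v y + c" by (rule Wc[OF \<delta>(3)[OF y0 yS(2)]])
        then show ?thesis using A(2)[OF S(1), of y] A'[OF yS(1)] yS
          by (simp add: matrix_vector_mult_add_rdistrib algebra_simps)
      qed
      from affine_map_unique[OF V ne this] show ?thesis
        using A'[OF S(2)] by (simp add: matrix_vector_mult_add_rdistrib algebra_simps)
    qed
    then show ?thesis using T by simp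
  qed
  define v where "v = (\<lambda>x. let T = (SOME T. T \<in> \<T> \<and> x \<in> T) in A T *v x + b T)"
  have vT: "v x = A T *v x + b T" if "T \<in> \<T>" "x \<in> T" for T x
  proof -
    let ?S = "SOME T. T \<in> \<T> \<and> x \<in> T"
    have "?S \<in> \<T> \<and> x \<in> ?S" by (rule someI[of _ T]) (use that in blast)
    then show ?thesis using consistent[of ?S T x] that by (simp add: v_def Let_def)
  qed
  have "continuous_on (\<Union>\<T>) v"
  proof (rule continuous_on_piecewise[OF finite_mesh cell_closed order_refl])
    fix T assume T: "T \<in> \<T>"
    show "continuous_on (T \<inter> \<Union>\<T>) v"
      by (rule continuous_on_eq[of _ "\<lambda>x. A T *v x + b T"])
         (use vT[OF T] in \<open>auto intro!: continuous_intros matrix_vector_mult_linear_continuous_on\<close>)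
  qed
  then have "v \<in> piecewise_affine \<T>" using vT unfolding piecewise_affine_def by blast
  then show ?thesis using A(1) vT by (intro bexI[of _ v] exI[of _ A] exI[of _ b]) simp_all
qed

end

subsection \<open>Riesz representation\<close>

text \<open>A Riesz representation by Gram--Schmidt on the number of coordinates: the form need only be
  positive on functions on which some coordinate does not vanish.\<close>

lemma riesz_finite_coordinates:
  fixes V :: "('a \<Rightarrow> 'b::real_vector) set" and a :: "('a \<Rightarrow> 'b) \<Rightarrow> ('a \<Rightarrow> 'b) \<Rightarrow> real"
    and \<kappa> :: "'i \<Rightarrow> ('a \<Rightarrow> 'b) \<Rightarrow> real" and l :: "('a \<Rightarrow> 'b) \<Rightarrow> real"
  assumes "finite I" and "(\<lambda>_. 0) \<in> V"
    and "\<And>v w c. v \<in> V \<Longrightarrow> w \<in> V \<Longrightarrow> (\<lambda>x. v x + c *\<^sub>R w x) \<in> V"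
    and "\<And>i v w c. i \<in> I \<Longrightarrow> v \<in> V \<Longrightarrow> w \<in> V \<Longrightarrow> \<kappa> i (\<lambda>x. v x + c *\<^sub>R w x) = \<kappa> i v + c * \<kappa> i w"
    and "\<And>v w z c. v \<in> V \<Longrightarrow> w \<in> V \<Longrightarrow> z \<in> V \<Longrightarrow> a (\<lambda>x. v x + c *\<^sub>R w x) z = a v z + c * a w z"
    and "\<And>v w. v \<in> V \<Longrightarrow> w \<in> V \<Longrightarrow> a v w = a w v"
    and "\<And>v i. v \<in> V \<Longrightarrow> i \<in> I \<Longrightarrow> \<kappa> i v \<noteq> 0 \<Longrightarrow> a v v > 0"
    and "\<And>v w. v \<in> V \<Longrightarrow> w \<in> V \<Longrightarrow> (\<And>i. i \<in> I \<Longrightarrow> \<kappa> i v = 0) \<Longrightarrow> a v w = 0"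
    and "\<And>v w c. v \<in> V \<Longrightarrow> w \<in> V \<Longrightarrow> l (\<lambda>x. v x + c *\<^sub>R w x) = l v + c * l w"
    and "\<And>v. v \<in> V \<Longrightarrow> (\<And>i. i \<in> I \<Longrightarrow> \<kappa> i v = 0) \<Longrightarrow> l v = 0"
  shows "\<exists>u\<in>V. \<forall>w\<in>V. a u w = l w"
  using assms
proof (induction I arbitrary: V l rule: finite_induct)
  case empty
  then show ?case by (intro bexI[of _ "\<lambda>_. 0"]) simp_all
next
  case (insert i I)
  note zero = insert.prems(1) and lin = insert.prems(2) and klin = insert.prems(3) and alin = insert.prems(4)
    and sym = insert.prems(5) and pos = insert.prems(6) and anull = insert.prems(7)
    and llin = insert.prems(8) and lnull = insert.prems(9)
  have k0: "\<kappa> j (\<lambda>_. 0) = 0" if "j \<in> insert i I" for j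
    using klin[OF that zero zero, of 1] by simp
  \<comment> \<open>On \<open>V0\<close> the coordinates in \<open>I\<close> alone decide positivity
    and degeneracy, so the induction hypothesis applies to every suitable functional
    \<open>m\<close>.\<close>
  define V0 where "V0 = {v \<in> V. \<kappa> i v = 0}"
  have IH: "\<exists>u\<in>V0. \<forall>w\<in>V0. a u w = m w"
    if m: "\<And>v w c. v \<in> V0 \<Longrightarrow> w \<in> V0 \<Longrightarrow> m (\<lambda>x. v x + c *\<^sub>R w x) = m v + c * m w"
      "\<And>v. v \<in> V0 \<Longrightarrow> (\<And>j. j \<in> insert i I \<Longrightarrow> \<kappa> j v = 0) \<Longrightarrow> m v = 0" for m
  proof (rule insert.IH)
    show "(\<lambda>_. 0) \<in> V0" using zero k0 by (simp add: V0_def)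
    show "(\<lambda>x. v x + c *\<^sub>R w x) \<in> V0" if "v \<in> V0" "w \<in> V0" for v w c
      using that lin klin by (simp add: V0_def)
    show "m v = 0" if "v \<in> V0" "\<And>i. i \<in> I \<Longrightarrow> \<kappa> i v = 0" for v
      using that by (intro m(2)) (auto simp: V0_def)
    show "a v w = 0" if "v \<in> V0" "w \<in> V0" "\<And>i. i \<in> I \<Longrightarrow> \<kappa> i v = 0" for v w
      using that by (intro anull) (auto simp: V0_def)
    show "a v v > 0" if "v \<in> V0" "j \<in> I" "\<kappa> j v \<noteq> 0" for v j
      using pos[of v j] that by (simp add: V0_def)
  qed (use klin alin sym m(1) in \<open>auto simp: V0_def\<close>)
  show ?case
  proof (cases "V0 = V")
    case True
    have "\<exists>u\<in>V0. \<forall>w\<in>V0. a u w = l w"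
      by (rule IH) (use llin lnull True in auto)
    then show ?thesis using True by simp
  next
    case False
    then obtain d where d: "d \<in> V" "\<kappa> i d \<noteq> 0" by (auto simp: V0_def)
    have alinr: "a z (\<lambda>x. v x + c *\<^sub>R w x) = a z v + c * a z w" if "v \<in> V" "w \<in> V" "z \<in> V" for v w z c
      using alin[OF that] sym[OF that(1,3)] sym[OF that(2,3)] sym[OF lin[OF that(1,2)] that(3)] by simp
    \<comment> \<open>The induction hypothesis for the functional \<open>a d\<close> yields the
      orthogonal projection \<open>p\<close> of \<open>d\<close> onto \<open>V0\<close>, and
      \<open>d' = d - p\<close> is the Gram-Schmidt direction.\<close>
    have "\<exists>u\<in>V0. \<forall>w\<in>V0. a u w = a d w"
    proof (rule IH)
      show "a d v = 0" if "v \<in> V0" "\<And>j. j \<in> insert i I \<Longrightarrow> \<kappa> j v = 0" for v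
        using anull[of v d] sym[of d v] that d by (auto simp: V0_def)
    qed (use alinr d in \<open>auto simp: V0_def\<close>)
    then obtain p where p: "p \<in> V0" "\<And>w. w \<in> V0 \<Longrightarrow> a p w = a d w" by blast
    have "\<exists>u\<in>V0. \<forall>w\<in>V0. a u w = l w"
      by (rule IH) (use llin lnull in \<open>auto simp: V0_def\<close>)
    then obtain u0 where u0: "u0 \<in> V0" "\<And>w. w \<in> V0 \<Longrightarrow> a u0 w = l w" by blast
    have pV: "p \<in> V" "u0 \<in> V" "\<kappa> i p = 0" using p u0 by (auto simp: V0_def)
    define d' where "d' = (\<lambda>x. d x + (-1) *\<^sub>R p x)"
    have d': "d' \<in> V" unfolding d'_def by (rule lin[OF d(1) pV(1)])
    have kd': "\<kappa> i d' = \<kappa> i d" unfolding d'_def using klin[OF _ d(1) pV(1), of i "-1"] pV by simp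
    have orth: "a d' w = 0" if "w \<in> V0" for w
      unfolding d'_def using alin[OF d(1) pV(1), of w "-1"] p(2)[OF that] that by (simp add: V0_def)
    have add: "a d' d' > 0" using pos[OF d', of i] kd' d by simp
    \<comment> \<open>Forced by testing \<open>u\<close> with \<open>d'\<close>, to which
      \<open>u0\<close> is orthogonal.\<close>
    define s where "s = l d' / a d' d'"
    define u where "u = (\<lambda>x. u0 x + s *\<^sub>R d' x)"
    have uV: "u \<in> V" unfolding u_def by (rule lin[OF pV(2) d'])
    have "a u w = l w" if w: "w \<in> V" for w
    proof -
      define t where "t = \<kappa> i w / \<kappa> i d'"
      define w0 where "w0 = (\<lambda>x. w x + (- t) *\<^sub>R d' x)"
      have w0V: "w0 \<in> V" unfolding w0_def by (rule lin[OF w d'])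
      have "\<kappa> i w0 = 0"
        unfolding w0_def using klin[OF _ w d', of i "- t"] kd' d by (simp add: t_def)
      then have w0: "w0 \<in> V0" using w0V by (simp add: V0_def)
      have weq: "w = (\<lambda>x. w0 x + t *\<^sub>R d' x)" by (simp add: w0_def)
      have 1: "a u w0 = l w0"
        unfolding u_def using alin[OF pV(2) d' w0V, of s] u0(2)[OF w0] orth[OF w0] by simp
      have 2: "a u d' = l d'"
        unfolding u_def using alin[OF pV(2) d' d', of s] orth[OF u0(1)] sym[OF pV(2) d'] add by (simp add: s_def)
      have "a u w = a u w0 + t * a u d'"
        using alinr[OF w0V d' uV, of t] weq by simp
      also have "\<dots> = l w0 + t * l d'" using 1 2 by simp
      also have "\<dots> = l w"
        using llin[OF w0V d', of t] weq by simp
      finally show ?thesis .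
    qed
    then show ?thesis using uV by blast
  qed
qed

subsection \<open>Area of polyhedral surfaces\<close>

text \<open>A grid of \<open>m * m\<close> cells of diameter at most \<open>?n / real m\<close> has
  total weight \<open>?B\<close>, independent of \<open>m\<close>. Refining the grid for smaller
  \<open>\<delta>\<close> therefore does not raise the bound.\<close>

lemma hausdorff_outer_parallelogram:
  fixes p u v :: "'a::euclidean_space"
  shows "hausdorff_outer 2 ((\<lambda>(s, t). p + s *\<^sub>R u + t *\<^sub>R v) ` ({0..1} \<times> {0..1})) < top"
proof -
  let ?f = "\<lambda>(s, t). p + s *\<^sub>R u + t *\<^sub>R v"
  let ?n = "norm u + norm v"
  let ?B = "unit_ball_vol 2 * (?n / 2) ^ 2"
  have ubv: "unit_ball_vol 2 \<ge> 0" by (rule unit_ball_vol_nonneg) simp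
  have "hausdorff_pre 2 \<delta> (?f ` ({0..1} \<times> {0..1})) \<le> ennreal ?B" if \<delta>: "\<delta> > 0" for \<delta>
  proof -
    obtain m :: nat where "?n / \<delta> < real m" using reals_Archimedean2 by blast
    moreover have "0 \<le> ?n / \<delta>" using \<delta> by simp
    ultimately have "0 < real m" "?n < real m * \<delta>" using \<delta> by (linarith, simp add: pos_divide_less_eq)
    then have m: "m > 0" "?n / real m \<le> \<delta>" by (simp, simp add: divide_le_eq mult.commute)
    define cell where "cell = (\<lambda>i j. ?f ` ({real i / real m..real (Suc i) / real m} \<times> {real j / real m..real (Suc j) / real m}))"
    \<comment> \<open>The grid is enumerated row by row; the empty sets after it have weight 0, as
      the dimension is positive.\<close>
    define C where "C = (\<lambda>k. if k < m * m then cell (k div m) (k mod m) else {})"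
    have dist_cell: "norm (x - y) \<le> ?n / real m" if xy: "x \<in> cell i j" "y \<in> cell i j" for x y i j
    proof -
      obtain s t s' t' where st: "x = p + s *\<^sub>R u + t *\<^sub>R v" "y = p + s' *\<^sub>R u + t' *\<^sub>R v"
        "s \<in> {real i / real m..real (Suc i) / real m}" "s' \<in> {real i / real m..real (Suc i) / real m}"
        "t \<in> {real j / real m..real (Suc j) / real m}" "t' \<in> {real j / real m..real (Suc j) / real m}"
        using xy unfolding cell_def by auto
      have b: "\<bar>s - s'\<bar> \<le> 1 / real m" "\<bar>t - t'\<bar> \<le> 1 / real m"
        using st(3-6) by (auto simp: add_divide_distrib abs_le_iff)
      have "norm (x - y) = norm ((s - s') *\<^sub>R u + (t - t') *\<^sub>R v)" by (simp add: st algebra_simps)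
      also have "\<dots> \<le> \<bar>s - s'\<bar> * norm u + \<bar>t - t'\<bar> * norm v"
        using norm_triangle_ineq[of "(s - s') *\<^sub>R u" "(t - t') *\<^sub>R v"] by simp
      also have "\<dots> \<le> 1 / real m * norm u + 1 / real m * norm v"
        using b by (intro add_mono mult_right_mono) auto
      finally show ?thesis by (simp add: add_divide_distrib)
    qed
    have bC: "bounded (C k)" for k
    proof (cases "C k = {}")
      case False
      then obtain y where y: "y \<in> C k" by blast
      have "\<forall>x\<in>C k. dist y x \<le> ?n / real m"
        using y dist_cell by (auto simp: C_def dist_norm split: if_splits)
      then show ?thesis unfolding bounded_def by blast
    qed simp
    have dC: "diameter (C k) \<le> ?n / real m" for k
      by (rule diameter_le) (use dist_cell in \<open>auto simp: C_def split: if_splits\<close>)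
    have "?f ` ({0..1} \<times> {0..1}) \<subseteq> (\<Union>k. C k)"
    proof clarify
      fix s t :: real assume st: "s \<in> {0..1}" "t \<in> {0..1}"
      \<comment> \<open>At \<open>r = 1\<close> the floor of \<open>r * real m\<close> would be
        \<open>m\<close>, one past the last cell, so this end point is assigned to cell
        \<open>m - 1\<close>.\<close>
      have "\<exists>i<m. r \<in> {real i / real m..real (Suc i) / real m}" if r: "r \<in> {0..1}" for r :: real
      proof (cases "r = 1")
        case True
        have "r \<in> {real (m - 1) / real m..real (Suc (m - 1)) / real m}" using m(1) True by (auto simp: field_simps)
        then show ?thesis using m(1) by (intro exI[of _ "m - 1"]) auto
      next
        case False
        then have r1: "0 \<le> r" "r < 1" using r by auto
        define i where "i = nat \<lfloor>r * real m\<rfloor>"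
        have 0: "0 \<le> r * real m" using r1 by simp
        then have i: "real i = of_int \<lfloor>r * real m\<rfloor>" by (simp add: i_def)
        then have ir: "real i \<le> r * real m" "r * real m < real i + 1" by linarith+
        have "r * real m < real m" using r1 m by simp
        then have "i < m" using ir(1) by linarith
        then show ?thesis using ir m(1) by (intro exI[of _ i]) (auto simp: field_simps)
      qed
      then obtain i j where ij: "i < m" "s \<in> {real i / real m..real (Suc i) / real m}"
        "j < m" "t \<in> {real j / real m..real (Suc j) / real m}" using st by meson
      have "i * m + j < m * m"
      proof -
        have "i * m + j < Suc i * m" using ij by simp
        also have "\<dots> \<le> m * m" using ij by (intro mult_right_mono) auto
        finally show ?thesis .
      qed
      then have "C (i * m + j) = cell i j" using ij by (simp add: C_def)
      moreover have "p + s *\<^sub>R u + t *\<^sub>R v \<in> cell i j" unfolding cell_def using ij by force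
      ultimately show "p + s *\<^sub>R u + t *\<^sub>R v \<in> (\<Union>k. C k)" by blast
    qed
    then have "C \<in> hausdorff_covers \<delta> (?f ` ({0..1} \<times> {0..1}))"
      unfolding hausdorff_covers_def using bC order_trans[OF dC m(2)] by simp
    then have "hausdorff_pre 2 \<delta> (?f ` ({0..1} \<times> {0..1})) \<le> (\<Sum>k. hausdorff_weight 2 (C k))"
      by (rule hausdorff_pre_le)
    also have "\<dots> = (\<Sum>k<m*m. hausdorff_weight 2 (C k))"
      by (rule suminf_finite) (auto simp: C_def hausdorff_weight_empty)
    also have "\<dots> \<le> (\<Sum>k<m*m. ennreal (unit_ball_vol 2 * (?n / real m / 2) ^ 2))"
    proof (rule sum_mono)
      fix k
      have "unit_ball_vol 2 * (diameter (C k) / 2) ^ 2 \<le> unit_ball_vol 2 * (?n / real m / 2) ^ 2"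
        using dC[of k] diameter_ge_0[OF bC] ubv by (intro mult_left_mono power_mono divide_right_mono) auto
      then show "hausdorff_weight 2 (C k) \<le> ennreal (unit_ball_vol 2 * (?n / real m / 2) ^ 2)"
        unfolding hausdorff_weight_def by (intro ennreal_leI) simp
    qed
    also have "\<dots> = ennreal (real (m * m) * (unit_ball_vol 2 * (?n / real m / 2) ^ 2))"
      using ubv by (simp add: ennreal_mult ennreal_of_nat_eq_real_of_nat)
    also have "real (m * m) * (unit_ball_vol 2 * (?n / real m / 2) ^ 2) = ?B"
      using m(1) by (simp add: power2_eq_square field_simps)
    finally show ?thesis .
  qed
  then have "hausdorff_outer 2 (?f ` ({0..1} \<times> {0..1})) \<le> ennreal ?B"
    unfolding hausdorff_outer_def by (intro SUP_least) auto
  then show ?thesis by (rule le_less_trans) simp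
qed

lemma convex_hull_3_subset_parallelogram:
  fixes a b c :: "'a::euclidean_space"
  shows "convex hull {a, b, c} \<subseteq> (\<lambda>(s, t). a + s *\<^sub>R (b - a) + t *\<^sub>R (c - a)) ` ({0..1} \<times> {0..1})"
proof
  fix x assume "x \<in> convex hull {a, b, c}"
  then obtain u v w where uvw: "0 \<le> u" "0 \<le> v" "0 \<le> w" "u + v + w = 1" "x = u *\<^sub>R a + v *\<^sub>R b + w *\<^sub>R c"
    unfolding convex_hull_3 by blast
  have u: "u = 1 - v - w" using uvw by simp
  have "x = a + v *\<^sub>R (b - a) + w *\<^sub>R (c - a)" unfolding uvw(5) u by (simp add: algebra_simps)
  then show "x \<in> (\<lambda>(s, t). a + s *\<^sub>R (b - a) + t *\<^sub>R (c - a)) ` ({0..1} \<times> {0..1})"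
    using uvw by (force intro: image_eqI[of _ _ "(v, w)"])
qed

text \<open>The frontier consists of four triangles, each contained in a parallelogram.\<close>

lemma hausdorff_outer_frontier_simplex:
  fixes T :: "(real^3) set"
  assumes "3 simplex T" shows "hausdorff_outer 2 (frontier T) < top"
proof -
  obtain C where C: "\<not> affine_dependent C" "int (card C) = 3 + 1" "T = convex hull C"
    using assms unfolding simplex by auto
  then have c4: "card C = 4" by simp
  have tri: "hausdorff_outer 2 (convex hull (C - {x})) < top" if "x \<in> C" for x
  proof -
    have "card (C - {x}) = 3" using c4 that by simp
    then obtain a b c where "C - {x} = {a, b, c}" by (auto simp: card_3_iff)
    then show ?thesis
      using le_less_trans[OF hausdorff_outer_mono[OF convex_hull_3_subset_parallelogram[of a b c]]
        hausdorff_outer_parallelogram] by simp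
  qed
  have "hausdorff_outer 2 (\<Union>x\<in>D. convex hull (C - {x})) < top" if "finite D" "D \<subseteq> C" for D
    using that
  proof (induction D rule: finite_induct)
    case empty then show ?case by (simp add: hausdorff_outer_empty)
  next
    case (insert x D)
    have "hausdorff_outer 2 (\<Union>x\<in>insert x D. convex hull (C - {x}))
        \<le> hausdorff_outer 2 (convex hull (C - {x})) + hausdorff_outer 2 (\<Union>x\<in>D. convex hull (C - {x}))"
      by (simp only: UN_insert) (rule hausdorff_outer_Un, simp)
    also have "\<dots> < top" using insert tri[of x] by (simp add: ennreal_add_less_top)
    finally show ?case .
  qed
  from this[of C] have "hausdorff_outer 2 (\<Union>x\<in>C. convex hull (C - {x})) < top"
    using c4 by (simp add: card_ge_0_finite)
  moreover have "frontier T = (\<Union>x\<in>C. convex hull (C - {x}))"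
    unfolding C(3) frontier_convex_hull_cases[OF C(1)] using c4 by auto
  ultimately show ?thesis by simp
qed

lemma hausdorff_outer_finite_Union:
  fixes F :: "'i \<Rightarrow> 'a::euclidean_space set"
  assumes "finite I" "d > 0" "\<And>i. i \<in> I \<Longrightarrow> hausdorff_outer d (F i) < top"
  shows "hausdorff_outer d (\<Union>i\<in>I. F i) < top"
  using assms
proof (induction I rule: finite_induct)
  case empty then show ?case by (simp add: hausdorff_outer_empty)
next
  case (insert x I)
  have "hausdorff_outer d (\<Union>i\<in>insert x I. F i) \<le> hausdorff_outer d (F x) + hausdorff_outer d (\<Union>i\<in>I. F i)"
    using hausdorff_outer_Un[OF \<open>d > 0\<close>] by simp
  also have "\<dots> < top" using insert by (simp add: ennreal_add_less_top)
  finally show ?case .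
qed

subsection \<open>Strains of piecewise affine displacements\<close>

lemma AE_lebesgue_on_iff: "S \<in> sets lebesgue \<Longrightarrow> (AE x in lebesgue_on S. P x) \<longleftrightarrow> (AE x in lebesgue. x \<in> S \<longrightarrow> P x)"
  by (simp add: AE_restrict_space_iff)

lemma AE_not_frontier_convex: "convex T \<Longrightarrow> AE x in lebesgue. x \<notin> frontier T"
  using negligible_convex_frontier by (intro AE_not_in) (simp add: negligible_iff_null_sets)

lemma (in bounded_open) AE_cell_sym_grad:
  assumes fin: "finite \<S>" and cl: "\<And>T. T \<in> \<S> \<Longrightarrow> closed T" and cv: "\<And>T. T \<in> \<S> \<Longrightarrow> convex T"
    and cover: "S \<subseteq> \<Union>\<S>"
    and aff: "\<And>T x. T \<in> \<S> \<Longrightarrow> x \<in> T \<Longrightarrow> v x = A T *v x + b T"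
    and T: "T \<in> \<S>" "interior T \<subseteq> S"
  shows "AE x in lebesgue_on T. sym_grad S v x = sym_part (A T)"
proof -
  have "AE x in lebesgue_on S. \<forall>T\<in>\<S>. x \<in> T \<longrightarrow> weak_grad S v x = A T"
    by (rule piecewise_affine_H1(2)[OF fin cl cv cover, where b = b]) (use aff in auto)
  then have "AE x in lebesgue. x \<in> S \<longrightarrow> (\<forall>T\<in>\<S>. x \<in> T \<longrightarrow> weak_grad S v x = A T)"
    by (simp only: AE_lebesgue_on_iff[OF sets_S])
  then have "AE x in lebesgue. x \<in> T \<longrightarrow> sym_grad S v x = sym_part (A T)"
    using AE_not_frontier_convex[OF cv[OF T(1)]]
  proof eventually_elim
    case (elim x)
    show ?case
    proof
      assume x: "x \<in> T"
      then have "x \<in> S" using elim(2) T cl[OF T(1)] by (auto simp: frontier_def)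
      then have "weak_grad S v x = A T" using elim(1) T(1) x by blast
      then show "sym_grad S v x = sym_part (A T)" by (simp add: sym_grad_def sym_part_def)
    qed
  qed
  moreover have "T \<in> sets lebesgue" using cl[OF T(1)] by auto
  ultimately show ?thesis by (simp only: AE_lebesgue_on_iff)
qed

text \<open>The quadratic form does not see the skew part, so edge moments can be computed from
  displacement matrices.\<close>

lemma inner_sym_part: "\<tau> \<bullet> (sym_part A *v \<tau>) = \<tau> \<bullet> (A *v \<tau>)"
proof -
  have "\<tau> \<bullet> (transpose A *v \<tau>) = (A *v \<tau>) \<bullet> \<tau>" using dot_lmul_matrix[of \<tau> "transpose A" \<tau>]
    by (simp add: vector_transpose_matrix inner_commute)
  then show ?thesis
    by (simp add: sym_part_def matrix_vector_mult_add_rdistrib scaleR_matrix_vector_assoc[symmetric] inner_add_right inner_commute)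
qed

context mesh
begin

abbreviation (input) pw where "pw \<equiv> piecewise_affine \<T>"

lemma cell_sets: "T \<in> \<T> \<Longrightarrow> T \<in> sets lebesgue"
  using cell_closed by auto

lemma AE_cell_const:
  assumes "T \<in> \<T>" "AE x in lebesgue_on T. P" shows P
proof -
  have "AE x in lebesgue_on (interior T). P"
    by (rule AE_lebesgue_on_subset[OF assms(2)]) (use cell_sets[OF assms(1)] interior_subset in auto)
  then show ?thesis by (rule AE_lebesgue_on_open_nonempty[OF _ open_interior cell_interior_nonempty[OF assms(1)]])
qed

text \<open>The part of a cell outside the domain lies in the frontier of the cell, which is null by
  convexity.\<close>

lemma AE_domain_to_cell:
  assumes "AE x in lebesgue_on \<Omega>. P x" "T \<in> \<T>" shows "AE x in lebesgue_on T. P x"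
proof -
  have "AE x in lebesgue. x \<in> \<Omega> \<longrightarrow> P x" using assms(1) by (simp only: AE_lebesgue_on_iff[OF sets_S])
  then have "AE x in lebesgue. x \<in> T \<longrightarrow> P x"
    using AE_not_frontier_convex[OF cell_convex[OF assms(2)]]
    by eventually_elim (use interior_cell_subset[OF assms(2)] cell_closed[OF assms(2)] in \<open>auto simp: frontier_def\<close>)
  then show ?thesis by (simp only: AE_lebesgue_on_iff[OF cell_sets[OF assms(2)]])
qed

lemma AE_Union_cells:
  assumes "\<S> \<subseteq> \<T>" "S \<subseteq> \<Union>\<S>" "S \<in> sets lebesgue" "\<And>T. T \<in> \<S> \<Longrightarrow> AE x in lebesgue_on T. P x"
  shows "AE x in lebesgue_on S. P x"
proof -
  have "AE x in lebesgue. \<forall>T\<in>\<S>. x \<in> T \<longrightarrow> P x"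
  proof (rule AE_finite_allI)
    show "finite \<S>" using assms(1) finite_mesh finite_subset by blast
    fix T assume T: "T \<in> \<S>"
    then have "T \<in> sets lebesgue" using assms(1) cell_sets by blast
    then show "AE x in lebesgue. x \<in> T \<longrightarrow> P x" using assms(4)[OF T] by (simp only: AE_lebesgue_on_iff)
  qed
  then have "AE x in lebesgue. x \<in> S \<longrightarrow> P x" by eventually_elim (use assms(2) in blast)
  then show ?thesis by (simp only: AE_lebesgue_on_iff[OF assms(3)])
qed

lemma AE_cells_to_domain: "(\<And>T. T \<in> \<T> \<Longrightarrow> AE x in lebesgue_on T. P x) \<Longrightarrow> AE x in lebesgue_on \<Omega>. P x"
  by (rule AE_Union_cells[OF order_refl domain_subset_mesh sets_S])

lemma cell_value_eqI:
  assumes "T \<in> \<T>" "AE x in lebesgue_on T. e x = C" shows "cell_value e T = C"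
  unfolding cell_value_def
proof (rule the_equality[where P = "\<lambda>C. AE x in lebesgue_on T. e x = C"])
  fix C' assume "AE x in lebesgue_on T. e x = C'"
  with assms(2) have "AE x in lebesgue_on T. C' = C" by eventually_elim simp
  then show "C' = C" by (rule AE_cell_const[OF assms(1)])
qed (rule assms(2))

lemma pw_affine:
  assumes "v \<in> pw"
  obtains A b where "\<forall>T\<in>\<T>. \<forall>x\<in>T. v x = A T *v x + b T"
proof -
  have "\<forall>T\<in>\<T>. \<exists>A b. \<forall>x\<in>T. v x = A *v x + b" using assms by (simp add: piecewise_affine_def)
  then have "\<exists>A. \<forall>T\<in>\<T>. \<exists>b. \<forall>x\<in>T. v x = A T *v x + b" by (rule bchoice)
  then obtain A where "\<forall>T\<in>\<T>. \<exists>b. \<forall>x\<in>T. v x = A T *v x + b" by blast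
  then have "\<exists>b. \<forall>T\<in>\<T>. \<forall>x\<in>T. v x = A T *v x + b T" by (rule bchoice)
  then show ?thesis using that by blast
qed

lemma pw_continuous: "v \<in> pw \<Longrightarrow> continuous_on (closure \<Omega>) v"
  by (simp add: piecewise_affine_def Union_mesh)

lemma pw_lincomb:
  assumes v: "v \<in> pw" and w: "w \<in> pw" shows "(\<lambda>x. v x + c *\<^sub>R w x) \<in> pw"
proof -
  obtain A b where A: "\<forall>T\<in>\<T>. \<forall>x\<in>T. v x = A T *v x + b T" by (rule pw_affine[OF v])
  obtain A' b' where A': "\<forall>T\<in>\<T>. \<forall>x\<in>T. w x = A' T *v x + b' T" by (rule pw_affine[OF w])
  have "continuous_on (\<Union>\<T>) (\<lambda>x. v x + c *\<^sub>R w x)"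
    using v w by (auto simp: piecewise_affine_def intro!: continuous_intros)
  moreover have "\<exists>(B::real^3^3) d. \<forall>x\<in>T. v x + c *\<^sub>R w x = B *v x + d" if "T \<in> \<T>" for T
    using A A' that
    by (intro exI[of _ "A T + c *\<^sub>R A' T"] exI[of _ "b T + c *\<^sub>R b' T"])
       (simp add: matrix_vector_mult_add_rdistrib scaleR_matrix_vector_assoc[symmetric] algebra_simps)
  ultimately show ?thesis by (simp add: piecewise_affine_def)
qed

lemma affine_pw: "(\<lambda>x. W *v x + b) \<in> pw"
  by (auto simp: piecewise_affine_def intro!: continuous_intros matrix_vector_mult_linear_continuous_on)

lemma zero_pw: "(\<lambda>_. 0) \<in> pw"
  using affine_pw[of 0 0] by simp

lemma pw_H1:
  assumes "v \<in> pw" shows "v \<in> H1 \<Omega>"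
proof -
  obtain A b where A: "\<forall>T\<in>\<T>. \<forall>x\<in>T. v x = A T *v x + b T" by (rule pw_affine[OF assms])
  show ?thesis
    by (rule piecewise_affine_H1(1)[OF finite_mesh cell_closed cell_convex domain_subset_mesh, where A = A and b = b]) (use A in auto)
qed

lemma pw_cell_strain:
  assumes "\<forall>T\<in>\<T>. \<forall>x\<in>T. v x = A T *v x + b T" "T \<in> \<T>"
  shows "AE x in lebesgue_on T. sym_grad \<Omega> v x = sym_part (A T)"
  by (rule AE_cell_sym_grad[OF finite_mesh cell_closed cell_convex domain_subset_mesh _ assms(2) interior_cell_subset[OF assms(2)], where b = b])
     (use assms(1) in auto)

lemma pw_cell_value:
  assumes "v \<in> pw" "T \<in> \<T>"
  shows "AE x in lebesgue_on T. sym_grad \<Omega> v x = cell_value (sym_grad \<Omega> v) T"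
proof -
  obtain A b where A: "\<forall>T\<in>\<T>. \<forall>x\<in>T. v x = A T *v x + b T" by (rule pw_affine[OF assms(1)])
  then show ?thesis using pw_cell_strain[OF A assms(2)] cell_value_eqI[OF assms(2) pw_cell_strain[OF A assms(2)]] by simp
qed

lemma cell_value_lincomb:
  assumes "v \<in> pw" "w \<in> pw" "T \<in> \<T>"
  shows "cell_value (sym_grad \<Omega> (\<lambda>x. v x + c *\<^sub>R w x)) T
    = cell_value (sym_grad \<Omega> v) T + c *\<^sub>R cell_value (sym_grad \<Omega> w) T"
proof (rule cell_value_eqI[OF assms(3)])
  show "AE x in lebesgue_on T. sym_grad \<Omega> (\<lambda>x. v x + c *\<^sub>R w x) x
    = cell_value (sym_grad \<Omega> v) T + c *\<^sub>R cell_value (sym_grad \<Omega> w) T"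
    using AE_domain_to_cell[OF sym_grad_lincomb[OF pw_H1[OF assms(1)] pw_H1[OF assms(2)], of c] assms(3)]
      pw_cell_value[OF assms(1,3)] pw_cell_value[OF assms(2,3)]
    by eventually_elim simp
qed

lemma star_cover: "interior (star \<T> a) \<subseteq> \<Union>(cells_at \<T> a)"
  using interior_subset by (simp add: star_def)

lemma cells_at_subset: "cells_at \<T> a \<subseteq> \<T>" by (auto simp: cells_at_def)

lemma star_closed: "closed (star \<T> a)"
  unfolding star_def using finite_subset[OF cells_at_subset finite_mesh] cell_closed cells_at_subset
  by (intro closed_Union) auto

lemma star_sets: "star \<T> a \<in> sets lebesgue"
  using star_closed by auto

lemma star_cell_strain:
  assumes "\<And>T x. T \<in> cells_at \<T> a \<Longrightarrow> x \<in> T \<Longrightarrow> v x = A T *v x + b T" "T \<in> cells_at \<T> a"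
  shows "AE x in lebesgue_on T. sym_grad (interior (star \<T> a)) v x = sym_part (A T)"
proof -
  have "bounded T" if "T \<in> cells_at \<T> a" for T
    using cell_compact[OF subsetD[OF cells_at_subset that]] by (rule compact_imp_bounded)
  then have "bounded (star \<T> a)"
    unfolding star_def using finite_subset[OF cells_at_subset finite_mesh] by (intro bounded_Union) auto
  then interpret st: bounded_open "interior (star \<T> a)"
    by unfold_locales (use bounded_subset interior_subset in auto)
  show ?thesis
  proof (rule st.AE_cell_sym_grad[OF finite_subset[OF cells_at_subset finite_mesh] _ _ star_cover assms(1) assms(2)])
    show "interior T \<subseteq> interior (star \<T> a)"
      by (rule interior_mono) (use assms(2) in \<open>auto simp: star_def\<close>)
    fix T assume "T \<in> cells_at \<T> a"
    then have "T \<in> \<T>" using cells_at_subset by blast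
    then show "closed T" "convex T" by (rule cell_closed, rule cell_convex)
  qed
qed

text \<open>The increment of \<open>v\<close> between two points of an edge is the same in all cells
  containing the edge. Hence the cell matrices agree on the tangent, and so do the moments.\<close>

lemma sym_grad_edge_strain:
  assumes v: "v \<in> pw" and \<tau>: "edge_tangents \<T> \<tau>"
  shows "sym_grad \<Omega> v \<in> edge_strain_space \<Omega> \<T> \<tau>"
proof -
  obtain A b where A: "\<forall>T\<in>\<T>. \<forall>x\<in>T. v x = A T *v x + b T" by (rule pw_affine[OF v])
  have cv: "cell_value (sym_grad \<Omega> v) T = sym_part (A T)" if "T \<in> \<T>" for T
    by (rule cell_value_eqI[OF that pw_cell_strain[OF A that]])
  have "edge_moment \<tau> (sym_grad \<Omega> v) T \<sigma> = edge_moment \<tau> (sym_grad \<Omega> v) T' \<sigma>"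
    if \<sigma>: "\<sigma> \<in> mesh_edges \<T>" and T: "T \<in> \<T>" "T' \<in> \<T>" "\<sigma> \<subseteq> T" "\<sigma> \<subseteq> T'" for \<sigma> T T'
  proof -
    obtain T0 where "\<sigma> edge_of T0" using \<sigma> by (auto simp: mesh_edges_def)
    then have "aff_dim \<sigma> = 1" by (simp add: edge_of_def)
    then have "\<not> (\<exists>x. \<sigma> \<subseteq> {x})" using aff_dim_subset aff_dim_sing
      by (metis aff_dim_empty aff_dim_sing one_neq_zero subset_singletonD zero_neq_neg_one equal_neg_zero)
    then obtain x y where xy: "x \<in> \<sigma>" "y \<in> \<sigma>" "x \<noteq> y" by blast
    obtain s where s: "x - y = s *\<^sub>R \<tau> \<sigma>" using \<tau> \<sigma> xy unfolding edge_tangents_def by blast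
    have "v x - v y = A S *v (x - y)" if "S \<in> \<T>" "\<sigma> \<subseteq> S" for S
      using A that xy by (simp add: matrix_vector_mult_diff_distrib subset_iff)
    then have diff: "v x - v y = s *\<^sub>R (A S *v \<tau> \<sigma>)" if "S \<in> \<T>" "\<sigma> \<subseteq> S" for S
      using that by (simp only: s matrix_vector_mult_scaleR)
    have "s *\<^sub>R (A T *v \<tau> \<sigma>) = s *\<^sub>R (A T' *v \<tau> \<sigma>)"
      by (rule trans[OF diff[OF T(1,3), symmetric] diff[OF T(2,4)]])
    moreover have "s \<noteq> 0" using s xy by auto
    ultimately have "A T *v \<tau> \<sigma> = A T' *v \<tau> \<sigma>" by simp
    then show ?thesis unfolding edge_moment_def cv[OF T(1)] cv[OF T(2)] inner_sym_part by simp
  qed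
  moreover have "\<forall>T\<in>\<T>. \<exists>C. AE x in lebesgue_on T. sym_grad \<Omega> v x = C"
    using pw_cell_strain[OF A] by blast
  moreover have "AE x in lebesgue_on \<Omega>. transpose (sym_grad \<Omega> v x) = sym_grad \<Omega> v x"
    by (simp add: sym_grad_symmetric)
  ultimately show ?thesis
    unfolding edge_strain_space_def using sym_grad_L2[OF pw_H1[OF v]] by blast
qed

lemma compatibility_iff:
  assumes "compatibility_forms \<Omega> \<T> \<tau> N \<phi>" "e \<in> edge_strain_space \<Omega> \<T> \<tau>" "a \<in> mesh_vertices \<T>"
  shows "(\<forall>j<N a. \<phi> a j e = 0) \<longleftrightarrow> (\<exists>v\<in>piecewise_affine (cells_at \<T> a).
      AE x in lebesgue_on (star \<T> a). sym_grad (interior (star \<T> a)) v x = e x)"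
  using assms unfolding compatibility_forms_def Let_def by blast

text \<open>On every star the restriction of \<open>v\<close> is the required witness.
  \<open>sym_grad\<close> depends on the underlying domain; the versions for \<open>\<Omega>\<close>
  and for the interior of the star are compared through the cell matrices.\<close>

lemma sym_grad_fe_strain:
  assumes v: "v \<in> pw" and \<tau>: "edge_tangents \<T> \<tau>" and \<phi>: "compatibility_forms \<Omega> \<T> \<tau> N \<phi>"
  shows "sym_grad \<Omega> v \<in> fe_strains \<Omega> \<T> \<tau> N \<phi>"
proof -
  note E = sym_grad_edge_strain[OF v \<tau>]
  obtain A b where A: "\<forall>T\<in>\<T>. \<forall>x\<in>T. v x = A T *v x + b T" by (rule pw_affine[OF v])
  have "\<forall>j<N a. \<phi> a j (sym_grad \<Omega> v) = 0" if a: "a \<in> mesh_vertices \<T>" for a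
    unfolding compatibility_iff[OF \<phi> E a]
  proof (rule bexI[of _ v])
    show "v \<in> piecewise_affine (cells_at \<T> a)"
    proof -
      have "continuous_on (\<Union>(cells_at \<T> a)) v"
        by (rule continuous_on_subset[of "\<Union>\<T>"]) (use v cells_at_subset[of a] in \<open>auto simp: piecewise_affine_def\<close>)
      moreover have "\<forall>T\<in>cells_at \<T> a. \<exists>(A::real^3^3) b. \<forall>x\<in>T. v x = A *v x + b"
        using v cells_at_subset[of a] by (auto simp: piecewise_affine_def)
      ultimately show ?thesis by (simp add: piecewise_affine_def)
    qed
    show "AE x in lebesgue_on (star \<T> a). sym_grad (interior (star \<T> a)) v x = sym_grad \<Omega> v x"
    proof (rule AE_Union_cells[OF cells_at_subset[of a] _ star_sets])
      show "star \<T> a \<subseteq> \<Union>(cells_at \<T> a)" by (simp add: star_def)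
      fix T assume T: "T \<in> cells_at \<T> a"
      then have T': "T \<in> \<T>" using cells_at_subset by blast
      have "AE x in lebesgue_on T. sym_grad (interior (star \<T> a)) v x = sym_part (A T)"
        by (rule star_cell_strain[OF _ T, where b = b]) (use A cells_at_subset in blast)
      with pw_cell_strain[OF A T'] show "AE x in lebesgue_on T. sym_grad (interior (star \<T> a)) v x = sym_grad \<Omega> v x"
        by eventually_elim simp
    qed
  qed
  then show ?thesis using E by (simp add: fe_strains_def)
qed

text \<open>The vanishing forms provide a displacement on each star whose cell matrices have the
  constant values of \<open>e\<close> as symmetric parts, which is the local input of
  \<open>glue_displacements\<close>.\<close>

lemma fe_strain_imp_sym_grad:
  assumes sc: "simply_connected \<Omega>" and \<phi>: "compatibility_forms \<Omega> \<T> \<tau> N \<phi>"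
    and e: "e \<in> fe_strains \<Omega> \<T> \<tau> N \<phi>"
  shows "\<exists>v\<in>pw. AE x in lebesgue_on \<Omega>. e x = sym_grad \<Omega> v x"
proof -
  have E: "e \<in> edge_strain_space \<Omega> \<T> \<tau>" using e by (simp add: fe_strains_def)
  have "\<forall>T\<in>\<T>. \<exists>C. AE x in lebesgue_on T. e x = C" using E by (simp add: edge_strain_space_def)
  then have "\<exists>C. \<forall>T\<in>\<T>. AE x in lebesgue_on T. e x = C T" by (rule bchoice)
  then obtain C where C: "\<forall>T\<in>\<T>. AE x in lebesgue_on T. e x = C T" by blast
  have "\<exists>v\<in>piecewise_affine \<T>. \<exists>A b. \<forall>T\<in>\<T>. sym_part (A T) = C T \<and> (\<forall>x\<in>T. v x = A T *v x + b T)"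
  proof (rule glue_displacements[OF sc])
    fix a assume a: "a \<in> mesh_vertices \<T>"
    have "\<forall>j<N a. \<phi> a j e = 0" using e a by (simp add: fe_strains_def)
    then obtain v where v: "v \<in> piecewise_affine (cells_at \<T> a)"
        "AE x in lebesgue_on (star \<T> a). sym_grad (interior (star \<T> a)) v x = e x"
      using compatibility_iff[OF \<phi> E a] by blast
    have "\<forall>T\<in>cells_at \<T> a. \<exists>A b. \<forall>x\<in>T. v x = A *v x + b" using v(1) by (simp add: piecewise_affine_def)
    then have "\<exists>A. \<forall>T\<in>cells_at \<T> a. \<exists>b. \<forall>x\<in>T. v x = A T *v x + b" by (rule bchoice)
    then obtain A where "\<forall>T\<in>cells_at \<T> a. \<exists>b. \<forall>x\<in>T. v x = A T *v x + b" by blast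
    then have "\<exists>b. \<forall>T\<in>cells_at \<T> a. \<forall>x\<in>T. v x = A T *v x + b T" by (rule bchoice)
    then obtain b where A: "\<And>T x. T \<in> cells_at \<T> a \<Longrightarrow> x \<in> T \<Longrightarrow> v x = A T *v x + b T" by blast
    have "sym_part (A T) = C T" if T: "T \<in> cells_at \<T> a" for T
    proof -
      have T': "T \<in> \<T>" using T cells_at_subset by blast
      have "AE x in lebesgue_on T. sym_grad (interior (star \<T> a)) v x = e x"
        by (rule AE_lebesgue_on_subset[OF v(2) _ star_sets cell_sets[OF T']]) (use T in \<open>auto simp: star_def\<close>)
      moreover have "AE x in lebesgue_on T. sym_grad (interior (star \<T> a)) v x = sym_part (A T)"
        by (rule star_cell_strain[where b = b, OF A T])
      ultimately have "AE x in lebesgue_on T. sym_part (A T) = C T"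
        using C[rule_format, OF T'] by eventually_elim simp
      then show ?thesis by (rule AE_cell_const[OF T'])
    qed
    then show "\<exists>v. \<forall>T\<in>cells_at \<T> a. \<exists>A b. sym_part A = C T \<and> (\<forall>x\<in>T. v x = A *v x + b)"
      using A by (intro exI[of _ v]) blast
  qed
  then obtain v A b where v: "v \<in> pw" "\<forall>T\<in>\<T>. sym_part (A T) = C T" "\<forall>T\<in>\<T>. \<forall>x\<in>T. v x = A T *v x + b T" by blast
  have "AE x in lebesgue_on \<Omega>. e x = sym_grad \<Omega> v x"
  proof (rule AE_cells_to_domain)
    fix T assume T: "T \<in> \<T>"
    show "AE x in lebesgue_on T. e x = sym_grad \<Omega> v x"
      using C[rule_format, OF T] pw_cell_strain[OF v(3) T] by eventually_elim (simp add: v(2) T)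
  qed
  then show ?thesis using v(1) by blast
qed

end

subsection \<open>The two energies\<close>

lemma attains_inf_iff: "attains_inf F S x \<longleftrightarrow> x \<in> S \<and> (\<forall>y\<in>S. F x \<le> F y)"
proof
  assume *: "attains_inf F S x"
  have "F x \<le> F y" if "y \<in> S" for y
  proof -
    have "ereal (F x) \<le> ereal (F y)" using * INF_lower[OF that, of "\<lambda>y. ereal (F y)"] by (simp add: attains_inf_def)
    then show ?thesis by simp
  qed
  then show "x \<in> S \<and> (\<forall>y\<in>S. F x \<le> F y)" using * by (simp add: attains_inf_def)
next
  assume *: "x \<in> S \<and> (\<forall>y\<in>S. F x \<le> F y)"
  then have "ereal (F x) = (INF y\<in>S. ereal (F y))"
    by (intro antisym INF_greatest INF_lower) auto
  then show "attains_inf F S x" using * by (simp add: attains_inf_def)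
qed

lemma quotient_lift_eqI: "c \<noteq> {} \<Longrightarrow> (\<And>v. v \<in> c \<Longrightarrow> F v = t) \<Longrightarrow> quotient_lift F c = t"
  unfolding quotient_lift_def by (rule the_equality) auto

lemma hooke_inner: "hooke lam mu e \<bullet> e' = lam * trace e * trace e' + 2 * mu * (e \<bullet> e')"
proof -
  have "mat 1 \<bullet> e' = trace e'" for e' :: "real^3^3"
    by (simp add: inner_vec_def mat_def trace_def if_distrib[of "\<lambda>x. x * _"] cong: if_cong)
  then show ?thesis by (simp add: hooke_def inner_add_left)
qed

lemma hooke_lincomb: "hooke lam mu (e + c *\<^sub>R e') = hooke lam mu e + c *\<^sub>R hooke lam mu e'"
proof -
  have "trace (e + c *\<^sub>R e') = trace e + c * trace e'" by (simp add: trace_def sum.distrib sum_distrib_left)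
  then show ?thesis by (simp add: hooke_def algebra_simps)
qed

lemma bounded_linear_hooke: "bounded_linear (hooke lam mu)"
proof -
  have "linear (hooke lam mu)"
  proof (rule linearI)
    show "hooke lam mu (e + e') = hooke lam mu e + hooke lam mu e'" for e e' using hooke_lincomb[of lam mu e 1 e'] by simp
    have z: "hooke lam mu 0 = 0" by (simp add: hooke_def trace_def)
    show "hooke lam mu (c *\<^sub>R e) = c *\<^sub>R hooke lam mu e" for c e using hooke_lincomb[of lam mu 0 c e] z by simp
  qed
  then show ?thesis by (simp add: linear_conv_bounded_linear)
qed

lemma L2_inner_integrable:
  fixes e e' :: "'a \<Rightarrow> 'b::euclidean_space"
  assumes "e \<in> Lp_space 2 M" "e' \<in> Lp_space 2 M" shows "integrable M (\<lambda>x. e x \<bullet> e' x)"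
proof (rule Bochner_Integration.integrable_bound)
  show "integrable M (\<lambda>x. (norm (e x))\<^sup>2 + (norm (e' x))\<^sup>2)" using assms by (simp add: L2_space_iff)
  show "(\<lambda>x. e x \<bullet> e' x) \<in> borel_measurable M" using assms by (intro borel_measurable_inner) (auto simp: L2_space_iff)
  have "\<bar>e x \<bullet> e' x\<bar> \<le> (norm (e x))\<^sup>2 + (norm (e' x))\<^sup>2" for x
  proof -
    have "2 * norm (e x) * norm (e' x) \<le> (norm (e x))\<^sup>2 + (norm (e' x))\<^sup>2" by (rule sum_squares_bound)
    moreover have "0 \<le> norm (e x) * norm (e' x)" by simp
    ultimately show ?thesis using Cauchy_Schwarz_ineq2[of "e x" "e' x"] by linarith
  qed
  then show "AE x in M. norm (e x \<bullet> e' x) \<le> norm ((norm (e x))\<^sup>2 + (norm (e' x))\<^sup>2)" by (intro AE_I2) simp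
qed

lemma integrable_inner_bounded:
  fixes f w :: "'a \<Rightarrow> 'b::euclidean_space"
  assumes "integrable M f" "w \<in> borel_measurable M" "\<And>x. x \<in> space M \<Longrightarrow> norm (w x) \<le> C"
  shows "integrable M (\<lambda>x. f x \<bullet> w x)"
proof (rule Bochner_Integration.integrable_bound)
  show "integrable M (\<lambda>x. C * norm (f x))" using assms(1) by simp
  show "(\<lambda>x. f x \<bullet> w x) \<in> borel_measurable M" using assms by (intro borel_measurable_inner) auto
  have "\<bar>f x \<bullet> w x\<bar> \<le> C * norm (f x)" if "x \<in> space M" for x
    using order_trans[OF Cauchy_Schwarz_ineq2[of "f x" "w x"] mult_left_mono[OF assms(3)[OF that] norm_ge_zero[of "f x"]]]
    by (simp add: mult.commute)
  then show "AE x in M. norm (f x \<bullet> w x) \<le> norm (C * norm (f x))"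
    by (intro AE_I2) (simp add: order_trans[OF _ abs_ge_self])
qed

locale elastic_mesh = mesh +
  fixes lam mu :: real and f g :: "real^3 \<Rightarrow> real^3"
  assumes data: "elasticity_data lam mu f g \<Omega>"
begin

lemma lam_pos: "lam > 0" and mu_pos: "mu > 0"
  using data by (auto simp: elasticity_data_def)

definition energy :: "(real^3 \<Rightarrow> real^3^3) \<Rightarrow> (real^3 \<Rightarrow> real^3^3) \<Rightarrow> real" where
  "energy e e' = (LINT x|lebesgue_on \<Omega>. hooke lam mu (e x) \<bullet> e' x)"

abbreviation strain where "strain \<equiv> sym_grad \<Omega>"

lemma hooke_L2:
  assumes "e \<in> Lp_space 2 (lebesgue_on \<Omega>)" shows "(\<lambda>x. hooke lam mu (e x)) \<in> Lp_space 2 (lebesgue_on \<Omega>)"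
proof -
  have e: "e \<in> borel_measurable (lebesgue_on \<Omega>)" "integrable (lebesgue_on \<Omega>) (\<lambda>x. (norm (e x))\<^sup>2)"
    using assms by (auto simp: L2_space_iff)
  obtain K where K: "\<And>x. norm (hooke lam mu x) \<le> norm x * K" "K > 0"
    using bounded_linear.pos_bounded[OF bounded_linear_hooke] by blast
  have m: "(\<lambda>x. hooke lam mu (e x)) \<in> borel_measurable (lebesgue_on \<Omega>)"
    using borel_measurable_continuous_on[OF linear_continuous_on[OF bounded_linear_hooke] e(1)] .
  have "integrable (lebesgue_on \<Omega>) (\<lambda>x. (norm (hooke lam mu (e x)))\<^sup>2)"
  proof (rule Bochner_Integration.integrable_bound)
    show "integrable (lebesgue_on \<Omega>) (\<lambda>x. K\<^sup>2 * (norm (e x))\<^sup>2)" using e by simp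
    show "(\<lambda>x. (norm (hooke lam mu (e x)))\<^sup>2) \<in> borel_measurable (lebesgue_on \<Omega>)"
      by (intro borel_measurable_power measurable_compose[OF m borel_measurable_norm])
    have "(norm (hooke lam mu (e x)))\<^sup>2 \<le> K\<^sup>2 * (norm (e x))\<^sup>2" for x
      using power_mono[OF K(1)[of "e x"] norm_ge_zero, of 2] by (simp add: power_mult_distrib mult.commute)
    then show "AE x in lebesgue_on \<Omega>. norm ((norm (hooke lam mu (e x)))\<^sup>2) \<le> norm (K\<^sup>2 * (norm (e x))\<^sup>2)"
      by (intro AE_I2) simp
  qed
  with m show ?thesis by (simp add: L2_space_iff)
qed

lemma energy_integrable:
  "e \<in> Lp_space 2 (lebesgue_on \<Omega>) \<Longrightarrow> e' \<in> Lp_space 2 (lebesgue_on \<Omega>) \<Longrightarrow>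
    integrable (lebesgue_on \<Omega>) (\<lambda>x. hooke lam mu (e x) \<bullet> e' x)"
  by (intro L2_inner_integrable hooke_L2)

lemma energy_cong:
  assumes L: "e \<in> Lp_space 2 (lebesgue_on \<Omega>)" "e' \<in> Lp_space 2 (lebesgue_on \<Omega>)"
      "d \<in> Lp_space 2 (lebesgue_on \<Omega>)" "d' \<in> Lp_space 2 (lebesgue_on \<Omega>)"
    and ae: "AE x in lebesgue_on \<Omega>. e x = d x" "AE x in lebesgue_on \<Omega>. e' x = d' x"
  shows "energy e e' = energy d d'"
  unfolding energy_def
proof (rule integral_cong_AE)
  show "AE x in lebesgue_on \<Omega>. hooke lam mu (e x) \<bullet> e' x = hooke lam mu (d x) \<bullet> d' x"
    using ae by eventually_elim simp
qed (use energy_integrable[OF L(1,2)] energy_integrable[OF L(3,4)] in auto)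

lemma strain_L2: "v \<in> H1 \<Omega> \<Longrightarrow> strain v \<in> Lp_space 2 (lebesgue_on \<Omega>)"
  by (rule sym_grad_L2)

lemma energy_sym: "energy e e' = energy e' e"
  unfolding energy_def hooke_inner by (simp add: inner_commute mult_ac)

lemma energy_lincomb:
  assumes "v \<in> H1 \<Omega>" "w \<in> H1 \<Omega>" "z \<in> H1 \<Omega>"
  shows "energy (strain (\<lambda>x. v x + c *\<^sub>R w x)) (strain z) = energy (strain v) (strain z) + c * energy (strain w) (strain z)"
proof -
  have "energy (strain (\<lambda>x. v x + c *\<^sub>R w x)) (strain z) = energy (\<lambda>x. strain v x + c *\<^sub>R strain w x) (strain z)"
    by (rule energy_cong)
       (use strain_L2[OF H1_lincomb(1)[OF assms(1,2)]] strain_L2[OF assms(3)] sym_grad_lincomb[OF assms(1,2)]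
         L2_space_lincomb[OF strain_L2[OF assms(1)] strain_L2[OF assms(2)]] in auto)
  also have "\<dots> = (LINT x|lebesgue_on \<Omega>. hooke lam mu (strain v x) \<bullet> strain z x + c * (hooke lam mu (strain w x) \<bullet> strain z x))"
    unfolding energy_def by (simp add: hooke_lincomb inner_add_left)
  also have "\<dots> = energy (strain v) (strain z) + c * energy (strain w) (strain z)"
    unfolding energy_def
    using energy_integrable[OF strain_L2[OF assms(1)] strain_L2[OF assms(3)]] energy_integrable[OF strain_L2[OF assms(2)] strain_L2[OF assms(3)]]
    by simp
  finally show ?thesis .
qed

lemma hooke_inner_nonneg: "0 \<le> hooke lam mu e \<bullet> e"
proof -
  have "0 \<le> lam * (trace e * trace e)" "0 \<le> 2 * (mu * (e \<bullet> e))" using lam_pos mu_pos by simp_all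
  then show ?thesis unfolding hooke_inner mult.assoc by linarith
qed

lemma energy_nonneg: "energy e e \<ge> 0"
  unfolding energy_def by (intro Bochner_Integration.integral_nonneg hooke_inner_nonneg)

text \<open>Both terms of \<open>hooke_inner\<close> are nonnegative, so the one with
  \<open>mu\<close> vanishes almost everywhere by itself.\<close>

lemma energy_zero:
  assumes e: "e \<in> Lp_space 2 (lebesgue_on \<Omega>)" and 0: "energy e e = 0"
  shows "AE x in lebesgue_on \<Omega>. e x = 0"
proof -
  have "AE x in lebesgue_on \<Omega>. hooke lam mu (e x) \<bullet> e x = 0"
    using integral_nonneg_eq_0_iff_AE[OF energy_integrable[OF e e]] 0
    unfolding energy_def by (simp add: hooke_inner_nonneg)
  then show ?thesis
  proof eventually_elim
    case (elim x)
    have "0 \<le> lam * trace (e x) * trace (e x)" "0 \<le> 2 * mu * (e x \<bullet> e x)"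
      using lam_pos mu_pos by (simp_all add: mult.assoc)
    then have "2 * mu * (e x \<bullet> e x) = 0" using elim unfolding hooke_inner by linarith
    then show ?case using mu_pos by simp
  qed
qed

lemma rigid_lincomb:
  assumes "r \<in> rigid \<Omega>" "s \<in> rigid \<Omega>" shows "(\<lambda>x. r x + c *\<^sub>R s x) \<in> rigid \<Omega>"
proof -
  have H: "r \<in> H1 \<Omega>" "s \<in> H1 \<Omega>" "AE x in lebesgue_on \<Omega>. strain r x = 0" "AE x in lebesgue_on \<Omega>. strain s x = 0"
    using assms by (auto simp: rigid_def)
  have "AE x in lebesgue_on \<Omega>. strain (\<lambda>x. r x + c *\<^sub>R s x) x = 0"
    using sym_grad_lincomb[OF H(1,2), of c] H(3,4) by eventually_elim simp
  then show ?thesis using H1_lincomb(1)[OF H(1,2)] by (simp add: rigid_def)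
qed

lemma affine_rigid:
  assumes "transpose W = - W" shows "(\<lambda>x. W *v x + b) \<in> rigid \<Omega>"
proof -
  have "AE x in lebesgue_on \<Omega>. strain (\<lambda>x. W *v x + b) x = 0"
    using affine_H1(2)[of W b] by eventually_elim (simp add: sym_grad_def assms)
  then show ?thesis using affine_H1(1) by (simp add: rigid_def)
qed

lemma zero_rigid: "(\<lambda>_. 0) \<in> rigid \<Omega>"
proof -
  have "transpose (0 :: real^3^3) = - 0" by (simp add: transpose_def vec_eq_iff)
  from affine_rigid[OF this, of 0] show ?thesis by simp
qed

section \<open>Classes modulo rigid displacements, and the load on them\<close>

definition cls :: "(real^3 \<Rightarrow> real^3) \<Rightarrow> (real^3 \<Rightarrow> real^3) set" where
  "cls v = rigid_rel \<Omega> `` {v}"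

lemma equiv_rigid_rel: "equiv (H1 \<Omega>) (rigid_rel \<Omega>)"
proof (rule equivI)
  show "rigid_rel \<Omega> \<subseteq> H1 \<Omega> \<times> H1 \<Omega>" by (auto simp: rigid_rel_def)
  show "refl_on (H1 \<Omega>) (rigid_rel \<Omega>)"
    by (rule refl_onI) (use zero_rigid in \<open>auto simp: rigid_rel_def\<close>)
  show "sym (rigid_rel \<Omega>)"
  proof (rule symI)
    fix v w assume "(v, w) \<in> rigid_rel \<Omega>"
    then have "v \<in> H1 \<Omega>" "w \<in> H1 \<Omega>" "(\<lambda>x. v x - w x) \<in> rigid \<Omega>" by (auto simp: rigid_rel_def)
    moreover from rigid_lincomb[OF zero_rigid this(3), of "-1"] have "(\<lambda>x. w x - v x) \<in> rigid \<Omega>" by simp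
    ultimately show "(w, v) \<in> rigid_rel \<Omega>" by (simp add: rigid_rel_def)
  qed
  show "trans (rigid_rel \<Omega>)"
  proof (rule transI)
    fix v w z assume "(v, w) \<in> rigid_rel \<Omega>" "(w, z) \<in> rigid_rel \<Omega>"
    then have *: "v \<in> H1 \<Omega>" "z \<in> H1 \<Omega>" "(\<lambda>x. v x - w x) \<in> rigid \<Omega>" "(\<lambda>x. w x - z x) \<in> rigid \<Omega>" by (auto simp: rigid_rel_def)
    from rigid_lincomb[OF *(3,4), of 1] have "(\<lambda>x. v x - z x) \<in> rigid \<Omega>" by simp
    then show "(v, z) \<in> rigid_rel \<Omega>" using * by (simp add: rigid_rel_def)
  qed
qed

lemma cls_memD:
  assumes "w \<in> cls v"
  shows "v \<in> H1 \<Omega>" "w \<in> H1 \<Omega>" "(\<lambda>x. v x - w x) \<in> rigid \<Omega>"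
  using assms by (auto simp: cls_def rigid_rel_def)

lemma cls_self: "v \<in> H1 \<Omega> \<Longrightarrow> v \<in> cls v"
  unfolding cls_def by (rule equiv_class_self[OF equiv_rigid_rel])

lemma cls_eqI:
  assumes "v \<in> H1 \<Omega>" "w \<in> H1 \<Omega>" "AE x in lebesgue_on \<Omega>. strain v x = strain w x" shows "cls v = cls w"
proof -
  have "AE x in lebesgue_on \<Omega>. strain (\<lambda>x. v x + (-1) *\<^sub>R w x) x = 0"
    using sym_grad_lincomb[OF assms(1,2), of "-1"] assms(3) by eventually_elim simp
  then have "(\<lambda>x. v x - w x) \<in> rigid \<Omega>" using H1_lincomb(1)[OF assms(1,2), of "-1"] by (simp add: rigid_def)
  then have "(v, w) \<in> rigid_rel \<Omega>" using assms by (simp add: rigid_rel_def)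
  then show ?thesis unfolding cls_def by (rule equiv_class_eq[OF equiv_rigid_rel])
qed

lemma cls_strain:
  assumes "w \<in> cls v" shows "AE x in lebesgue_on \<Omega>. strain w x = strain v x"
proof -
  note H = cls_memD[OF assms]
  have "AE x in lebesgue_on \<Omega>. strain (\<lambda>x. v x + (-1) *\<^sub>R w x) x = 0" using H(3) by (simp add: rigid_def)
  then show ?thesis using sym_grad_lincomb[OF H(1,2), of "-1"] by eventually_elim simp
qed

text \<open>Makes \<open>g\<close> integrable over the boundary. Its product with a bounded field is
  then integrable too, and the surface term is linear on piecewise affine fields.\<close>

lemma finite_surface_measure: "finite_measure (surface_measure \<Omega>)"
proof (rule finite_measureI)
  have "emeasure (surface_measure \<Omega>) (space (surface_measure \<Omega>)) = emeasure (hausdorff_measure 2) (frontier \<Omega>)"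
    unfolding surface_measure_def by (subst emeasure_restrict_space) (auto simp: space_restrict_space)
  also have "\<dots> = hausdorff_outer 2 (frontier \<Omega>)"
    by (rule emeasure_hausdorff_measure) auto
  also have "\<dots> \<le> hausdorff_outer 2 (\<Union>T\<in>\<T>. frontier T)" by (rule hausdorff_outer_mono[OF frontier_subset])
  also have "\<dots> < top"
    by (rule hausdorff_outer_finite_Union[OF finite_mesh _ hausdorff_outer_frontier_simplex[OF cell_simplex]]) auto
  finally show "emeasure (surface_measure \<Omega>) (space (surface_measure \<Omega>)) \<noteq> \<infinity>" by auto
qed

lemma f_integrable: "integrable (lebesgue_on \<Omega>) f"
  by (rule Lp_space_integrable[of _ "6/5"]) (use data finite_meas in \<open>auto simp: elasticity_data_def\<close>)

lemma g_integrable: "integrable (surface_measure \<Omega>) g"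
  by (rule Lp_space_integrable[of _ "4/3"]) (use data finite_surface_measure in \<open>auto simp: elasticity_data_def\<close>)

lemma space_surface_measure: "space (surface_measure \<Omega>) = frontier \<Omega>"
  by (simp add: surface_measure_def space_restrict_space)

lemma pw_bounded:
  assumes "v \<in> pw" obtains C where "\<And>x. x \<in> closure \<Omega> \<Longrightarrow> norm (v x) \<le> C"
proof -
  have "compact (v ` closure \<Omega>)"
    using pw_continuous[OF assms] bounded_domain by (intro compact_continuous_image) (auto simp: compact_eq_bounded_closed)
  then have "bounded (v ` closure \<Omega>)" by (rule compact_imp_bounded)
  then show ?thesis using that unfolding bounded_iff by blast
qed

lemma pw_integrable:
  assumes v: "v \<in> pw"
  shows "integrable (lebesgue_on \<Omega>) (\<lambda>x. f x \<bullet> v x)" "integrable (surface_measure \<Omega>) (\<lambda>x. g x \<bullet> v x)"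
proof -
  obtain C where C: "\<And>x. x \<in> closure \<Omega> \<Longrightarrow> norm (v x) \<le> C" using pw_bounded[OF v] by blast
  have vm: "v \<in> borel_measurable (lebesgue_on \<Omega>)" using H1_L2[OF pw_H1[OF v]] by (simp add: L2_space_iff)
  show "integrable (lebesgue_on \<Omega>) (\<lambda>x. f x \<bullet> v x)"
    by (rule integrable_inner_bounded[OF f_integrable vm]) (use C closure_subset in auto)
  have fr: "frontier \<Omega> \<subseteq> closure \<Omega>" by (auto simp: frontier_def)
  have "v \<in> borel_measurable (restrict_space borel (frontier \<Omega>))"
    by (rule borel_measurable_continuous_on_restrict[OF continuous_on_subset[OF pw_continuous[OF v] fr]])
  moreover have "sets (surface_measure \<Omega>) = sets (restrict_space borel (frontier \<Omega>))"
    unfolding surface_measure_def by (rule sets_restrict_space_cong) simp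
  ultimately have "v \<in> borel_measurable (surface_measure \<Omega>)"
    using measurable_cong_sets by blast
  then show "integrable (surface_measure \<Omega>) (\<lambda>x. g x \<bullet> v x)"
    by (rule integrable_inner_bounded[OF g_integrable]) (use C fr space_surface_measure in auto)
qed

text \<open>Both parts of the load ignore null sets of the domain: the volume integral directly, the
  surface integral because the trace of \<open>w\<close> is the continuous boundary value of
  \<open>v\<close>.\<close>

lemma load_AE_pw:
  assumes v: "v \<in> pw" and w: "w \<in> H1 \<Omega>" "AE x in lebesgue_on \<Omega>. w x = v x"
  shows "load f g \<Omega> w = (LINT x|lebesgue_on \<Omega>. f x \<bullet> v x) + (LINT x|surface_measure \<Omega>. g x \<bullet> v x)"
proof -
  have m: "f \<in> borel_measurable (lebesgue_on \<Omega>)" "v \<in> borel_measurable (lebesgue_on \<Omega>)" "w \<in> borel_measurable (lebesgue_on \<Omega>)"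
    using f_integrable H1_L2[OF pw_H1[OF v]] H1_L2[OF w(1)] by (auto simp: L2_space_iff)
  have "(LINT x|lebesgue_on \<Omega>. f x \<bullet> w x) = (LINT x|lebesgue_on \<Omega>. f x \<bullet> v x)"
    by (rule integral_cong_AE) (use m w(2) in \<open>auto elim: eventually_mono intro: borel_measurable_inner\<close>)
  moreover have "(LINT x|surface_measure \<Omega>. g x \<bullet> boundary_trace \<Omega> w x) = (LINT x|surface_measure \<Omega>. g x \<bullet> v x)"
  proof (rule Bochner_Integration.integral_cong[OF refl])
    fix x assume "x \<in> space (surface_measure \<Omega>)"
    then have "boundary_trace \<Omega> w x = v x"
      using boundary_trace_continuous[OF pw_continuous[OF v] _ m(3) w(2), of x] space_surface_measure by simp
    then show "g x \<bullet> boundary_trace \<Omega> w x = g x \<bullet> v x" by simp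
  qed
  ultimately show ?thesis by (simp add: load_def)
qed

lemma load_pw: "v \<in> pw \<Longrightarrow> load f g \<Omega> v = (LINT x|lebesgue_on \<Omega>. f x \<bullet> v x) + (LINT x|surface_measure \<Omega>. g x \<bullet> v x)"
  by (rule load_AE_pw[OF _ pw_H1]) auto

lemma load_lincomb:
  assumes "v \<in> pw" "w \<in> pw"
  shows "load f g \<Omega> (\<lambda>x. v x + c *\<^sub>R w x) = load f g \<Omega> v + c * load f g \<Omega> w"
  unfolding load_pw[OF pw_lincomb[OF assms]] load_pw[OF assms(1)] load_pw[OF assms(2)]
  using pw_integrable[OF assms(1)] pw_integrable[OF assms(2)]
  by (simp add: inner_add_right algebra_simps)

lemma load_rigid: "r \<in> rigid \<Omega> \<Longrightarrow> load f g \<Omega> r = 0"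
  using data by (simp add: elasticity_data_def)

text \<open>Linearity of the load is established for piecewise affine fields. So \<open>w\<close> is
  traded for \<open>v\<close> minus an affine rigid field, which equals \<open>w\<close> almost
  everywhere and is again piecewise affine.\<close>

lemma load_cls:
  assumes v: "v \<in> pw" and w: "w \<in> cls v"
  shows "load f g \<Omega> w = load f g \<Omega> v"
proof -
  note H = cls_memD[OF w]
  obtain W b where W: "transpose W = - W" "AE x in lebesgue_on \<Omega>. v x - w x = W *v x + b"
    using rigid_affine_AE[OF connected_domain H(3)] by blast
  let ?r = "\<lambda>x. W *v x + b"
  have ae: "AE x in lebesgue_on \<Omega>. w x = v x + (-1) *\<^sub>R ?r x"
    using W(2) by eventually_elim (simp add: algebra_simps)
  have pwv: "(\<lambda>x. v x + (-1) *\<^sub>R ?r x) \<in> pw" by (rule pw_lincomb[OF v affine_pw])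
  have "load f g \<Omega> w = load f g \<Omega> (\<lambda>x. v x + (-1) *\<^sub>R ?r x)"
    unfolding load_AE_pw[OF pwv H(2) ae] load_pw[OF pwv] ..
  also have "\<dots> = load f g \<Omega> v" using load_lincomb[OF v affine_pw, of "-1" W b] load_rigid[OF affine_rigid[OF W(1)]] by simp
  finally show ?thesis .
qed

section \<open>From the strain problem to the displacement problem\<close>

lemma displacement_energy_eq:
  "displacement_energy lam mu f g \<Omega> v = (1/2) * energy (strain v) (strain v) - load f g \<Omega> v"
  by (simp add: displacement_energy_def energy_def)

lemma displacement_energy_cls:
  assumes "v \<in> pw"
  shows "displacement_energy_dot lam mu f g \<Omega> (cls v) = displacement_energy lam mu f g \<Omega> v"
  unfolding displacement_energy_dot_def
proof (rule quotient_lift_eqI)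
  show "cls v \<noteq> {}" using cls_self[OF pw_H1[OF assms]] by blast
  fix w assume w: "w \<in> cls v"
  have "energy (strain w) (strain w) = energy (strain v) (strain v)"
    using strain_L2[OF cls_memD(1)[OF w]] strain_L2[OF cls_memD(2)[OF w]] cls_strain[OF w] by (intro energy_cong) auto
  then show "displacement_energy lam mu f g \<Omega> w = displacement_energy lam mu f g \<Omega> v"
    by (simp add: displacement_energy_eq load_cls[OF assms w])
qed

text \<open>\<open>kappa\<close> is meaningful at \<open>e\<close> because strains of displacements
  satisfy the double curl condition; the description is unique because displacements with equal
  strains differ by a rigid one.\<close>

lemma kappa_eq_cls:
  assumes v: "v \<in> H1 \<Omega>" and e: "e \<in> Lp_space 2 (lebesgue_on \<Omega>)" "AE x in lebesgue_on \<Omega>. e x = strain v x"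
  shows "kappa \<Omega> e = cls v"
proof -
  have es: "e \<in> strain_space \<Omega>" by (rule sym_grad_strain_space[OF v e])
  have "(THE c. c \<in> H1_dot \<Omega> \<and> is_class_strain \<Omega> c e) = cls v"
  proof (rule the_equality)
    have "is_class_strain \<Omega> (cls v) e"
      unfolding is_class_strain_def
    proof
      fix w assume "w \<in> cls v"
      from cls_strain[OF this] e(2) show "AE x in lebesgue_on \<Omega>. strain w x = e x" by eventually_elim simp
    qed
    then show "cls v \<in> H1_dot \<Omega> \<and> is_class_strain \<Omega> (cls v) e"
      using v by (auto simp: H1_dot_def cls_def intro: quotientI)
    fix c assume c: "c \<in> H1_dot \<Omega> \<and> is_class_strain \<Omega> c e"
    then obtain w where w: "w \<in> H1 \<Omega>" "c = cls w" unfolding H1_dot_def cls_def by (auto elim: quotientE)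
    then have "AE x in lebesgue_on \<Omega>. strain w x = e x" using c cls_self[OF w(1)] by (simp add: is_class_strain_def)
    with e(2) have "AE x in lebesgue_on \<Omega>. strain w x = strain v x" by eventually_elim simp
    then show "c = cls v" using cls_eqI[OF w(1) v] w(2) by simp
  qed
  then show ?thesis using es by (simp add: kappa_def)
qed

lemma strain_energy_eq:
  assumes v: "v \<in> pw" and e: "e \<in> Lp_space 2 (lebesgue_on \<Omega>)" "AE x in lebesgue_on \<Omega>. e x = strain v x"
  shows "strain_energy lam mu f g \<Omega> e = displacement_energy lam mu f g \<Omega> v"
proof -
  note H = pw_H1[OF v]
  have "quotient_lift (load f g \<Omega>) (kappa \<Omega> e) = load f g \<Omega> v"
    unfolding kappa_eq_cls[OF H e]
  proof (rule quotient_lift_eqI)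
    show "cls v \<noteq> {}" using cls_self[OF H] by blast
  qed (rule load_cls[OF v])
  moreover have "energy e e = energy (strain v) (strain v)"
    by (rule energy_cong[OF e(1,1) strain_L2[OF H] strain_L2[OF H] e(2,2)])
  ultimately show ?thesis by (simp add: strain_energy_def displacement_energy_eq energy_def)
qed

lemma pw_strain_zero:
  assumes "v \<in> pw" "\<And>T. T \<in> \<T> \<Longrightarrow> cell_value (strain v) T = 0"
  shows "AE x in lebesgue_on \<Omega>. strain v x = 0"
proof (rule AE_cells_to_domain)
  fix T assume T: "T \<in> \<T>"
  show "AE x in lebesgue_on T. strain v x = 0" using pw_cell_value[OF assms(1) T] assms(2)[OF T] by simp
qed

text \<open>The coordinates are the entries of the strain matrices on the cells. A nonzero entry
  forces positive energy; if all vanish the field is rigid, so the form and the load vanish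
  too.\<close>

lemma galerkin_solution: "\<exists>u\<in>pw. \<forall>w\<in>pw. energy (strain u) (strain w) = load f g \<Omega> w"
proof (rule riesz_finite_coordinates[where I = "\<T> \<times> (UNIV :: (3 \<times> 3) set)"
      and \<kappa> = "\<lambda>(T, i, j) v. cell_value (strain v) T $ i $ j"
      and a = "\<lambda>v w. energy (strain v) (strain w)"])
  let ?I = "\<T> \<times> (UNIV :: (3 \<times> 3) set)" and ?\<kappa> = "\<lambda>(T, i, j) v. cell_value (strain v) T $ i $ j"
  show "finite ?I" using finite_mesh by simp
  show "(\<lambda>_. 0) \<in> pw" by (rule zero_pw)
  show "(\<lambda>x. v x + c *\<^sub>R w x) \<in> pw" if "v \<in> pw" "w \<in> pw" for v w c by (rule pw_lincomb[OF that])
  show "?\<kappa> i (\<lambda>x. v x + c *\<^sub>R w x) = ?\<kappa> i v + c * ?\<kappa> i w" if "i \<in> ?I" "v \<in> pw" "w \<in> pw" for i v w c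
    using that cell_value_lincomb[OF that(2,3)] by (auto simp: case_prod_beta)
  show "energy (strain (\<lambda>x. v x + c *\<^sub>R w x)) (strain z) = energy (strain v) (strain z) + c * energy (strain w) (strain z)"
    if "v \<in> pw" "w \<in> pw" "z \<in> pw" for v w z c
    by (rule energy_lincomb) (use that pw_H1 in auto)
  show "energy (strain v) (strain w) = energy (strain w) (strain v)" for v w by (rule energy_sym)
  have null: "AE x in lebesgue_on \<Omega>. strain v x = 0" if "v \<in> pw" "\<And>i. i \<in> ?I \<Longrightarrow> ?\<kappa> i v = 0" for v
  proof (rule pw_strain_zero[OF that(1)])
    fix T assume "T \<in> \<T>"
    then have "cell_value (strain v) T $ i $ j = 0" for i j using that(2)[of "(T, i, j)"] by simp
    then show "cell_value (strain v) T = 0" by (simp add: vec_eq_iff)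
  qed
  have zL: "(\<lambda>_. 0 :: real^3^3) \<in> Lp_space 2 (lebesgue_on \<Omega>)" by (simp add: L2_space_iff)
  show "0 < energy (strain v) (strain v)" if v: "v \<in> pw" and i: "i \<in> ?I" "?\<kappa> i v \<noteq> 0" for v i
  proof (rule ccontr)
    assume "\<not> 0 < energy (strain v) (strain v)"
    then have "energy (strain v) (strain v) = 0" using energy_nonneg[of "strain v"] by linarith
    then have ae: "AE x in lebesgue_on \<Omega>. strain v x = 0" by (rule energy_zero[OF strain_L2[OF pw_H1[OF v]]])
    obtain T k l where T: "i = (T, k, l)" "T \<in> \<T>" using i(1) by auto
    have "cell_value (strain v) T = 0" by (rule cell_value_eqI[OF T(2) AE_domain_to_cell[OF ae T(2)]])
    then show False using i(2) T(1) by simp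
  qed
  show "energy (strain v) (strain w) = 0" if v: "v \<in> pw" and w: "w \<in> pw" and 0: "\<And>i. i \<in> ?I \<Longrightarrow> ?\<kappa> i v = 0" for v w
  proof -
    have "energy (strain v) (strain w) = energy (\<lambda>_. 0) (strain w)"
      using strain_L2[OF pw_H1[OF v]] strain_L2[OF pw_H1[OF w]] zL null[OF v 0] by (intro energy_cong) auto
    then show ?thesis by (simp add: energy_def hooke_inner trace_def)
  qed
  show "load f g \<Omega> (\<lambda>x. v x + c *\<^sub>R w x) = load f g \<Omega> v + c * load f g \<Omega> w" if "v \<in> pw" "w \<in> pw" for v w c
    by (rule load_lincomb[OF that])
  show "load f g \<Omega> v = 0" if v: "v \<in> pw" and 0: "\<And>i. i \<in> ?I \<Longrightarrow> ?\<kappa> i v = 0" for v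
    by (rule load_rigid) (use null[OF v 0] pw_H1[OF v] in \<open>simp add: rigid_def\<close>)
qed

text \<open>Completion of the square: the Galerkin equation for \<open>u\<close> cancels the first
  variation, leaving the energy of the difference.\<close>

lemma displacement_energy_expand:
  assumes u: "u \<in> pw" "\<forall>w\<in>pw. energy (strain u) (strain w) = load f g \<Omega> w" and w: "w \<in> pw"
  shows "displacement_energy lam mu f g \<Omega> w = displacement_energy lam mu f g \<Omega> u
    + (1/2) * energy (strain (\<lambda>x. w x + (-1) *\<^sub>R u x)) (strain (\<lambda>x. w x + (-1) *\<^sub>R u x))"
proof -
  note H = pw_H1[OF u(1)] pw_H1[OF w]
  let ?d = "\<lambda>x. w x + (-1) *\<^sub>R u x"
  have d: "?d \<in> H1 \<Omega>" by (rule H1_lincomb(1)[OF H(2,1)])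
  have 1: "energy (strain ?d) (strain ?d) = energy (strain w) (strain ?d) + (-1) * energy (strain u) (strain ?d)"
    by (rule energy_lincomb[OF H(2,1) d])
  have 2: "energy (strain w) (strain ?d) = energy (strain w) (strain w) + (-1) * energy (strain u) (strain w)"
    using energy_lincomb[OF H(2,1) H(2), of "-1"] energy_sym[of "strain w" "strain ?d"] by simp
  have 3: "energy (strain u) (strain ?d) = energy (strain u) (strain w) + (-1) * energy (strain u) (strain u)"
    using energy_lincomb[OF H(2,1) H(1), of "-1"] energy_sym[of "strain u" "strain ?d"] energy_sym[of "strain u" "strain w"] by simp
  have 4: "energy (strain u) (strain w) = load f g \<Omega> w" "energy (strain u) (strain u) = load f g \<Omega> u" using u w by auto
  show ?thesis unfolding displacement_energy_eq 1 2 3 4 by (simp add: field_simps)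
qed

end

theorem theorem4p1:
  fixes \<Omega> :: "(real^3) set"
    and \<T> :: "(real^3) set set"
    and \<tau> :: "(real^3) set \<Rightarrow> real^3"
    and N :: "real^3 \<Rightarrow> nat"
    and \<phi> :: "real^3 \<Rightarrow> nat \<Rightarrow> (real^3 \<Rightarrow> real^3^3) \<Rightarrow> real"
    and lam mu :: real
    and f g :: "real^3 \<Rightarrow> real^3"
  assumes "polyhedral_domain \<Omega>"
    and "simply_connected \<Omega>"
    and "elasticity_data lam mu f g \<Omega>"
    and "tetrahedral_mesh \<Omega> \<T>"
    and "edge_tangents \<T> \<tau>"
    and "compatibility_forms \<Omega> \<T> \<tau> N \<phi>"
  shows "\<exists>\<epsilon> u.
     attains_inf (strain_energy lam mu f g \<Omega>) (fe_strains \<Omega> \<T> \<tau> N \<phi>) \<epsilon> \<and>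
     (\<forall>e. attains_inf (strain_energy lam mu f g \<Omega>) (fe_strains \<Omega> \<T> \<tau> N \<phi>) e
            \<longrightarrow> (AE x in lebesgue_on \<Omega>. e x = \<epsilon> x)) \<and>
     attains_inf (displacement_energy_dot lam mu f g \<Omega>) (fe_displacements_dot \<Omega> \<T>) u \<and>
     (\<forall>w. attains_inf (displacement_energy_dot lam mu f g \<Omega>) (fe_displacements_dot \<Omega> \<T>) w
            \<longrightarrow> w = u) \<and>
     is_class_strain \<Omega> u \<epsilon>"
proof -
  interpret elastic_mesh \<Omega> \<T> lam mu f g
    by unfold_locales (use assms in \<open>auto simp: polyhedral_domain_def\<close>)
  let ?V = "piecewise_affine \<T>" and ?E = "fe_strains \<Omega> \<T> \<tau> N \<phi>"
  let ?J = "displacement_energy lam mu f g \<Omega>" and ?j = "strain_energy lam mu f g \<Omega>"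
    and ?Jd = "displacement_energy_dot lam mu f g \<Omega>"
  obtain u where u: "u \<in> ?V" "\<forall>w\<in>?V. energy (strain u) (strain w) = load f g \<Omega> w"
    using galerkin_solution by blast
  have min: "?J u \<le> ?J w" if "w \<in> ?V" for w
    unfolding displacement_energy_expand[OF u that]
    using energy_nonneg[of "strain (\<lambda>x. w x + (-1) *\<^sub>R u x)"] by linarith
  \<comment> \<open>The expansion leaves no room for a positive quadratic remainder, so the
    difference has zero energy and hence zero strain.\<close>
  have uniq: "AE x in lebesgue_on \<Omega>. strain w x = strain u x" if w: "w \<in> ?V" and le: "?J w \<le> ?J u" for w
  proof -
    let ?d = "\<lambda>x. w x + (-1) *\<^sub>R u x"
    have "energy (strain ?d) (strain ?d) = 0"
      using le energy_nonneg[of "strain ?d"] unfolding displacement_energy_expand[OF u w] by linarith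
    then have "AE x in lebesgue_on \<Omega>. strain ?d x = 0"
      by (rule energy_zero[OF strain_L2[OF H1_lincomb(1)[OF pw_H1[OF w] pw_H1[OF u(1)]]]])
    then show ?thesis using sym_grad_lincomb[OF pw_H1[OF w] pw_H1[OF u(1)], of "-1"] by eventually_elim simp
  qed
  have EL: "e \<in> Lp_space 2 (lebesgue_on \<Omega>)" if "e \<in> ?E" for e using that by (simp add: fe_strains_def edge_strain_space_def)
  have uE: "strain u \<in> ?E" by (rule sym_grad_fe_strain[OF u(1) assms(5,6)])
  have ju: "?j (strain u) = ?J u" by (rule strain_energy_eq[OF u(1) EL[OF uE]]) simp
  \<comment> \<open>Every competitor of the strain problem is carried, with its energy, to a
    competitor of the displacement problem. The fact \<open>D\<close> does the same for classes, so
    \<open>min\<close> and \<open>uniq\<close> serve both problems.\<close>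
  have E: "\<exists>w\<in>?V. (AE x in lebesgue_on \<Omega>. e x = strain w x) \<and> ?j e = ?J w" if e: "e \<in> ?E" for e
  proof -
    obtain w where w: "w \<in> ?V" "AE x in lebesgue_on \<Omega>. e x = strain w x"
      using fe_strain_imp_sym_grad[OF assms(2,6) e] by blast
    then show ?thesis using strain_energy_eq[OF w(1) EL[OF e] w(2)] by blast
  qed
  have D: "\<exists>w\<in>?V. c = cls w \<and> ?Jd c = ?J w" if c: "c \<in> fe_displacements_dot \<Omega> \<T>" for c
  proof -
    obtain w where "w \<in> ?V" "c = cls w"
      using c unfolding fe_displacements_dot_def cls_def by (auto elim: quotientE)
    then show ?thesis using displacement_energy_cls by blast
  qed
  have 1: "attains_inf ?j ?E (strain u)"
    unfolding attains_inf_iff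
  proof (intro conjI ballI uE)
    fix e assume "e \<in> ?E"
    then obtain w where "w \<in> ?V" "?j e = ?J w" using E by blast
    then show "?j (strain u) \<le> ?j e" using min ju by simp
  qed
  have 2: "AE x in lebesgue_on \<Omega>. e x = strain u x" if "attains_inf ?j ?E e" for e
  proof -
    have e: "e \<in> ?E" "?j e \<le> ?j (strain u)" using that uE by (auto simp: attains_inf_iff)
    obtain w where w: "w \<in> ?V" "AE x in lebesgue_on \<Omega>. e x = strain w x" "?j e = ?J w" using E[OF e(1)] by blast
    have "AE x in lebesgue_on \<Omega>. strain w x = strain u x" by (rule uniq[OF w(1)]) (use e(2) w(3) ju in simp)
    with w(2) show ?thesis by eventually_elim simp
  qed
  have uD: "cls u \<in> fe_displacements_dot \<Omega> \<T>"
    unfolding fe_displacements_dot_def cls_def by (rule quotientI[OF u(1)])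
  have 3: "attains_inf ?Jd (fe_displacements_dot \<Omega> \<T>) (cls u)"
    unfolding attains_inf_iff
  proof (intro conjI ballI uD)
    fix c assume "c \<in> fe_displacements_dot \<Omega> \<T>"
    then obtain w where "w \<in> ?V" "?Jd c = ?J w" using D by blast
    then show "?Jd (cls u) \<le> ?Jd c" using min displacement_energy_cls[OF u(1)] by simp
  qed
  have 4: "c = cls u" if "attains_inf ?Jd (fe_displacements_dot \<Omega> \<T>) c" for c
  proof -
    have c: "c \<in> fe_displacements_dot \<Omega> \<T>" "?Jd c \<le> ?Jd (cls u)" using that uD by (auto simp: attains_inf_iff)
    obtain w where w: "w \<in> ?V" "c = cls w" "?Jd c = ?J w" using D[OF c(1)] by blast
    have "AE x in lebesgue_on \<Omega>. strain w x = strain u x"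
      by (rule uniq[OF w(1)]) (use c(2) w(3) displacement_energy_cls[OF u(1)] in simp)
    then show ?thesis using cls_eqI[OF pw_H1[OF w(1)] pw_H1[OF u(1)]] w(2) by simp
  qed
  have 5: "is_class_strain \<Omega> (cls u) (strain u)"
    unfolding is_class_strain_def using cls_strain by blast
  show ?thesis using 1 2 3 4 5 by blast
qed

end
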